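(* Consider the classical Hammersley model. There exists a constant $c_1>0$ such that for all $t>0$ and all $r>0$, $$\mathbb{P}\big(Z_1(t,t)>r\,\mathbb{E}Z^+_1(t,t)\big)\le\frac{c_1t^2}{\big(\mathbb{E}Z^+_1(t,t)\big)^3}\Big(\frac1{r^3}+\frac1{r^4}\Big).$$
   Context: Let $\mathbf P$ be a homogeneous Poisson process of intensity one in $\mathbb R\times(0,\infty)$, all weights equal to $1$; $L(\mathbf p,\mathbf q)$ is the maximal number of points of $\mathbf P$ in a coordinatewise increasing chain inside $\{\mathbf x:p_1<x_1\le q_1,\ p_2<x_2\le q_2\}$. Let $\nu_1$ be a homogeneous Poisson process of intensity $1$ on $\mathbb R$, independent of $\mathbf P$, with counting function $\nu_1(x)=\nu_1((0,x])$ for $x\ge0$, $\nu_1(x)=-\nu_1((x,0])$ for $x<0$. Define $L_1(x,t)=\sup_{z\le x}\{\nu_1(z)+L((z,0),(x,t))\}$, the exit point $Z_1(x,t)=\sup\{z\le x: L_1(x,t)=\nu_1(z)+L((z,0),(x,t))\}$, and $Z^+_1=\max(Z_1,0)$. *)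

theory Defs
  imports "HOL-Probability.Probability"
begin

definition bset2 :: "(real \<times> real) set \<Rightarrow> bool" where
  "bset2 B \<longleftrightarrow> B \<in> sets borel \<and> bounded B \<and> B \<subseteq> UNIV \<times> {0<..}"

definition bset1 :: "real set \<Rightarrow> bool" where
  "bset1 C \<longleftrightarrow> C \<in> sets borel \<and> bounded C"

definition indep_poisson_pair ::
  "'a measure \<Rightarrow> ('a \<Rightarrow> (real \<times> real) set) \<Rightarrow> ('a \<Rightarrow> real set) \<Rightarrow> bool" where
  "indep_poisson_pair M P N \<longleftrightarrow>
     prob_space M \<and>
     (\<forall>\<omega>\<in>space M. P \<omega> \<subseteq> UNIV \<times> {0<..} \<and>
        (\<forall>B. bounded B \<longrightarrow> finite (P \<omega> \<inter> B)) \<and>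
        (\<forall>C. bounded C \<longrightarrow> finite (N \<omega> \<inter> C))) \<and>
     (\<forall>B. bset2 B \<longrightarrow> (\<forall>k::nat.
        measure M {\<omega> \<in> space M. card (P \<omega> \<inter> B) = k}
          = (measure lborel B) ^ k / fact k * exp (- measure lborel B))) \<and>
     (\<forall>C. bset1 C \<longrightarrow> (\<forall>k::nat.
        measure M {\<omega> \<in> space M. card (N \<omega> \<inter> C) = k}
          = (measure lborel C) ^ k / fact k * exp (- measure lborel C))) \<and>
     (\<forall>(I::nat set) (J::nat set) Bs Cs. finite I \<and> finite J \<and>
        (\<forall>i\<in>I. bset2 (Bs i)) \<and> (\<forall>j\<in>J. bset1 (Cs j)) \<and>
        disjoint_family_on Bs I \<and> disjoint_family_on Cs J \<longrightarrow>
        prob_space.indep_vars M (\<lambda>_. count_space (UNIV :: nat set))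
          (\<lambda>ij \<omega>. case ij of Inl i \<Rightarrow> card (P \<omega> \<inter> Bs i) | Inr j \<Rightarrow> card (N \<omega> \<inter> Cs j))
          (I <+> J))"

definition incr_chain :: "(real \<times> real) set \<Rightarrow> bool" where
  "incr_chain S \<longleftrightarrow> (\<forall>x\<in>S. \<forall>y\<in>S. x \<noteq> y \<longrightarrow>
      (fst x < fst y \<and> snd x < snd y) \<or> (fst y < fst x \<and> snd y < snd x))"

definition LPP :: "(real \<times> real) set \<Rightarrow> real \<times> real \<Rightarrow> real \<times> real \<Rightarrow> nat" where
  "LPP Q p q = Sup {card S | S. finite S \<and> incr_chain S \<and>
      S \<subseteq> Q \<inter> {x. fst p < fst x \<and> fst x \<le> fst q \<and> snd p < snd x \<and> snd x \<le> snd q}}"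

definition nu_count :: "real set \<Rightarrow> real \<Rightarrow> real" where
  "nu_count N x = (if 0 \<le> x then real (card (N \<inter> {0<..x}))
                   else - real (card (N \<inter> {x<..0})))"

definition L1 :: "(real \<times> real) set \<Rightarrow> real set \<Rightarrow> real \<Rightarrow> real \<Rightarrow> real" where
  "L1 Q N x t = Sup ((\<lambda>z. nu_count N z + real (LPP Q (z, 0) (x, t))) ` {..x})"

definition Z1 :: "(real \<times> real) set \<Rightarrow> real set \<Rightarrow> real \<Rightarrow> real \<Rightarrow> real" where
  "Z1 Q N x t = Sup {z. z \<le> x \<and> L1 Q N x t = nu_count N z + real (LPP Q (z, 0) (x, t))}"

definition Z1plus :: "(real \<times> real) set \<Rightarrow> real set \<Rightarrow> real \<Rightarrow> real \<Rightarrow> real" where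
  "Z1plus Q N x t = max (Z1 Q N x t) 0"

end

theory Submission
  imports Defs "HOL-Real_Asymp.Real_Asymp"
begin

text \<open>
  Fix \<open>0 < u < t\<close> and look at the half-plane from the point \<open>(u, 0)\<close>: if the exit point is beyond \<open>u\<close>, then
  the paths leaving the axis to the right of \<open>u\<close> do at least as well as those leaving it to the left. The
  flux of the latter through the vertical line above \<open>u\<close> is a stationary process of sinks, so this is a
  statement about the quadrant model with sources and sinks. For source rate \<open>r\<close> and sink rate \<open>s\<close> the
  total height \<open>L(x, t)\<close> satisfies
  \<open>E (1 / (r s)) ^ L(x, t) = exp (x (1 / s - r) + t (1 / r - s))\<close>,
  because after tilting the sources the model is stationary. Suitable rates and Chernoff's bound
  show that both a large height of the source paths and a small total height have probability at most
  \<open>exp (- u ^ 3 / (96 t ^ 2))\<close>, which is of order \<open>t ^ 2 / u ^ 3\<close>; only the first term of the bound is needed.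

  All this is done on grids whose cells carry independent Bernoulli weights, where stationarity is a
  computation with one cell. Grid heights bound the continuum heights of the paths to the left from
  below and those of the paths to the right from above, as soon as the grid separates the points.
\<close>

section \<open>Expectations over finite product laws\<close>

text \<open>The half-plane has no left edge, so the stationary sinks above \<open>u\<close> have to
  be produced. The grid starts at a finite distance to the left of \<open>u\<close>, without sinks.
  For comparison, stationary sinks are put on its left edge: they stay stationary, and the two right
  edges agree unless some path that may use these sinks collects more than all the sources of the
  strip. For a long strip this is exponentially unlikely.

  The cube in the exponent arises as follows. With \<open>d = u / t\<close>, rates are changed by
  order \<open>d\<close>; after cancellation of the linear terms the heights differ from the
  threshold by order \<open>t * d ^ 2\<close>. The logarithms of the tilts are of order
  \<open>d\<close>, so Chernoff's bound gains \<open>t * d ^ 3 = u ^ 3 / t ^ 2\<close>.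

  The expectation enters through the choice \<open>u = r * EZ\<close>. Measurability and
  integrability of the exit point must still be shown. Since \<open>M\<close> is not assumed
  complete, outcomes with an unbounded supremum in \<open>L1\<close> cannot be discarded there, and
  the default values of \<open>Sup\<close> are followed.\<close>

text \<open>
  Expectations of functions of finitely many independent bits are explicit positive linear
  functionals, so that the boundary weights can be tilted and replaced without building new
  probability spaces.
\<close>

definition bern_mean :: "real \<Rightarrow> (bool \<Rightarrow> real) \<Rightarrow> real" where
  "bern_mean p f = p * f True + (1 - p) * f False"

fun iter_mean :: "nat \<Rightarrow> (('b \<Rightarrow> real) \<Rightarrow> real) \<Rightarrow> ('b list \<Rightarrow> real) \<Rightarrow> real" where
  "iter_mean 0 E f = f []"
| "iter_mean (Suc k) E f = E (\<lambda>x. iter_mean k E (\<lambda>xs. f (x # xs)))"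

definition mean_functional :: "(('b \<Rightarrow> real) \<Rightarrow> real) \<Rightarrow> bool" where
  "mean_functional E \<longleftrightarrow> (\<forall>f g. E (\<lambda>x. f x + g x) = E f + E g) \<and> (\<forall>c f. E (\<lambda>x. c * f x) = c * E f) \<and>
     (\<forall>f g. (\<forall>x. f x \<le> g x) \<longrightarrow> E f \<le> E g) \<and> E (\<lambda>_. 1) = 1"

lemma mean_add: "mean_functional E \<Longrightarrow> E (\<lambda>x. f x + g x) = E f + E g"
  and mean_cmult: "mean_functional E \<Longrightarrow> E (\<lambda>x. c * f x) = c * E f"
  and mean_one: "mean_functional E \<Longrightarrow> E (\<lambda>_. 1) = 1"
  unfolding mean_functional_def by (elim conjE, erule spec2, elim conjE, erule spec2, elim conjE,
      assumption)

lemma mean_mono: "mean_functional E \<Longrightarrow> (\<And>x. f x \<le> g x) \<Longrightarrow> E f \<le> E g"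
  unfolding mean_functional_def by meson

lemma mean_const: "mean_functional E \<Longrightarrow> E (\<lambda>_. c) = c"
  using mean_cmult[of E c "\<lambda>_. 1"] mean_one[of E] by simp

lemma mean_bern_mean: assumes "0 \<le> p" "p \<le> 1" shows "mean_functional (bern_mean p)"
proof -
  have "bern_mean p f \<le> bern_mean p g" if "\<forall>x. f x \<le> g x" for f g
    unfolding bern_mean_def using that assms by (intro add_mono mult_left_mono) auto
  then show ?thesis by (simp add: mean_functional_def) (simp add: bern_mean_def algebra_simps)
qed

lemma mean_iter_mean: assumes "mean_functional E" shows "mean_functional (iter_mean k E)"
proof (induction k)
  case 0 show ?case by (simp add: mean_functional_def)
next
  case (Suc k)
  show ?case unfolding mean_functional_def
    by (simp add: mean_add[OF Suc] mean_cmult[OF Suc] mean_add[OF assms] mean_cmult[OF assms]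
        mean_const[OF Suc] mean_const[OF assms] mean_mono[OF Suc] mean_mono[OF assms])
qed

lemma iter_mean_cong: "(\<And>xs. length xs = k \<Longrightarrow> f xs = g xs) \<Longrightarrow> iter_mean k E f = iter_mean k E g"
proof (induction k arbitrary: f g)
  case (Suc k)
  have "iter_mean k E (\<lambda>xs. f (x # xs)) = iter_mean k E (\<lambda>xs. g (x # xs))" for x
    by (rule Suc.IH) (simp add: Suc.prems)
  then show ?case by simp
qed simp

lemma iter_mean_mono:
  assumes "mean_functional E" "\<And>xs. length xs = k \<Longrightarrow> f xs \<le> g xs"
      shows "iter_mean k E f \<le> iter_mean k E g"
proof -
  \<comment> \<open>Cutting both integrands off to 0 at lists of the wrong length makes the
    inequality hold for all arguments, as \<open>mean_mono\<close> requires.\<close>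
  have "iter_mean k E f = iter_mean k E (\<lambda>xs. if length xs = k then f xs else 0)"
    by (rule iter_mean_cong) simp
  also have "\<dots> \<le> iter_mean k E (\<lambda>xs. if length xs = k then g xs else 0)"
    by (rule mean_mono[OF mean_iter_mean[OF assms(1)]]) (simp add: assms(2))
  also have "\<dots> = iter_mean k E g" by (rule iter_mean_cong) simp
  finally show ?thesis .
qed

lemma iter_mean_add: "iter_mean (m + n) E f = iter_mean m E (\<lambda>xs. iter_mean n E (\<lambda>ys. f (xs @ ys)))"
  by (induction m arbitrary: f) simp_all

text \<open>A finite Fubini theorem: a Bernoulli mean is a combination of two terms, so linearity of
  \<open>E\<close> is enough.\<close>

lemma mean_bern_mean_swap: "mean_functional E \<Longrightarrow> E (\<lambda>x. bern_mean p (f x))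
    = bern_mean p (\<lambda>b. E (\<lambda>x. f x b))"
  unfolding bern_mean_def
  using mean_add[of E "\<lambda>x. p * f x True" "\<lambda>x. (1 - p) * f x False"]
  by (simp add: mean_cmult[of E p "\<lambda>x. f x True"] mean_cmult[of E "1 - p" "\<lambda>x. f x False"])

lemma iter_mean_cmult: "(\<And>c f. E (\<lambda>x. c * f x) = c * E f) \<Longrightarrow> iter_mean k E (\<lambda>x. c * f x)
    = c * iter_mean k E f"
  by (induction k arbitrary: f) simp_all

lemma bern_mean_cmult: "bern_mean p (\<lambda>x. c * f x) = c * bern_mean p f"
  by (simp add: bern_mean_def algebra_simps)

text \<open>The law of one grid column: a source bit below it and the weights of its
  \<open>k\<close> cells. Iterating it gives the law of the whole grid.\<close>

definition col_mean :: "real \<Rightarrow> real \<Rightarrow> nat \<Rightarrow> (bool \<times> bool list \<Rightarrow> real) \<Rightarrow> real" where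
  "col_mean a p k f = bern_mean a (\<lambda>I. iter_mean k (bern_mean p) (\<lambda>W. f (I, W)))"

lemma col_mean_cmult: "col_mean a p k (\<lambda>x. c * f x) = c * col_mean a p k f"
  by (simp add: col_mean_def bern_mean_cmult iter_mean_cmult)

lemma mean_col_mean: assumes "0 \<le> a" "a \<le> 1" "0 \<le> p" "p \<le> 1"
    shows "mean_functional (col_mean a p k)"
proof -
  have a: "mean_functional (bern_mean a)" and p: "mean_functional (iter_mean k (bern_mean p))"
      using assms by (auto intro: mean_bern_mean mean_iter_mean)
  show ?thesis unfolding mean_functional_def col_mean_def
    by (simp add: mean_add[OF a] mean_add[OF p] mean_cmult[OF a] mean_cmult[OF p] mean_const[OF a]
        mean_const[OF p] mean_mono[OF a] mean_mono[OF p])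
qed

lemma col_mean_cong: "(\<And>I W. length W = k \<Longrightarrow> f (I, W) = g (I, W)) \<Longrightarrow> col_mean a p k f
    = col_mean a p k g"
  unfolding col_mean_def by (auto simp: bern_mean_def intro!: arg_cong2[where f = "(+)"]
      arg_cong2[where f = "(*)"] iter_mean_cong)

lemma col_mean_mono:
  assumes "0 \<le> a" "a \<le> 1" "0 \<le> p" "p \<le> 1" "\<And>x. length (snd x) = k \<Longrightarrow> f x \<le> g x"
  shows "col_mean a p k f \<le> col_mean a p k g"
  unfolding col_mean_def using assms by (intro mean_mono[of "bern_mean a"] iter_mean_mono
      mean_bern_mean) auto

text \<open>The support of the iterated column law. Facts about \<open>!\<close> or about lengths
  hold only there, so integrands are compared on this set.\<close>

definition configs :: "nat \<Rightarrow> nat \<Rightarrow> (bool \<times> bool list) list set" where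
  "configs n k = {cs. length cs = n \<and> (\<forall>c \<in> set cs. length (snd c) = k)}"

lemma cols_mean_cong:
  "(\<And>cs. cs \<in> configs n k \<Longrightarrow> f cs = g cs) \<Longrightarrow> iter_mean n (col_mean a p k) f
      = iter_mean n (col_mean a p k) g"
proof (induction n arbitrary: f g)
  case 0 then show ?case by (simp add: configs_def)
next
  case (Suc n)
  show ?case unfolding iter_mean.simps
    by (rule col_mean_cong, rule Suc.IH, rule Suc.prems) (auto simp: configs_def)
qed

lemma cols_mean_mono:
  assumes "0 \<le> a" "a \<le> 1" "0 \<le> p" "p \<le> 1" "\<And>cs. cs \<in> configs n k \<Longrightarrow> f cs \<le> g cs"
  shows "iter_mean n (col_mean a p k) f \<le> iter_mean n (col_mean a p k) g"
proof -
  have m: "mean_functional (iter_mean n (col_mean a p k))" using assms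
      by (intro mean_iter_mean mean_col_mean)
  have "iter_mean n (col_mean a p k) f = iter_mean n (col_mean a p k)
      (\<lambda>xs. if xs \<in> configs n k then f xs else 0)"
    by (rule cols_mean_cong) simp
  also have "\<dots> \<le> iter_mean n (col_mean a p k) (\<lambda>xs. if xs \<in> configs n k then g xs else 0)"
    by (rule mean_mono[OF m]) (simp add: assms(5))
  also have "\<dots> = iter_mean n (col_mean a p k) g" by (rule cols_mean_cong) simp
  finally show ?thesis .
qed

section \<open>Stationary columns\<close>

text \<open>
  Let a unit cell carry the increment \<open>I\<close> along its bottom edge, \<open>J\<close> along its left edge and
  the weight \<open>w\<close>. With height 0 at the lower left corner, the upper right corner has height
  \<open>max I J w\<close>; subtracting \<open>I\<close> and \<open>J\<close> gives the increments along the right and the top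
  edge. A column is processed from bottom to top, the top increment of a cell being the
  bottom increment of the next one.
\<close>

fun column_step :: "bool \<Rightarrow> bool list \<Rightarrow> bool list \<Rightarrow> bool list" where
  "column_step I (j # js) (w # ws) = (\<not> I \<and> (j \<or> w)) # column_step (\<not> j \<and> (I \<or> w)) js ws"
| "column_step I _ _ = []"

lemma length_column_step [simp]: "length (column_step I J W) = min (length J) (length W)"
  by (induction I J W rule: column_step.induct) auto

text \<open>
  Burke property of one cell: the map of edge increments only exchanges (1, 1), with any
  weight, and (0, 0) with weight, so the condition on \<open>a\<close>, \<open>b\<close>, \<open>p\<close> makes the product law
  invariant.
\<close>

lemma burke_column_step:
  assumes b: "0 \<le> b" "b \<le> 1" and p: "0 \<le> p" "p \<le> 1" and ab: "a * b = p * (1 - a) * (1 - b)"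
  shows "bern_mean a (\<lambda>I. iter_mean k (bern_mean b)
      (\<lambda>J. iter_mean k (bern_mean p) (\<lambda>W. F (column_step I J W)))) = iter_mean k (bern_mean b) F"
proof (induction k arbitrary: F)
  case 0 then show ?case by (simp add: bern_mean_def algebra_simps)
next
  case (Suc k)
  define \<Phi> where "\<Phi> j I = iter_mean k (bern_mean b)
      (\<lambda>J. iter_mean k (bern_mean p) (\<lambda>W. F (j # column_step I J W)))" for j I
  have m: "mean_functional (iter_mean k (bern_mean b))" using b
      by (intro mean_iter_mean mean_bern_mean)
  have "bern_mean a (\<lambda>I. iter_mean (Suc k) (bern_mean b)
      (\<lambda>J. iter_mean (Suc k) (bern_mean p) (\<lambda>W. F (column_step I J W))))
     = bern_mean a (\<lambda>I. bern_mean b (\<lambda>j. bern_mean p (\<lambda>w. \<Phi> (\<not> I \<and> (j \<or> w)) (\<not> j \<and> (I \<or> w)))))"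
    by (simp add: \<Phi>_def mean_bern_mean_swap[OF m])
  also have "\<dots> = bern_mean b (\<lambda>j. bern_mean a (\<lambda>I. \<Phi> j I)) + (a * b - p * (1 - a) * (1 - b)) *
      (\<Phi> False False - \<Phi> True True)"
    by (simp add: bern_mean_def algebra_simps)
  also have "\<dots> = bern_mean b (\<lambda>j. bern_mean a (\<lambda>I. \<Phi> j I))" using ab by simp
  also have "bern_mean a (\<lambda>I. \<Phi> j I) = iter_mean k (bern_mean b) (\<lambda>xs. F (j # xs))" for j
    unfolding \<Phi>_def by (rule Suc.IH)
  then have "bern_mean b (\<lambda>j. bern_mean a (\<lambda>I. \<Phi> j I)) = iter_mean (Suc k) (bern_mean b) F" by simp
  finally show ?case .
qed

text \<open>Transports the increments of the left edge through the columns, ending with the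
  increments of the right edge.\<close>

fun run_columns :: "bool list \<Rightarrow> (bool \<times> bool list) list \<Rightarrow> bool list" where
  "run_columns J [] = J"
| "run_columns J (c # cs) = run_columns (column_step (fst c) J (snd c)) cs"

lemma run_columns_append: "run_columns J (cs @ ds) = run_columns (run_columns J cs) ds"
  by (induction cs arbitrary: J) simp_all

lemma length_run_columns: "cs \<in> configs n k \<Longrightarrow> length J = k \<Longrightarrow> length (run_columns J cs) = k"
  by (induction cs arbitrary: J n) (auto simp: configs_def)

definition count_true :: "bool list \<Rightarrow> nat" where "count_true xs = length (filter id xs)"
lemma count_true_simps [simp]: "count_true [] = 0" "count_true (x # xs) = of_bool x
    + count_true xs" by (auto simp: count_true_def)

lemma mgf_iid: "iter_mean k (bern_mean b) (\<lambda>J. \<phi> ^ count_true J) = (1 - b + b * \<phi>) ^ k"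
proof (induction k)
  case (Suc k)
  have "iter_mean (Suc k) (bern_mean b) (\<lambda>J. \<phi> ^ count_true J)
      = b * iter_mean k (bern_mean b) (\<lambda>xs. \<phi> * \<phi> ^ count_true xs) + (1 - b) * iter_mean k
          (bern_mean b) (\<lambda>xs. \<phi> ^ count_true xs)"
    by (simp add: bern_mean_def[of b "\<lambda>x. iter_mean k (bern_mean b) (f x)" for f])
  also have "iter_mean k (bern_mean b) (\<lambda>xs. \<phi> * \<phi> ^ count_true xs) = \<phi> * (1 - b + b * \<phi>) ^ k"
    by (simp only: iter_mean_cmult[of "bern_mean b", OF bern_mean_cmult] Suc)
  finally show ?case by (simp add: Suc algebra_simps)
qed simp

text \<open>
  Tilting the source of one column by \<open>\<phi>\<close> turns the parameter \<open>a'\<close> into the stationary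
  parameter \<open>a\<close> at the cost of a constant factor \<open>c\<close>; invariance then removes the columns
  one at a time.
\<close>

lemma mgf_stationary:
  assumes b: "0 \<le> b" "b \<le> 1" and p: "0 \<le> p" "p \<le> 1" and ab: "a * b = p * (1 - a) * (1 - b)"
    and a': "0 \<le> a'" "a' \<le> 1" and tilt: "a' * \<phi> = c * a" "1 - a' = c * (1 - a)"
  shows "iter_mean k (bern_mean b) (\<lambda>J. iter_mean n (col_mean a' p k)
      (\<lambda>cs. \<phi> ^ (count_true (map fst cs) + count_true (run_columns J cs))))
    = c ^ n * (1 - b + b * \<phi>) ^ k"
proof (induction n)
  case 0 show ?case by (simp add: mgf_iid)
next
  case (Suc n)
  define \<Phi> where "\<Phi> = (\<lambda>J. iter_mean n (col_mean a' p k)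
      (\<lambda>cs. \<phi> ^ (count_true (map fst cs) + count_true (run_columns J cs))))"
  have m: "mean_functional (iter_mean k (bern_mean b))" "mean_functional
      (iter_mean k (bern_mean p))" "mean_functional (iter_mean n (col_mean a' p k))"
    using b p a' by (auto intro!: mean_iter_mean mean_bern_mean mean_col_mean)
  have "iter_mean (Suc n) (col_mean a' p k) (\<lambda>cs. \<phi> ^ (count_true (map fst cs)
      + count_true (run_columns J cs)))
      = bern_mean a' (\<lambda>I. \<phi> ^ of_bool I * iter_mean k (bern_mean p) (\<lambda>W. \<Phi> (column_step I J W)))"
          for J
    by (simp add: col_mean_def \<Phi>_def power_add mult.assoc mean_cmult[OF m(2)] mean_cmult[OF m(3)])
  also have "\<dots> J = c * bern_mean a (\<lambda>I. iter_mean k (bern_mean p) (\<lambda>W. \<Phi> (column_step I J W)))"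
      for J
    using tilt by (simp add: bern_mean_def distrib_left flip: mult.assoc)
  finally have "iter_mean k (bern_mean b) (\<lambda>J. iter_mean (Suc n) (col_mean a' p k)
      (\<lambda>cs. \<phi> ^ (count_true (map fst cs) + count_true (run_columns J cs))))
     = c * bern_mean a (\<lambda>I. iter_mean k (bern_mean b)
         (\<lambda>J. iter_mean k (bern_mean p) (\<lambda>W. \<Phi> (column_step I J W))))"
    by (simp add: mean_cmult[OF m(1)] mean_bern_mean_swap[OF m(1)])
  also have "\<dots> = c * iter_mean k (bern_mean b) \<Phi>" by (subst burke_column_step[OF b p ab]) simp
  also have "iter_mean k (bern_mean b) \<Phi> = c ^ n * (1 - b + b * \<phi>) ^ k" using Suc
      by (simp only: \<Phi>_def)
  finally show ?case by simp
qed

text \<open>Iterated Burke property without a tilt. It allows sinks that have evolved through a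
  strip to be replaced by fresh ones with the same law.\<close>

lemma run_columns_stationary:
  assumes b: "0 \<le> b" "b \<le> 1" and p: "0 \<le> p" "p \<le> 1" and ab: "a * b = p * (1 - a) * (1 - b)"
    and a: "0 \<le> a" "a \<le> 1"
  shows "iter_mean k (bern_mean b) (\<lambda>J. iter_mean n (col_mean a p k) (\<lambda>cs. F (run_columns J cs)))
      = iter_mean k (bern_mean b) F"
proof (induction n)
  case 0 show ?case by simp
next
  case (Suc n)
  have m: "mean_functional (iter_mean k (bern_mean b))" using b
      by (auto intro!: mean_iter_mean mean_bern_mean)
  define \<Phi> where "\<Phi> = (\<lambda>J. iter_mean n (col_mean a p k) (\<lambda>cs. F (run_columns J cs)))"
  have "iter_mean k (bern_mean b) (\<lambda>J. iter_mean (Suc n) (col_mean a p k)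
      (\<lambda>cs. F (run_columns J cs)))
     = bern_mean a (\<lambda>I. iter_mean k (bern_mean b)
         (\<lambda>J. iter_mean k (bern_mean p) (\<lambda>W. \<Phi> (column_step I J W))))"
    by (simp add: col_mean_def \<Phi>_def mean_bern_mean_swap[OF m])
  also have "\<dots> = iter_mean k (bern_mean b) \<Phi>" by (rule burke_column_step[OF b p ab])
  also have "\<dots> = iter_mean k (bern_mean b) F" using Suc by (simp only: \<Phi>_def)
  finally show ?case .
qed

section \<open>Changing Bernoulli parameters: monotonicity and removal of a source tilt\<close>

lemma bern_mean_mono_param: "p \<le> q \<Longrightarrow> f False \<le> f True \<Longrightarrow> bern_mean p f \<le> bern_mean q f"
proof -
  assume "p \<le> q" "f False \<le> f True"
  then have "0 \<le> (q - p) * (f True - f False)" by simp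
  then show ?thesis by (simp add: bern_mean_def algebra_simps)
qed

text \<open>Stochastic domination without a coupling: the parameter is raised one coordinate at a
  time, each time by \<open>bern_mean_mono_param\<close>.\<close>

lemma iter_mean_mono_param:
  assumes "0 \<le> p" "p \<le> q" "q \<le> 1"
    and "\<And>xs ys. length xs = k \<Longrightarrow> length ys = k \<Longrightarrow> list_all2 (\<le>) xs ys \<Longrightarrow> f xs \<le> f ys"
  shows "iter_mean k (bern_mean p) f \<le> iter_mean k (bern_mean q) f"
  using assms(4)
proof (induction k arbitrary: f)
  case (Suc k)
  have m: "mean_functional (bern_mean p)" "mean_functional (bern_mean q)" using assms
      by (auto intro: mean_bern_mean)
  have "iter_mean k (bern_mean p) (\<lambda>xs. f (x # xs)) \<le> iter_mean k (bern_mean q) (\<lambda>xs. f (x # xs))"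
      for x
    by (rule Suc.IH, rule Suc.prems) auto
  then have "iter_mean (Suc k) (bern_mean p) f
      \<le> bern_mean p (\<lambda>x. iter_mean k (bern_mean q) (\<lambda>xs. f (x # xs)))"
    by (simp add: mean_mono[OF m(1)])
  also have "\<dots> \<le> iter_mean (Suc k) (bern_mean q) f"
    unfolding iter_mean.simps
  proof (rule bern_mean_mono_param[OF assms(2)], rule iter_mean_mono[OF m(2)])
    fix xs :: "bool list" assume "length xs = k"
    then show "f (False # xs) \<le> f (True # xs)"
      by (intro Suc.prems) (simp_all add: list_all2_refl)
  qed
  finally show ?case .
qed simp

lemma cols_mean_mono_param:
  assumes "0 \<le> a" "a \<le> a'" "a' \<le> 1" "0 \<le> p" "p \<le> 1"
    and "\<And>cs ds. cs \<in> configs n k \<Longrightarrow> ds \<in> configs n k \<Longrightarrow> map snd cs = map snd ds \<Longrightarrow>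
      list_all2 (\<le>) (map fst cs) (map fst ds) \<Longrightarrow> f cs \<le> f ds"
  shows "iter_mean n (col_mean a p k) f \<le> iter_mean n (col_mean a' p k) f"
  using assms(6)
proof (induction n arbitrary: f)
  case (Suc n)
  have m: "mean_functional (bern_mean a)" "mean_functional (bern_mean p)" using assms
      by (auto intro: mean_bern_mean)
  have "iter_mean n (col_mean a p k) (\<lambda>xs. f (x # xs))
      \<le> iter_mean n (col_mean a' p k) (\<lambda>xs. f (x # xs))"
    if "length (snd x) = k" for x
    by (rule Suc.IH, rule Suc.prems) (use that in \<open>auto simp: configs_def\<close>)
  then have "iter_mean (Suc n) (col_mean a p k) f
      \<le> col_mean a p k (\<lambda>x. iter_mean n (col_mean a' p k) (\<lambda>xs. f (x # xs)))"
    unfolding iter_mean.simps by (intro col_mean_mono assms) (use assms in auto)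
  also have "\<dots> \<le> col_mean a' p k (\<lambda>x. iter_mean n (col_mean a' p k) (\<lambda>xs. f (x # xs)))"
    unfolding col_mean_def[of a] col_mean_def[of a' p k "\<lambda>x. iter_mean n (col_mean a' p k)
        (\<lambda>xs. f (x # xs))"]
  proof (intro bern_mean_mono_param iter_mean_mono[OF m(2)] cols_mean_mono)
    fix xs :: "bool list" and cs assume "length xs = k" "cs \<in> configs n k"
    then show "f ((False, xs) # cs) \<le> f ((True, xs) # cs)"
      by (intro Suc.prems) (simp_all add: configs_def list_all2_refl)
  qed (use assms in auto)
  finally show ?case by simp
qed simp

text \<open>Sources and weights are independent and \<open>g\<close> sees the weights only. Each
  source contributes a factor \<open>1 - a + a * s\<close>, and the remaining mean may use any
  source parameter.\<close>

lemma cols_mean_tilt_away: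
  "iter_mean n (col_mean a p k) (\<lambda>cs. s ^ count_true (map fst cs) * g (map snd cs))
    = (1 - a + a * s) ^ n * iter_mean n (col_mean a'' p k) (\<lambda>cs. g (map snd cs))"
proof (induction n arbitrary: g)
  case (Suc n)
  define \<Phi> where "\<Phi> = (\<lambda>W. iter_mean n (col_mean a'' p k) (\<lambda>cs. g (W # map snd cs)))"
  have "iter_mean (Suc n) (col_mean a p k) (\<lambda>cs. s ^ count_true (map fst cs) * g (map snd cs))
     = col_mean a p k (\<lambda>x. s ^ of_bool (fst x) * iter_mean n (col_mean a p k)
         (\<lambda>cs. s ^ count_true (map fst cs) * g (snd x # map snd cs)))"
    by (simp add: power_add mult.assoc iter_mean_cmult col_mean_cmult)
  also have "\<dots> = (1 - a + a * s) ^ n * col_mean a p k (\<lambda>x. s ^ of_bool (fst x) * \<Phi> (snd x))"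
    by (simp only: Suc.IH[of "\<lambda>W. g (snd x # W)"
        for x] \<Phi>_def mult.left_commute[of _ "(1 - a + a * s) ^ n"] col_mean_cmult)
  also have "col_mean a p k (\<lambda>x. s ^ of_bool (fst x) * \<Phi> (snd x))
      = (1 - a + a * s) * col_mean a'' p k (\<lambda>x. \<Phi> (snd x))"
    by (simp add: col_mean_def iter_mean_cmult bern_mean_cmult)
        (simp add: bern_mean_def algebra_simps)
  finally show ?case by (simp add: \<Phi>_def)
qed simp

section \<open>Last-passage heights on a grid\<close>

text \<open>\<open>X\<close> and \<open>Y\<close> are heights on the bottom and the left edge, and
  \<open>w i j\<close> belongs to the cell with lower left corner \<open>(i, j)\<close>. Keeping the
  edges as parameters makes it possible to switch off one of them. The corner takes its height from
  \<open>Y\<close>.\<close>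

fun grid_lpp :: "(nat \<Rightarrow> nat) \<Rightarrow> (nat \<Rightarrow> nat) \<Rightarrow> (nat \<Rightarrow> nat \<Rightarrow> bool) \<Rightarrow> nat \<Rightarrow> nat \<Rightarrow> nat" where
  "grid_lpp X Y w 0 j = Y j"
| "grid_lpp X Y w (Suc i) 0 = X (Suc i)"
| "grid_lpp X Y w (Suc i) (Suc j) =
     max (max (grid_lpp X Y w i (Suc j)) (grid_lpp X Y w (Suc i) j))
         (grid_lpp X Y w i j + of_bool (w i j))"

text \<open>The recursion consists of maxima and additions of constants, hence is max-plus linear in
  the boundary data.\<close>

lemma grid_lpp_max: "grid_lpp (\<lambda>i. max (X i) (X' i)) (\<lambda>j. max (Y j) (Y' j)) w i j
    = max (grid_lpp X Y w i j) (grid_lpp X' Y' w i j)"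
  by (induction X Y w i j rule: grid_lpp.induct) (auto simp: max_def)

text \<open>Since 0 is neutral for \<open>max\<close> on naturals, linearity separates paths using
  the sources from paths using the sinks.\<close>

lemma grid_lpp_split: "grid_lpp X Y w i j = max (grid_lpp X (\<lambda>_. 0) w i j)
    (grid_lpp (\<lambda>_. 0) Y w i j)"
  using grid_lpp_max[of X "\<lambda>_. 0" "\<lambda>_. 0" Y w i j] by simp

lemma grid_lpp_mono:
  "(\<And>i. X i \<le> X' i) \<Longrightarrow> (\<And>j. Y j \<le> Y' j) \<Longrightarrow> grid_lpp X Y w i j \<le> grid_lpp X' Y' w i j"
  by (induction X Y w i j rule: grid_lpp.induct) (auto simp: max_def le_max_iff_disj)

lemma grid_lpp_cong:
  "(\<And>i'. i' \<le> i \<Longrightarrow> X i' = X' i') \<Longrightarrow> (\<And>j'. j' \<le> j \<Longrightarrow> Y j' = Y' j') \<Longrightarrow>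
   (\<And>i' j'. i' < i \<Longrightarrow> j' < j \<Longrightarrow> w i' j' = w' i' j') \<Longrightarrow> grid_lpp X Y w i j = grid_lpp X' Y' w' i j"
  by (induction X Y w i j rule: grid_lpp.induct) auto

lemma grid_lpp_cong_w:
  assumes "\<And>i' j'. i' < i \<Longrightarrow> j' < j \<Longrightarrow> w i' j' = w' i' j'" "i = i2"
  shows "grid_lpp X Y w i j = grid_lpp X Y w' i2 j"
  unfolding assms(2)[symmetric] by (rule grid_lpp_cong[OF refl refl assms(1)])

lemma grid_lpp_mono_j: "mono Y \<Longrightarrow> j \<le> j' \<Longrightarrow> grid_lpp X Y w i j \<le> grid_lpp X Y w i j'"
proof (induction j' arbitrary: )
  case (Suc j')
  have "grid_lpp X Y w i j' \<le> grid_lpp X Y w i (Suc j')"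
    by (cases i) (auto simp: Suc.prems(1) monoD)
  then show ?case using Suc by (cases "j = Suc j'") auto
qed simp

definition source_sum :: "(bool \<times> bool list) list \<Rightarrow> nat \<Rightarrow> nat"
    where "source_sum cs i = count_true (map fst (take i cs))"
definition sink_sum :: "bool list \<Rightarrow> nat \<Rightarrow> nat" where "sink_sum J j = count_true (take j J)"
definition occupied :: "(bool \<times> bool list) list \<Rightarrow> nat \<Rightarrow> nat \<Rightarrow> bool"
    where "occupied cs i j = snd (cs ! i) ! j"

lemma count_true_append [simp]: "count_true (xs @ ys) = count_true xs + count_true ys"
    by (simp add: count_true_def)

lemma count_true_take_mono: "mono (\<lambda>i. count_true (take i xs))"
proof (rule monoI)
  fix i j :: nat assume "i \<le> j"
  then obtain d where "j = i + d" using le_Suc_ex by blast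
  then show "count_true (take i xs) \<le> count_true (take j xs)" by (simp add: take_add)
qed

lemma count_true_take_Suc: "i < length xs \<Longrightarrow> count_true (take (Suc i) xs) = count_true (take i xs)
    + of_bool (xs ! i)"
  by (simp add: take_Suc_conv_app_nth)

lemma mono_source_sum: "mono (source_sum cs)"
  using count_true_take_mono[of "map fst cs"] by (simp add: source_sum_def[abs_def] take_map)

lemma mono_sink_sum: "mono (sink_sum J)"
  using count_true_take_mono[of J] by (simp add: sink_sum_def[abs_def])

lemma source_sum_0 [simp]: "source_sum cs 0 = 0" and sink_sum_0 [simp]: "sink_sum J 0 = 0"
    by (simp_all add: source_sum_def sink_sum_def)

text \<open>Translates heights into increments. Going up the column, the top increment of a cell
  takes over the role of the source for the cells above it.\<close>

lemma column_step_heights: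
  assumes "\<And>j. j \<le> length J \<Longrightarrow> g j = x + sink_sum J j" "length W = length J" "g' 0 = x + of_bool I"
    and "\<And>j. j < length J \<Longrightarrow> g' (Suc j) = max (max (g (Suc j)) (g' j)) (g j + of_bool (W ! j))"
    and "j \<le> length J"
  shows "g' j = x + of_bool I + sink_sum (column_step I J W) j"
  using assms
proof (induction J arbitrary: g g' x I W j)
  case Nil
  then show ?case by (simp add: sink_sum_def)
next
  case (Cons a J)
  then obtain v V where W: "W = v # V" "length V = length J" by (cases W) auto
  have g0: "g 0 = x" "g 1 = x + of_bool a" using Cons.prems(1)[of 0] Cons.prems(1)[of 1]
      by (auto simp: sink_sum_def)
  have g1: "g' (Suc 0) = max (max (g 1) (g' 0)) (g 0 + of_bool v)" using Cons.prems(4)[of 0] W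
      by simp
  show ?case
  proof (cases j)
    case 0 then show ?thesis using Cons.prems(3) by (simp add: sink_sum_def)
  next
    case (Suc j')
    \<comment> \<open>The rest of the column is a column with base height
      \<open>x + of_bool a\<close> whose source is the top increment of the first cell.\<close>
    have "g' (Suc j') = x + of_bool a + of_bool (\<not> a \<and> (I \<or> v))
        + sink_sum (column_step (\<not> a \<and> (I \<or> v)) J V) j'"
    proof (rule Cons.IH[where g = "\<lambda>j. g (Suc j)" and g' = "\<lambda>j. g' (Suc j)"])
      show "g (Suc j) = x + of_bool a + sink_sum J j" if "j \<le> length J" for j
        using Cons.prems(1)[of "Suc j"] that by (simp add: sink_sum_def)
      show "g' (Suc 0) = x + of_bool a + of_bool (\<not> a \<and> (I \<or> v))"
        using g0 g1 Cons.prems(3) by (auto simp: max_def)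
      show "g' (Suc (Suc j)) = max (max (g (Suc (Suc j))) (g' (Suc j))) (g (Suc j)
          + of_bool (V ! j))"
        if "j < length J" for j using Cons.prems(4)[of "Suc j"] that W by simp
    qed (use W Cons.prems(5) Suc in auto)
    then show ?thesis using W Suc by (auto simp: sink_sum_def)
  qed
qed

lemma configs_take: "cs \<in> configs n k \<Longrightarrow> i \<le> n \<Longrightarrow> take i cs \<in> configs i k"
  by (auto simp: configs_def dest: in_set_takeD)

lemma configs_nth: "cs \<in> configs n k \<Longrightarrow> i < n \<Longrightarrow> length (snd (cs ! i)) = k"
  by (auto simp: configs_def)

lemma grid_lpp_run_columns:
  assumes "cs \<in> configs n k" "length J = k" "i \<le> n" "j \<le> k"
  shows "grid_lpp (source_sum cs) (sink_sum J) (occupied cs) i j = source_sum cs i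
      + sink_sum (run_columns J (take i cs)) j"
  using assms(3,4)
proof (induction i arbitrary: j)
  case 0 then show ?case by (simp add: source_sum_def sink_sum_def)
next
  case (Suc i)
  have l: "length cs = n" using assms(1) by (simp add: configs_def)
  have t: "take (Suc i) cs = take i cs @ [cs ! i]" using Suc.prems l
      by (simp add: take_Suc_conv_app_nth)
  have X: "source_sum cs (Suc i) = source_sum cs i + of_bool (fst (cs ! i))"
      by (simp add: source_sum_def t)
  have lS: "length (run_columns J (take i cs)) = k"
    using length_run_columns[OF configs_take[OF assms(1)], of i J] Suc.prems assms(2) by simp
  have "grid_lpp (source_sum cs) (sink_sum J) (occupied cs) (Suc i) j = source_sum cs i
      + of_bool (fst (cs ! i)) +
      sink_sum (column_step (fst (cs ! i)) (run_columns J (take i cs)) (snd (cs ! i))) j"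
  proof (rule column_step_heights[where g = "\<lambda>j. grid_lpp (source_sum cs) (sink_sum J)
      (occupied cs) i j"])
    show "grid_lpp (source_sum cs) (sink_sum J) (occupied cs) i j = source_sum cs i
        + sink_sum (run_columns J (take i cs)) j"
      if "j \<le> length (run_columns J (take i cs))" for j using Suc.IH that Suc.prems lS by simp
    show "grid_lpp (source_sum cs) (sink_sum J) (occupied cs) (Suc i) (Suc j) =
        max (max (grid_lpp (source_sum cs) (sink_sum J) (occupied cs) i (Suc j))
            (grid_lpp (source_sum cs) (sink_sum J) (occupied cs) (Suc i) j))
          (grid_lpp (source_sum cs) (sink_sum J) (occupied cs) i j + of_bool (snd (cs ! i) ! j))"
              for j
      by (simp add: occupied_def[of cs i j])
  qed (use Suc.prems lS configs_nth[OF assms(1), of i] X in simp_all)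
  then show ?case by (simp add: X t run_columns_append)
qed

lemma grid_lpp_total:
  assumes "cs \<in> configs n k" "length J = k"
  shows "grid_lpp (source_sum cs) (sink_sum J) (occupied cs) n k = count_true (map fst cs)
      + count_true (run_columns J cs)"
  using grid_lpp_run_columns[OF assms order.refl order.refl] assms length_run_columns[OF assms]
  by (simp add: source_sum_def sink_sum_def configs_def)

abbreviation no_sinks :: "nat \<Rightarrow> bool list" where "no_sinks k \<equiv> replicate k False"

lemma sink_sum_no_sinks [simp]: "sink_sum (no_sinks k) = (\<lambda>_. 0)"
  by (auto simp: sink_sum_def count_true_def fun_eq_iff)

lemma source_sum_mono:
  assumes "list_all2 (\<le>) (map fst cs) (map fst ds)" shows "source_sum cs i \<le> source_sum ds i"
proof -
  have "count_true xs \<le> count_true ys" if "list_all2 (\<le>) xs ys" for xs ys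
    using that by (induction rule: list_all2_induct) auto
  then show ?thesis using assms by (simp add: source_sum_def list_all2_takeI flip: take_map)
qed

lemma sink_sum_mono:
  assumes "list_all2 (\<le>) xs ys" shows "sink_sum xs i \<le> sink_sum ys i"
proof -
  have "count_true xs \<le> count_true ys" if "list_all2 (\<le>) xs ys" for xs ys
    using that by (induction rule: list_all2_induct) auto
  then show ?thesis using assms by (simp add: sink_sum_def list_all2_takeI)
qed

text \<open>Height 0 on the other edge lets paths start there without reward. Thus
  \<open>sink_lpp\<close> and \<open>source_lpp\<close> both include paths through weights
  alone.\<close>

definition sink_lpp :: "bool list \<Rightarrow> (bool \<times> bool list) list \<Rightarrow> nat" where
  "sink_lpp J cs = grid_lpp (\<lambda>_. 0) (sink_sum J) (occupied cs) (length cs) (length J)"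
definition source_lpp :: "nat \<Rightarrow> (bool \<times> bool list) list \<Rightarrow> nat" where
  "source_lpp k cs = grid_lpp (source_sum cs) (\<lambda>_. 0) (occupied cs) (length cs) k"

lemma max_sink_lpp_source_lpp:
  assumes "cs \<in> configs n k" "length J = k"
  shows "count_true (map fst cs) + count_true (run_columns J cs)
      = max (source_lpp k cs) (sink_lpp J cs)"
  unfolding sink_lpp_def source_lpp_def grid_lpp_total[OF assms, symmetric] using assms
      by (subst grid_lpp_split) (simp add: configs_def)

lemma occupied_cong: "map snd cs = map snd ds \<Longrightarrow> i < length cs \<Longrightarrow> occupied cs i j = occupied ds i j"
  unfolding occupied_def by (metis length_map nth_map)

lemma source_lpp_mono:
  assumes "map snd cs = map snd ds" "list_all2 (\<le>) (map fst cs) (map fst ds)"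
  shows "source_lpp k cs \<le> source_lpp k ds"
proof -
  have l: "length cs = length ds" using assms(1) by (metis length_map)
  have "source_lpp k cs = grid_lpp (source_sum cs) (\<lambda>_. 0) (occupied ds) (length cs) k"
    unfolding source_lpp_def by (rule grid_lpp_cong) (auto simp: occupied_cong[OF assms(1)])
  also have "\<dots> \<le> source_lpp k ds" unfolding source_lpp_def l
      by (rule grid_lpp_mono) (auto intro: source_sum_mono assms)
  finally show ?thesis .
qed

lemma sink_lpp_cong: assumes "map snd cs = map snd ds" shows "sink_lpp J cs = sink_lpp J ds"
proof -
  have "length cs = length ds" using assms by (metis length_map)
  then show ?thesis unfolding sink_lpp_def by (intro grid_lpp_cong_w)
      (simp_all add: occupied_cong[OF assms])
qed

lemma sink_lpp_mono: "list_all2 (\<le>) J J' \<Longrightarrow> sink_lpp J cs \<le> sink_lpp J' cs"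
  unfolding sink_lpp_def using grid_lpp_mono[of "\<lambda>_. 0" "\<lambda>_. 0" "sink_sum J" "sink_sum J'"]
      by (simp add: sink_sum_mono list_all2_lengthD)

text \<open>
  A path that uses the sinks cannot win at any height of the last column if the sources
  alone outweigh the best sink path at the top, and then both columns of increments are read
  off the same heights.
\<close>

lemma run_columns_neq_no_sinks_imp:
  assumes cs: "cs \<in> configs n k" and J: "length J = k"
      and neq: "run_columns (no_sinks k) cs \<noteq> run_columns J cs"
  shows "count_true (map fst cs) < sink_lpp J cs"
proof (rule ccontr)
  assume "\<not> ?thesis"
  then have le: "sink_lpp J cs \<le> source_sum cs n" using cs by (simp add: source_sum_def configs_def)
  have n: "length cs = n" using cs by (simp add: configs_def)
  have *: "sink_sum (run_columns J cs) j = sink_sum (run_columns (no_sinks k) cs) j" if "j \<le> k"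
      for j
  proof -
    have "grid_lpp (\<lambda>_. 0) (sink_sum J) (occupied cs) n j \<le> sink_lpp J cs"
      unfolding sink_lpp_def n using that J by (auto intro: grid_lpp_mono_j mono_sink_sum)
    also have "\<dots> \<le> source_sum cs n" by (rule le)
    also have "\<dots> \<le> grid_lpp (source_sum cs) (\<lambda>_. 0) (occupied cs) n j"
      using grid_lpp_mono_j[of "\<lambda>_. 0" 0 j "source_sum cs" "occupied cs" n]
          by (cases n) (auto simp: mono_def)
    finally have "grid_lpp (source_sum cs) (sink_sum J) (occupied cs) n j
        = grid_lpp (source_sum cs) (\<lambda>_. 0) (occupied cs) n j"
      by (subst grid_lpp_split) simp
    then show ?thesis
      using grid_lpp_run_columns[OF cs J order.refl that]
          grid_lpp_run_columns[OF cs, of "no_sinks k" n j] that n by simp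
  qed
  have l: "length (run_columns J cs) = k" "length (run_columns (no_sinks k) cs) = k"
    using cs J by (auto intro: length_run_columns)
  have "run_columns J cs ! j = run_columns (no_sinks k) cs ! j" if "j < k" for j
    using *[of j] *[of "Suc j"] that l
    by (cases "run_columns J cs ! j"; cases "run_columns (no_sinks k) cs ! j")
        (simp_all add: sink_sum_def count_true_take_Suc)
  then show False using neq l by (simp add: list_eq_iff_nth_eq)
qed

text \<open>Total heights increase with the sinks, and both sides of the comparison contain the same
  sources.\<close>

lemma count_true_run_columns_no_sinks_le:
  assumes "cs \<in> configs n k" "length J = k" shows "count_true (run_columns (no_sinks k) cs)
      \<le> count_true (run_columns J cs)"
proof -
  have "grid_lpp (source_sum cs) (sink_sum (no_sinks k)) (occupied cs) n k
      \<le> grid_lpp (source_sum cs) (sink_sum J) (occupied cs) n k"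
    by (rule grid_lpp_mono) auto
  then show ?thesis using assms by (simp add: grid_lpp_total del: sink_sum_no_sinks)
qed

lemma mean_bounded: "mean_functional E \<Longrightarrow> (\<And>x. f x \<le> c) \<Longrightarrow> E f \<le> c"
  using mean_mono[of E f "\<lambda>_. c"] mean_const[of E c] by simp

lemma chernoff_upper: "1 \<le> \<phi> \<Longrightarrow> of_bool (K \<le> real l) \<le> \<phi> powr (- K) * \<phi> ^ l"
  and chernoff_lower: "0 < \<psi> \<Longrightarrow> \<psi> \<le> 1 \<Longrightarrow> of_bool (real l \<le> K) \<le> \<psi> powr (- K) * \<psi> ^ l"
proof -
  have *: "\<phi> powr (- K) * \<phi> ^ l = \<phi> powr (real l - K)" if "0 < \<phi>" for \<phi>
    using that by (simp add: powr_realpow[symmetric] powr_add[symmetric])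
  show "of_bool (K \<le> real l) \<le> \<phi> powr (- K) * \<phi> ^ l" if "1 \<le> \<phi>"
    using that *[of \<phi>] by (auto simp: ge_one_powr_ge_zero)
  show "of_bool (real l \<le> K) \<le> \<psi> powr (- K) * \<psi> ^ l" if "0 < \<psi>" "\<psi> \<le> 1"
    using that *[of \<psi>] powr_mono'[of "real l - K" 0 \<psi>] by auto
qed

section \<open>Chernoff bounds for exits\<close>

text \<open>
  Raising the source parameter to \<open>a'\<close> favours exits through the sources. At \<open>a'\<close> such an
  exit forces either the source paths above \<open>K\<close> or the total height below \<open>K\<close>; the former
  are dominated by the total height with auxiliary sinks of parameter \<open>b2\<close>.
\<close>

lemma quadrant_bound:
  assumes p: "0 \<le> p" "p \<le> 1" and a: "0 \<le> a" "a \<le> a'" "a' \<le> 1"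
    and b: "0 \<le> b" "b \<le> 1" and ab: "a * b = p * (1 - a) * (1 - b)"
    and b2: "0 \<le> b2" "b2 \<le> 1" and ab2: "a2 * b2 = p * (1 - a2) * (1 - b2)"
    and \<phi>: "1 \<le> \<phi>" "a' * \<phi> = c * a2" "1 - a' = c * (1 - a2)"
    and \<psi>: "0 < \<psi>" "\<psi> \<le> 1" "a' * \<psi> = d * a" "1 - a' = d * (1 - a)"
  shows "iter_mean k (bern_mean b) (\<lambda>J. iter_mean n (col_mean a p k)
      (\<lambda>cs. of_bool (sink_lpp J cs \<le> source_lpp k cs)))
    \<le> \<phi> powr (- K) * (c ^ n * (1 - b2 + b2 * \<phi>) ^ k) + \<psi> powr (- K) * (d ^ n * (1 - b + b * \<psi>) ^ k)"
proof -
  let ?L = "\<lambda>J cs. count_true (map fst cs) + count_true (run_columns J cs)"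
  have a': "0 \<le> a'" using a by simp
  have mb: "mean_functional (bern_mean b)" "mean_functional (bern_mean b2)" "mean_functional
      (iter_mean k (bern_mean b))" "mean_functional (iter_mean k (bern_mean b2))"
    and mc: "mean_functional (iter_mean n (col_mean a' p k))"
    by (intro mean_iter_mean mean_bern_mean mean_col_mean; fact)+
  have H: "iter_mean n (col_mean a' p k) (\<lambda>cs. of_bool (K \<le> real (source_lpp k cs)))
      \<le> \<phi> powr (- K) * (c ^ n * (1 - b2 + b2 * \<phi>) ^ k)" (is "?H \<le> _")
  proof -
    \<comment> \<open>The event does not involve sinks, so averaging over auxiliary ones is free.
      Their parameter \<open>b2\<close> can then be chosen to fit the tilt.\<close>
    have "?H = iter_mean k (bern_mean b2) (\<lambda>J. ?H)" by (simp add: mean_const[OF mb(4)])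
    also have "\<dots> \<le> iter_mean k (bern_mean b2)
        (\<lambda>J. iter_mean n (col_mean a' p k) (\<lambda>cs. \<phi> powr (- K) * \<phi> ^ ?L J cs))"
    proof (rule iter_mean_mono[OF mb(2)], rule cols_mean_mono[OF a' a(3) p])
      fix J :: "bool list" and cs assume J: "length J = k" and cs: "cs \<in> configs n k"
      have "of_bool (K \<le> real (source_lpp k cs)) \<le> (of_bool (K \<le> real (?L J cs)) :: real)"
        using max_sink_lpp_source_lpp[OF cs J] by (auto simp: max_def)
      also have "\<dots> \<le> \<phi> powr (- K) * \<phi> ^ ?L J cs" by (rule chernoff_upper[OF \<phi>(1)])
      finally show "of_bool (K \<le> real (source_lpp k cs)) \<le> \<phi> powr (- K) * \<phi> ^ ?L J cs" .
    qed
    also have "\<dots> = \<phi> powr (- K) * (c ^ n * (1 - b2 + b2 * \<phi>) ^ k)"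
      unfolding mean_cmult[OF mc] mean_cmult[OF mb(4)]
      by (simp only: mgf_stationary[OF b2 p ab2 a' a(3) \<phi>(2,3)])
    finally show ?thesis .
  qed
  have L: "iter_mean k (bern_mean b) (\<lambda>J. iter_mean n (col_mean a' p k)
      (\<lambda>cs. of_bool (real (?L J cs) \<le> K)))
      \<le> \<psi> powr (- K) * (d ^ n * (1 - b + b * \<psi>) ^ k)" (is "?E \<le> _")
  proof -
    have "?E \<le> iter_mean k (bern_mean b) (\<lambda>J. iter_mean n (col_mean a' p k)
        (\<lambda>cs. \<psi> powr (- K) * \<psi> ^ ?L J cs))"
      by (intro mean_mono[OF mb(3)] mean_mono[OF mc] chernoff_lower \<psi>)
    also have "\<dots> = \<psi> powr (- K) * (d ^ n * (1 - b + b * \<psi>) ^ k)"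
      unfolding mean_cmult[OF mc] mean_cmult[OF mb(3)]
      by (simp only: mgf_stationary[OF b p ab a' a(3) \<psi>(3,4)])
    finally show ?thesis .
  qed
  \<comment> \<open>More sources raise \<open>source_lpp\<close> and leave \<open>sink_lpp\<close>
    unchanged, so the exit event is increasing in the source parameter.\<close>
  have "iter_mean k (bern_mean b) (\<lambda>J. iter_mean n (col_mean a p k)
      (\<lambda>cs. of_bool (sink_lpp J cs \<le> source_lpp k cs)))
    \<le> iter_mean k (bern_mean b) (\<lambda>J. iter_mean n (col_mean a' p k)
        (\<lambda>cs. of_bool (sink_lpp J cs \<le> source_lpp k cs)))"
  proof (intro mean_mono[OF mb(3)] cols_mean_mono_param[OF a p])
    fix J :: "bool list" and cs ds :: "(bool \<times> bool list) list" assume "map snd cs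
        = map snd ds" "list_all2 (\<le>) (map fst cs) (map fst ds)"
    then have "sink_lpp J cs = sink_lpp J ds" "source_lpp k cs \<le> source_lpp k ds"
        by (auto intro: sink_lpp_cong source_lpp_mono)
    then show "(of_bool (sink_lpp J cs \<le> source_lpp k cs) :: real)
        \<le> of_bool (sink_lpp J ds \<le> source_lpp k ds)" by auto
  qed
  also have "\<dots> \<le> iter_mean k (bern_mean b) (\<lambda>J. iter_mean n (col_mean a' p k)
      (\<lambda>cs. of_bool (K \<le> real (source_lpp k cs)) + of_bool (real (?L J cs) \<le> K)))"
  proof (rule iter_mean_mono[OF mb(1)], rule cols_mean_mono[OF a' a(3) p])
    fix J :: "bool list" and cs assume J: "length J = k" and cs: "cs \<in> configs n k"
    show "(of_bool (sink_lpp J cs \<le> source_lpp k cs) :: real)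
        \<le> of_bool (K \<le> real (source_lpp k cs)) + of_bool (real (?L J cs) \<le> K)"
      unfolding max_sink_lpp_source_lpp[OF cs J] by (auto simp: max_def)
  qed
  also have "\<dots> = iter_mean n (col_mean a' p k) (\<lambda>cs. of_bool (K \<le> real (source_lpp k cs))) + ?E"
    by (simp only: mean_add[OF mc] mean_add[OF mb(3)] mean_const[OF mb(3)])
  also have "\<dots> \<le> \<phi> powr (- K) * (c ^ n * (1 - b2 + b2 * \<phi>) ^ k)
      + \<psi> powr (- K) * (d ^ n * (1 - b + b * \<psi>) ^ k)"
    by (rule add_mono[OF H L])
  finally show ?thesis .
qed

text \<open>If the right edges differ, a path with sinks beats the number of sources. The indicator
  is therefore at most \<open>\<theta>\<close> to the power \<open>sink_lpp\<close> minus that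
  number. The two parts are independent, and \<open>sink_lpp\<close> lies below a total height with
  explicit moments.\<close>

lemma coalescence_bound:
  assumes p: "0 \<le> p" "p \<le> 1" and a: "0 \<le> a" "a \<le> 1"
    and b: "0 \<le> b" "b \<le> b'" "b' \<le> 1" and a': "0 \<le> a'" "a' \<le> 1"
    and ab': "a'' * b' = p * (1 - a'') * (1 - b')"
    and \<theta>: "1 \<le> \<theta>" "a' * \<theta> = e * a''" "1 - a' = e * (1 - a'')"
  shows "iter_mean k (bern_mean b) (\<lambda>J. iter_mean m (col_mean a p k)
      (\<lambda>cs. of_bool (run_columns (no_sinks k) cs \<noteq> run_columns J cs)))
    \<le> (1 - a + a / \<theta>) ^ m * (e ^ m * (1 - b' + b' * \<theta>) ^ k)"
proof -
  have b1: "b \<le> 1" "0 \<le> b'" using b by auto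
  have mb: "mean_functional (bern_mean b)" "mean_functional (bern_mean b')" "mean_functional
      (iter_mean k (bern_mean b))" "mean_functional (iter_mean k (bern_mean b'))"
    and mc: "mean_functional (iter_mean m (col_mean a p k))" "mean_functional
        (iter_mean m (col_mean a' p k))"
    by (intro mean_iter_mean mean_bern_mean mean_col_mean; fact)+
  have V: "sink_lpp J (map (Pair False) (map snd cs)) = sink_lpp J cs" for J cs
    by (rule sink_lpp_cong) simp
  have "iter_mean k (bern_mean b) (\<lambda>J. iter_mean m (col_mean a p k)
      (\<lambda>cs. of_bool (run_columns (no_sinks k) cs \<noteq> run_columns J cs)))
     \<le> iter_mean k (bern_mean b) (\<lambda>J. iter_mean m (col_mean a p k)
         (\<lambda>cs. (1 / \<theta>) ^ count_true (map fst cs) * \<theta> ^ sink_lpp J cs))"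
  proof (rule iter_mean_mono[OF mb(1)], rule cols_mean_mono[OF a p])
    fix J :: "bool list" and cs assume J: "length J = k" and cs: "cs \<in> configs m k"
    have "(1 / \<theta>) ^ count_true (map fst cs) * \<theta> ^ sink_lpp J cs \<ge> 1"
        if "count_true (map fst cs) < sink_lpp J cs"
      using power_increasing[of "count_true (map fst cs)" "sink_lpp J cs" \<theta>] \<theta>(1) that
      by (simp add: field_simps)
    moreover have "0 \<le> (1 / \<theta>) ^ count_true (map fst cs) * \<theta> ^ sink_lpp J cs" using \<theta>(1) by simp
    ultimately show "of_bool (run_columns (no_sinks k) cs \<noteq> run_columns J cs)
        \<le> (1 / \<theta>) ^ count_true (map fst cs) * \<theta> ^ sink_lpp J cs"
      using run_columns_neq_no_sinks_imp[OF cs J] by auto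
  qed
  \<comment> \<open>By \<open>V\<close>, \<open>sink_lpp\<close> depends on the columns only through
    the weights. Hence the true sources factor out, and \<open>a'\<close> can replace
    \<open>a\<close> in what remains.\<close>
  also have "\<dots> = (1 - a + a / \<theta>) ^ m * iter_mean k (bern_mean b)
      (\<lambda>J. iter_mean m (col_mean a' p k) (\<lambda>cs. \<theta> ^ sink_lpp J cs))"
    using cols_mean_tilt_away[where a'' = a' and g = "\<lambda>ws. \<theta> ^ sink_lpp J (map (Pair False) ws)"
        and s = "1 / \<theta>"
        and a = a and p = p and k = k and n = m for J, unfolded V]
    by (simp only: mean_cmult[OF mb(3)] times_divide_eq_right mult_1_right)
  also have "\<dots> \<le> (1 - a + a / \<theta>) ^ m * (e ^ m * (1 - b' + b' * \<theta>) ^ k)"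
  proof (rule mult_left_mono)
    have "iter_mean k (bern_mean b) (\<lambda>J. iter_mean m (col_mean a' p k) (\<lambda>cs. \<theta> ^ sink_lpp J cs))
      \<le> iter_mean k (bern_mean b') (\<lambda>J. iter_mean m (col_mean a' p k) (\<lambda>cs. \<theta> ^ sink_lpp J cs))"
      by (rule iter_mean_mono_param[OF b], rule mean_mono[OF mc(2)])
        (simp add: sink_lpp_mono power_increasing \<theta>(1))
    also have "\<dots> \<le> iter_mean k (bern_mean b')
        (\<lambda>J. iter_mean m (col_mean a' p k) (\<lambda>cs. \<theta> ^
        (count_true (map fst cs) + count_true (run_columns J cs))))"
    proof (rule iter_mean_mono[OF mb(2)], rule cols_mean_mono[OF a' p])
      fix J :: "bool list" and cs assume "length J = k" "cs \<in> configs m k"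
      then show "\<theta> ^ sink_lpp J cs \<le> \<theta> ^ (count_true (map fst cs) + count_true (run_columns J cs))"
        using \<theta>(1) by (intro power_increasing) (simp_all add: max_sink_lpp_source_lpp)
    qed
    also have "\<dots> = e ^ m * (1 - b' + b' * \<theta>) ^ k"
      by (rule mgf_stationary[OF b1(2) b(3) p ab' a' \<theta>(2,3)])
    finally show "iter_mean k (bern_mean b) (\<lambda>J. iter_mean m (col_mean a' p k)
        (\<lambda>cs. \<theta> ^ sink_lpp J cs)) \<le> e ^ m * (1 - b' + b' * \<theta>) ^ k" .
    have "0 \<le> (1 - a) + a / \<theta>" using a \<theta>(1) by (intro add_nonneg_nonneg) auto
    then show "0 \<le> (1 - a + a / \<theta>) ^ m" by simp
  qed
  finally show ?thesis .
qed

text \<open>Given the first \<open>m\<close> columns, the exit probability is a function of the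
  sinks with values between 0 and 1. Replacing sinks evolved from an empty edge by sinks evolved
  from a stationary edge costs at most the coalescence probability, and stationary sinks keep their
  law.\<close>

lemma halfplane_bound:
  assumes p: "0 \<le> p" "p \<le> 1" and a: "0 \<le> a" "a \<le> 1" and b: "0 \<le> b" "b \<le> 1"
    and ab: "a * b = p * (1 - a) * (1 - b)"
    and Q: "iter_mean k (bern_mean b) (\<lambda>J. iter_mean n (col_mean a p k)
        (\<lambda>cs. of_bool (sink_lpp J cs \<le> source_lpp k cs))) \<le> B1"
    and C: "iter_mean k (bern_mean b) (\<lambda>J. iter_mean m (col_mean a p k)
        (\<lambda>cs. of_bool (run_columns (no_sinks k) cs \<noteq> run_columns J cs))) \<le> B2"
  shows "iter_mean (m + n) (col_mean a p k)
    (\<lambda>cs. of_bool (sink_lpp (run_columns (no_sinks k) (take m cs)) (drop m cs) \<le> source_lpp k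
        (drop m cs))) \<le> B1 + B2"
proof -
  let ?q = "\<lambda>J. iter_mean n (col_mean a p k) (\<lambda>cs. of_bool (sink_lpp J cs \<le> source_lpp k cs)) ::
      real"
  have mb: "mean_functional (bern_mean b)" "mean_functional (iter_mean k (bern_mean b))"
      and mc: "mean_functional (iter_mean m (col_mean a p k))" "mean_functional
      (iter_mean n (col_mean a p k))"
    by (intro mean_iter_mean mean_bern_mean mean_col_mean; fact)+
  have q1: "0 \<le> ?q J" "?q J \<le> 1" for J
    using mean_mono[OF mc(2), of "\<lambda>_. 0" "\<lambda>cs. of_bool (sink_lpp J cs \<le> source_lpp k cs)"]
        mean_const[OF mc(2), of 0]
    by (auto intro!: mean_bounded[OF mc(2)])
  have "iter_mean (m + n) (col_mean a p k) (\<lambda>cs. of_bool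
      (sink_lpp (run_columns (no_sinks k) (take m cs)) (drop m cs) \<le> source_lpp k (drop m cs)))
    = iter_mean m (col_mean a p k) (\<lambda>cs. ?q (run_columns (no_sinks k) cs))"
    unfolding iter_mean_add by (rule cols_mean_cong) (simp add: configs_def)
  also have "\<dots> = iter_mean k (bern_mean b) (\<lambda>J. iter_mean m (col_mean a p k)
      (\<lambda>cs. ?q (run_columns (no_sinks k) cs)))"
    by (simp only: mean_const[OF mb(2)])
  also have "\<dots> \<le> iter_mean k (bern_mean b) (\<lambda>J. iter_mean m (col_mean a p k)
      (\<lambda>cs. ?q (run_columns J cs) + of_bool (run_columns (no_sinks k) cs \<noteq> run_columns J cs)))"
  proof (intro mean_mono[OF mb(2)] mean_mono[OF mc(1)])
    show "?q (run_columns (no_sinks k) cs) \<le> ?q (run_columns J cs)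
        + of_bool (run_columns (no_sinks k) cs \<noteq> run_columns J cs)" for J cs
      using q1(1)[of "run_columns J cs"] q1(2)[of "run_columns (no_sinks k) cs"]
          by (cases "run_columns (no_sinks k) cs
          = run_columns J cs") (auto simp del: iter_mean.simps)
  qed
  also have "\<dots> = iter_mean k (bern_mean b) ?q
      + iter_mean k (bern_mean b) (\<lambda>J. iter_mean m (col_mean a p k)
      (\<lambda>cs. of_bool (run_columns (no_sinks k) cs \<noteq> run_columns J cs)))"
    by (simp only: mean_add[OF mc(1)] mean_add[OF mb(2)] run_columns_stationary[OF b p ab a,
        where F = ?q])
  also have "\<dots> \<le> B1 + B2" by (rule add_mono[OF Q C])
  finally show ?thesis .
qed

lemma mean_count_true: "iter_mean k (bern_mean b) (\<lambda>J. real (count_true J)) = real k * b"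
proof (induction k)
  case (Suc k)
  have 1: "bern_mean b (\<lambda>x. f x + c) = bern_mean b f + c" for f c
      by (simp add: bern_mean_def algebra_simps)
  have 2: "iter_mean k (bern_mean b) (\<lambda>xs. of_bool x + real (count_true xs)) = of_bool x
      + iter_mean k (bern_mean b) (\<lambda>xs. real (count_true xs))" for x
  proof -
    have "iter_mean k (bern_mean b) (\<lambda>xs. y + f xs) = y + iter_mean k (bern_mean b) f" for y f
      by (induction k arbitrary: f) (simp_all add: 1[of f
          for f, simplified add.commute] bern_mean_def algebra_simps)
    then show ?thesis .
  qed
  show ?case by (simp add: 2 Suc) (simp add: bern_mean_def algebra_simps)
qed simp

text \<open>Stationary sinks dominate the empty edge, and Markov's inequality applies to them. The
  essential feature is that the bound does not depend on the strip length \<open>m\<close>.\<close>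

lemma overflow_bound:
  assumes p: "0 \<le> p" "p \<le> 1" and a: "0 \<le> a" "a \<le> 1" and b: "0 \<le> b" "b \<le> 1"
    and ab: "a * b = p * (1 - a) * (1 - b)" and K: "0 < K"
  shows "iter_mean m (col_mean a p k) (\<lambda>cs. of_bool (K
      \<le> real (count_true (run_columns (no_sinks k) cs)))) \<le> real k * b / K"
proof -
  have mb: "mean_functional (bern_mean b)" "mean_functional (iter_mean k (bern_mean b))"
      and mc: "mean_functional (iter_mean m (col_mean a p k))"
    by (intro mean_iter_mean mean_bern_mean mean_col_mean; fact)+
  have "iter_mean m (col_mean a p k) (\<lambda>cs. of_bool (K
      \<le> real (count_true (run_columns (no_sinks k) cs))))
     = iter_mean k (bern_mean b) (\<lambda>J. iter_mean m (col_mean a p k)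
         (\<lambda>cs. of_bool (K \<le> real (count_true (run_columns (no_sinks k) cs)))))"
    by (simp only: mean_const[OF mb(2)])
  also have "\<dots> \<le> iter_mean k (bern_mean b) (\<lambda>J. iter_mean m (col_mean a p k)
      (\<lambda>cs. (1 / K) * real (count_true (run_columns J cs))))"
  proof (rule iter_mean_mono[OF mb(1)], rule cols_mean_mono[OF a p])
    fix J :: "bool list" and cs assume "length J = k" "cs \<in> configs m k"
    then show "of_bool (K \<le> real (count_true (run_columns (no_sinks k) cs)))
        \<le> (1 / K) * real (count_true (run_columns J cs))"
      using count_true_run_columns_no_sinks_le[of cs m k J] K by (auto simp: field_simps)
  qed
  also have "\<dots> = (1 / K) * iter_mean k (bern_mean b) (\<lambda>J. real (count_true J))"
    by (simp only: mean_cmult[OF mc] mean_cmult[OF mb(2)] run_columns_stationary[OF b p ab a,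
        where F = "\<lambda>J. real (count_true J)"])
  finally show ?thesis by (simp add: mean_count_true)
qed

section \<open>Comparison of grid paths with continuum paths\<close>

text \<open>Restarting the recursion at column \<open>m\<close>: heights further right depend on the
  past only through the heights on that column, and a common constant can be taken out.\<close>

lemma grid_lpp_shift:
  assumes "\<And>i. X (m + i) = c + X2 i" "\<And>j. j \<le> k \<Longrightarrow> grid_lpp X Y w m j = c + Y2 j" "j \<le> k"
  shows "grid_lpp X Y w (m + i) j = c + grid_lpp X2 Y2 (\<lambda>i. w (m + i)) i j"
  using assms(3)
proof (induction i arbitrary: j)
  case 0 then show ?case by (simp add: assms(2))
next
  case (Suc i)
  note IH = Suc.IH
  show ?case using Suc.prems
  proof (induction j)
    case 0 then show ?case using assms(1)[of "Suc i"] by simp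
  next
    case (Suc j)
    then show ?case by (simp add: IH max_def)
  qed
qed

section \<open>Grid heights as maxima over exit points and chains of cells\<close>

definition grid_chain :: "(nat \<times> nat) set \<Rightarrow> bool" where
  "grid_chain S \<longleftrightarrow> (\<forall>x\<in>S. \<forall>y\<in>S. x \<noteq> y \<longrightarrow>
      (fst x < fst y \<and> snd x < snd y) \<or> (fst y < fst x \<and> snd y < snd x))"

lemma grid_chain_subset: "grid_chain S \<Longrightarrow> T \<subseteq> S \<Longrightarrow> grid_chain T"
  unfolding grid_chain_def by (meson subsetD)

text \<open>Following the maximum in the recursion backwards yields an optimal exit and an optimal
  chain. The condition on \<open>X 0\<close> matches the zero height of the left edge at the
  corner.\<close>

lemma grid_lpp_lower:
  assumes "X 0 = 0"
  shows "\<exists>i0 S. i0 \<le> i \<and> grid_chain S \<and> S \<subseteq> {i0..<i} \<times> {..<j} \<and> (\<forall>s\<in>S. w (fst s) (snd s)) \<and>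
    grid_lpp X (\<lambda>_. 0) w i j = X i0 + card S"
  (is "?P i j")
proof (induction i arbitrary: j)
  case 0 show ?case using assms by (intro exI[of _ 0] exI[of _ "{}"]) (simp add: grid_chain_def)
next
  case (Suc i)
  note IH = Suc.IH
  show ?case
  proof (induction j)
    case 0 show ?case by (intro exI[of _ "Suc i"] exI[of _ "{}"]) (simp add: grid_chain_def)
  next
    case (Suc j)
    have M: "max (max a b) c = a \<or> max (max a b) c = b \<or> max (max a b) c = c" for a b c :: nat
      by (auto simp: max_def)
    consider "grid_lpp X (\<lambda>_. 0) w (Suc i) (Suc j) = grid_lpp X (\<lambda>_. 0) w i (Suc j)"
      | "grid_lpp X (\<lambda>_. 0) w (Suc i) (Suc j) = grid_lpp X (\<lambda>_. 0) w (Suc i) j"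
      | "grid_lpp X (\<lambda>_. 0) w (Suc i) (Suc j) = grid_lpp X (\<lambda>_. 0) w i j + 1" "w i j"
      | "grid_lpp X (\<lambda>_. 0) w (Suc i) (Suc j) = grid_lpp X (\<lambda>_. 0) w i j"
      using M[of "grid_lpp X (\<lambda>_. 0) w i (Suc j)" "grid_lpp X (\<lambda>_. 0) w (Suc i) j" "grid_lpp X
          (\<lambda>_. 0) w i j + of_bool (w i j)"]
      unfolding grid_lpp.simps(3)[of X "\<lambda>_. 0" w i j]
          by (cases "w i j") (simp_all only: of_bool_eq add_0_right, blast+)
    then show ?case
    proof cases
      case 1
      obtain i0 S where "i0 \<le> i" "grid_chain S" "S
          \<subseteq> {i0..<i} \<times> {..<Suc j}" "\<forall>s\<in>S. w (fst s) (snd s)"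
        "grid_lpp X (\<lambda>_. 0) w i (Suc j) = X i0 + card S" using IH[of "Suc j"] by blast
      moreover have "{i0..<i} \<times> {..<Suc j} \<subseteq> {i0..<Suc i} \<times> {..<Suc j}" by auto
      ultimately show ?thesis using 1 by (intro exI[of _ i0] exI[of _ S]) auto
    next
      case 2
      obtain i0 S where "i0 \<le> Suc i" "grid_chain S" "S
          \<subseteq> {i0..<Suc i} \<times> {..<j}" "\<forall>s\<in>S. w (fst s) (snd s)"
        "grid_lpp X (\<lambda>_. 0) w (Suc i) j = X i0 + card S" using Suc.IH by blast
      moreover have "{i0..<Suc i} \<times> {..<j} \<subseteq> {i0..<Suc i} \<times> {..<Suc j}" by auto
      ultimately show ?thesis using 2 by (intro exI[of _ i0] exI[of _ S]) auto
    next
      case 3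
      obtain i0 S where S: "i0 \<le> i" "grid_chain S" "S \<subseteq> {i0..<i} \<times> {..<j}" "\<forall>s\<in>S. w (fst s) (snd s)"
        "grid_lpp X (\<lambda>_. 0) w i j = X i0 + card S" using IH[of j] by blast
      have fin: "finite S" by (rule finite_subset[OF S(3)]) simp
      have lt: "fst x < i \<and> snd x < j" if "x \<in> S" for x using S(3) that by auto
      then have "grid_chain (insert (i, j) S)" using S(2) unfolding grid_chain_def by auto
      moreover have "(i, j) \<notin> S" using lt[of "(i, j)"] by auto
      moreover have "insert (i, j) S \<subseteq> {i0..<Suc i} \<times> {..<Suc j}" using S(1,3) by auto
      ultimately show ?thesis using 3 S fin by (intro exI[of _ i0] exI[of _ "insert (i, j) S"]) auto
    next
      case 4
      obtain i0 S where "i0 \<le> i" "grid_chain S" "S \<subseteq> {i0..<i} \<times> {..<j}" "\<forall>s\<in>S. w (fst s) (snd s)"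
        "grid_lpp X (\<lambda>_. 0) w i j = X i0 + card S" using IH[of j] by blast
      moreover have "{i0..<i} \<times> {..<j} \<subseteq> {i0..<Suc i} \<times> {..<Suc j}" by auto
      ultimately show ?thesis using 4 by (intro exI[of _ i0] exI[of _ S]) auto
    qed
  qed
qed

text \<open>The converse of \<open>grid_lpp_lower\<close>: every exit with a chain of occupied cells
  to its right is a competitor.\<close>

lemma grid_lpp_upper:
  assumes "mono X" "X 0 = 0"
  shows "i0 \<le> i \<Longrightarrow> grid_chain S \<Longrightarrow> S \<subseteq> {i0..<i} \<times> {..<j} \<Longrightarrow> \<forall>s\<in>S. w (fst s) (snd s) \<Longrightarrow>
    X i0 + card S \<le> grid_lpp X (\<lambda>_. 0) w i j"
proof (induction i arbitrary: j S)
  case 0 then show ?case using assms by simp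
next
  case (Suc i)
  note IH = Suc.IH
  note prems = Suc.prems
  show ?case
  proof (cases "i0 = Suc i")
    case True
    then have "S = {}" using Suc.prems by auto
    moreover have "X (Suc i) \<le> grid_lpp X (\<lambda>_. 0) w (Suc i) j"
      using grid_lpp_mono_j[of "\<lambda>_. 0" 0 j X w "Suc i"] by (simp add: mono_def)
    ultimately show ?thesis using True by simp
  next
    case False
    then have i0: "i0 \<le> i" using Suc.prems by simp
    show ?thesis using Suc.prems(2-)
    proof (induction j arbitrary: S)
      case 0
      then have "S = {}" by auto
      then show ?case using i0 monoD[OF assms(1), of i0 "Suc i"] by simp
    next
      case (Suc j)
      have fin: "finite S" by (rule finite_subset[OF Suc.prems(2)]) simp
      \<comment> \<open>A chain that avoids the corner cell cannot meet both the last column and the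
        last row, since two such cells would not be ordered.\<close>
      consider (corner) "(i, j) \<in> S" | (col) "S \<subseteq> {i0..<i} \<times> {..<Suc j}" | (row) "S
          \<subseteq> {i0..<Suc i} \<times> {..<j}"
      proof (cases "(i, j) \<in> S \<or> S \<subseteq> {i0..<i} \<times> {..<Suc j} \<or> S \<subseteq> {i0..<Suc i} \<times> {..<j}")
        case False
        then obtain x y where xy: "x \<in> S" "x \<notin> {i0..<i} \<times> {..<Suc j}" "y
            \<in> S" "y \<notin> {i0..<Suc i} \<times> {..<j}"
          by blast
        then have "fst x = i" "snd y = j" "snd x \<le> j" "fst y \<le> i"
          using Suc.prems(2) by (cases x; cases y; force)+
        moreover have "x \<noteq> (i, j)" "y \<noteq> (i, j)" using xy False by auto
        ultimately show ?thesis using Suc.prems(1) xy(1,3) unfolding grid_chain_def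
          by (metis linorder_not_less prod.collapse)
      qed blast
      then show ?case
      proof cases
        case corner
        let ?T = "S - {(i, j)}"
        have T: "grid_chain ?T" "\<forall>s\<in>?T. w (fst s) (snd s)"
          using Suc.prems grid_chain_subset[of S ?T] by auto
        have "x \<in> {i0..<i} \<times> {..<j}" if x: "x \<in> ?T" for x
        proof -
          have "x \<noteq> (i, j)" "x \<in> S" using x by auto
          moreover have "x \<in> {i0..<Suc i} \<times> {..<Suc j}" using x Suc.prems(2) by auto
          ultimately show ?thesis using Suc.prems(1) corner unfolding grid_chain_def
            by (cases x) force
        qed
        then have "X i0 + card ?T \<le> grid_lpp X (\<lambda>_. 0) w i j" by (intro IH i0 T) auto
        moreover have "w i j" using corner Suc.prems(3) by auto
        moreover have "card S = Suc (card ?T)" by (rule card.remove[OF fin corner])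
        ultimately show ?thesis by simp
      next
        case col
        then have "X i0 + card S \<le> grid_lpp X (\<lambda>_. 0) w i (Suc j)" using Suc.prems
            by (intro IH i0) auto
        then show ?thesis by (simp add: le_max_iff_disj)
      next
        case row
        then have "X i0 + card S \<le> grid_lpp X (\<lambda>_. 0) w (Suc i) j" using Suc.prems
            by (intro Suc.IH) auto
        then show ?thesis by (simp add: le_max_iff_disj)
      qed
    qed
  qed
qed

section \<open>Chains of points in rectangles\<close>

definition rect :: "real \<times> real \<Rightarrow> real \<times> real \<Rightarrow> (real \<times> real) set" where
  "rect p q = {x. fst p < fst x \<and> fst x \<le> fst q \<and> snd p < snd x \<and> snd x \<le> snd q}"

lemma rect_eq: "rect (a, b) (c, d) = {a<..c} \<times> {b<..d}"
  by (auto simp: rect_def)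

lemma bounded_rect: "bounded (rect p q)"
  by (cases p; cases q) (auto simp: rect_eq intro!: bounded_Times)

definition locally_finite :: "'a::metric_space set \<Rightarrow> bool" where
  "locally_finite Q \<longleftrightarrow> (\<forall>B. bounded B \<longrightarrow> finite (Q \<inter> B))"

lemma LPP_rect: "LPP Q p q = Sup {card S | S. finite S \<and> incr_chain S \<and> S \<subseteq> Q \<inter> rect p q}"
  by (simp add: LPP_def rect_def)

lemma finite_chains:
  assumes "locally_finite Q"
  shows "finite {card S | S. finite S \<and> incr_chain S \<and> S \<subseteq> Q \<inter> rect p q}"
proof -
  have "finite (Q \<inter> rect p q)" using assms bounded_rect by (auto simp: locally_finite_def)
  then have "finite (card ` Pow (Q \<inter> rect p q))" by (simp only: finite_Pow_iff finite_imageI)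
  then show ?thesis by (rule rev_finite_subset) auto
qed

lemma LPP_ge:
  assumes "locally_finite Q" "finite S" "incr_chain S" "S \<subseteq> Q \<inter> rect p q"
  shows "card S \<le> LPP Q p q"
  unfolding LPP_rect
  by (rule cSup_upper) (use assms finite_chains[OF assms(1)] in \<open>auto intro!: bdd_above_finite\<close>)

lemma LPP_attained:
  assumes "locally_finite Q"
  obtains S where "finite S" "incr_chain S" "S \<subseteq> Q \<inter> rect p q" "card S = LPP Q p q"
proof -
  let ?A = "{card S | S. finite S \<and> incr_chain S \<and> S \<subseteq> Q \<inter> rect p q}"
  have "0 \<in> ?A" by (auto intro!: exI[of _ "{}"] simp: incr_chain_def)
  then have ne: "?A \<noteq> {}" by blast
  have "Sup ?A = Max ?A" unfolding Sup_nat_def by (rule if_not_P[OF ne])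
  then have "Sup ?A \<in> ?A" using Max_in[OF finite_chains[OF assms] ne] by (rule ssubst)
  then obtain S where "finite S" "incr_chain S" "S \<subseteq> Q \<inter> rect p q" "Sup ?A = card S" by blast
  then show ?thesis using that[of S] unfolding LPP_rect by simp
qed

section \<open>Reading a configuration off the points, and cells that separate points\<close>

definition cell_interval :: "real \<Rightarrow> real \<Rightarrow> nat \<Rightarrow> real set" where
  "cell_interval x0 w i = {x0 + real i * w<..x0 + real (Suc i) * w}"

text \<open>Only occupancy is recorded, which gives independent bits. Multiple points in a cell are
  lost, and this is harmless once the grid separates the points.\<close>

definition grid_config ::
  "real \<Rightarrow> real \<Rightarrow> real \<Rightarrow> nat \<Rightarrow> nat \<Rightarrow> (real \<times> real) set \<Rightarrow> real set \<Rightarrow> (bool \<times> bool list) list" where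
  "grid_config x0 w h M k Q N = map (\<lambda>i. (N \<inter> cell_interval x0 w i \<noteq> {},
     map (\<lambda>j. Q \<inter> cell_interval x0 w i \<times> cell_interval 0 h j \<noteq> {}) [0..<k])) [0..<M]"

lemma grid_config_in_configs: "grid_config x0 w h M k Q N \<in> configs M k"
  by (auto simp: grid_config_def configs_def)

lemma length_grid_config [simp]: "length (grid_config x0 w h M k Q N) = M"
  by (simp add: grid_config_def)

lemma cell_interval_shift: "cell_interval x0 w (m + i) = cell_interval (x0 + real m * w) w i"
  by (simp add: cell_interval_def algebra_simps)

lemma drop_grid_config: "drop m (grid_config x0 w h (m + n) k Q N)
    = grid_config (x0 + real m * w) w h n k Q N"
  by (rule nth_equalityI) (auto simp: grid_config_def cell_interval_shift)

lemma take_grid_config: "take m (grid_config x0 w h (m + n) k Q N) = grid_config x0 w h m k Q N"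
  by (rule nth_equalityI) (auto simp: grid_config_def)

lemma occupied_grid_config: "i < M \<Longrightarrow> j < k \<Longrightarrow> occupied (grid_config x0 w h M k Q N) i j
    \<longleftrightarrow> Q \<inter> cell_interval x0 w i \<times> cell_interval 0 h j \<noteq> {}"
  by (simp add: occupied_def grid_config_def)

lemma count_true_map_upt: "count_true (map f [0..<i]) = card {i'. i' < i \<and> f i'}"
proof (induction i)
  case (Suc i)
  have "{i'. i' < Suc i \<and> f i'} = (if f i then insert i {i'. i' < i \<and> f i'} else
      {i'. i' < i \<and> f i'})"
    by (auto simp: less_Suc_eq)
  then show ?case using Suc by simp
qed (simp add: count_true_def)

lemma source_sum_grid_config: "i \<le> M \<Longrightarrow> source_sum (grid_config x0 w h M k Q N) i
    = card {i'. i' < i \<and> N \<inter> cell_interval x0 w i' \<noteq> {}}"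
  by (simp add: source_sum_def grid_config_def take_map comp_def count_true_map_upt)

text \<open>The ceiling minus 1 is used because cells are open on the left and closed on the right,
  like the intervals in \<open>nu_count\<close> and \<open>LPP\<close>.\<close>

definition cell_index :: "real \<Rightarrow> real \<Rightarrow> real \<Rightarrow> nat" where
  "cell_index x0 w y = nat (\<lceil>(y - x0) / w\<rceil> - 1)"

lemma mem_cell_interval_cell_index:
  assumes "0 < w" "x0 < y" shows "y \<in> cell_interval x0 w (cell_index x0 w y)"
proof -
  let ?r = "(y - x0) / w"
  have "0 < ?r" using assms by simp
  then have c: "1 \<le> \<lceil>?r\<rceil>" by linarith
  then have r: "real (cell_index x0 w y) = of_int \<lceil>?r\<rceil> - 1" by (simp add: cell_index_def)
  have "real (cell_index x0 w y) < ?r" "?r \<le> real (Suc (cell_index x0 w y))"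
    using r by (simp_all, linarith+)
  then show ?thesis using assms(1) by (simp add: cell_interval_def field_simps)
qed

lemma cell_index_less:
  assumes "0 < w" "x0 < y" "y \<le> x0 + real M * w" shows "cell_index x0 w y < M"
proof -
  have "x0 + real (cell_index x0 w y) * w < x0 + real M * w"
    using mem_cell_interval_cell_index[OF assms(1,2)] assms(3) by (simp add: cell_interval_def)
  then show ?thesis using assms(1) by simp
qed

lemma cell_index_ge:
  assumes "0 < w" "x0 + real i * w < y" "x0 < y" shows "i \<le> cell_index x0 w y"
proof -
  have "real i * w < real (Suc (cell_index x0 w y)) * w"
    using mem_cell_interval_cell_index[OF assms(1,3)] assms(2) by (simp add: cell_interval_def)
  then have "i < Suc (cell_index x0 w y)" using assms(1) mult_less_cancel_right_pos
      of_nat_less_iff by blast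
  then show ?thesis by simp
qed

lemma cell_index_strict:
  assumes "0 < w" "x0 < y" "w < y' - y" shows "cell_index x0 w y < cell_index x0 w y'"
proof -
  have "x0 + real (Suc (cell_index x0 w y)) * w < y'"
    using mem_cell_interval_cell_index[OF assms(1,2)] assms(3)
        by (simp add: cell_interval_def algebra_simps)
  then have "Suc (cell_index x0 w y) \<le> cell_index x0 w y'" using assms by (intro cell_index_ge) auto
  then show ?thesis by simp
qed

text \<open>
  On gapped sets distinct points fall into distinct cells of width at most \<open>d\<close>.
\<close>

definition gapped :: "real \<Rightarrow> real set \<Rightarrow> bool" where
  "gapped d A \<longleftrightarrow> (\<forall>x\<in>A. \<forall>y\<in>A. x < y \<longrightarrow> d < y - x)"

lemma gapped_subset: "gapped d A \<Longrightarrow> B \<subseteq> A \<Longrightarrow> gapped d B"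
  by (auto simp: gapped_def)

lemma finite_gapped:
  assumes "finite A" obtains e where "0 < e" "\<And>d. d < e \<Longrightarrow> gapped d A"
proof -
  let ?D = "{y - x | x y. x \<in> A \<and> y \<in> A \<and> x < y}"
  have "?D \<subseteq> (\<lambda>(x, y). y - x) ` (A \<times> A)" by auto
  then have "finite ?D" by (rule finite_subset) (simp add: assms)
  \<comment> \<open>The element 1 keeps the set of distances nonempty when \<open>A\<close> has
    fewer than two points.\<close>
  then have fin: "finite (insert 1 ?D)" by simp
  have le: "Min (insert 1 ?D) \<le> y - x" if "x \<in> A" "y \<in> A" "x < y" for x y
    using fin that by (intro Min_le) auto
  have "0 < Min (insert 1 ?D)" using fin by (subst Min_gr_iff) auto
  moreover have "gapped d A" if "d < Min (insert 1 ?D)" for d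
    unfolding gapped_def using le less_le_trans[OF that] by blast
  ultimately show ?thesis by (rule that)
qed

lemma cell_index_inj:
  assumes "gapped w A" "0 < w" "\<And>y. y \<in> A \<Longrightarrow> x0 < y" shows "inj_on (cell_index x0 w) A"
proof (rule inj_onI)
  fix x y assume *: "x \<in> A" "y \<in> A" "cell_index x0 w x = cell_index x0 w y"
  show "x = y"
  proof (rule ccontr)
    assume "x \<noteq> y"
    then have "w < y - x \<or> w < x - y" using assms(1) * by (auto simp: gapped_def neq_iff)
    then show False using cell_index_strict[OF assms(2), of x0 x y]
        cell_index_strict[OF assms(2), of x0 y x] assms(3) * by auto
  qed
qed

lemma cell_interval_disjoint: "0 < w \<Longrightarrow> i < i' \<Longrightarrow> y \<in> cell_interval x0 w i
    \<Longrightarrow> y' \<in> cell_interval x0 w i' \<Longrightarrow> y < y'"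
proof -
  assume a: "0 < w" "i < i'" "y \<in> cell_interval x0 w i" "y' \<in> cell_interval x0 w i'"
  then have "real (Suc i) * w \<le> real i' * w" by (intro mult_right_mono) auto
  moreover have "y \<le> x0 + real (Suc i) * w" "x0 + real i' * w < y'" using a(3,4)
      by (auto simp: cell_interval_def)
  ultimately show ?thesis by linarith
qed

lemma cell_interval_subset:
  assumes "0 < w" "i0 \<le> i" "i < M" shows "cell_interval x0 w i
      \<subseteq> {x0 + real i0 * w<..x0 + real M * w}"
proof -
  have "real i0 * w \<le> real i * w" "real (Suc i) * w \<le> real M * w"
    using assms by (auto intro!: mult_right_mono)
  then show ?thesis by (auto simp: cell_interval_def)
qed

text \<open>Choosing one point in every occupied cell is injective, on any grid. The reverse
  comparison needs gaps.\<close>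

lemma source_sum_le_card:
  assumes "locally_finite N" "0 < w"
  shows "source_sum (grid_config x0 w h M k Q N) M \<le> card (N \<inter> {x0<..x0 + real M * w})"
proof -
  let ?I = "{i. i < M \<and> N \<inter> cell_interval x0 w i \<noteq> {}}"
  have "\<forall>i\<in>?I. \<exists>y. y \<in> N \<inter> cell_interval x0 w i" by blast
  from bchoice[OF this] obtain f where f: "\<And>i. i \<in> ?I \<Longrightarrow> f i \<in> N \<inter> cell_interval x0 w i" by blast
  have "inj_on f ?I"
  proof (rule inj_onI)
    fix i i' assume "i \<in> ?I" "i' \<in> ?I" "f i = f i'"
    then show "i = i'" using cell_interval_disjoint[OF assms(2), of i i' "f i" x0 "f i'"]
        cell_interval_disjoint[OF assms(2), of i' i "f i'" x0 "f i"] f[of i] f[of i']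
            by (cases i i' rule: linorder_cases) auto
  qed
  moreover have "f ` ?I \<subseteq> N \<inter> {x0<..x0 + real M * w}"
  proof
    fix y assume "y \<in> f ` ?I"
    then obtain i where "i \<in> ?I" "y = f i" by blast
    then show "y \<in> N \<inter> {x0<..x0 + real M * w}"
      using f[of i] cell_interval_subset[OF assms(2), of 0 i M x0] by auto
  qed
  moreover have "finite (N \<inter> {x0<..x0 + real M * w})"
    using assms(1) by (auto simp: locally_finite_def)
  ultimately have "card ?I \<le> card (N \<inter> {x0<..x0 + real M * w})" by (rule card_inj_on_le)
  then show ?thesis by (simp add: source_sum_grid_config)
qed

text \<open>Gapped points occupy different cells, so the cells from \<open>i\<close> on count at
  least the points there.\<close>

lemma source_sum_gap:
  assumes "gapped w (N \<inter> {x0<..x0 + real M * w})" "0 < w" "i \<le> M"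
  shows "source_sum (grid_config x0 w h M k Q N) i
      + card (N \<inter> {x0 + real i * w<..x0 + real M * w}) \<le> source_sum (grid_config x0 w h M k Q N) M"
proof -
  let ?B = "N \<inter> {x0 + real i * w<..x0 + real M * w}"
  let ?I = "\<lambda>i. {i'. i' < i \<and> N \<inter> cell_interval x0 w i' \<noteq> {}}"
  have x0: "x0 < y" if "y \<in> ?B" for y
  proof -
    have "0 \<le> real i * w" using assms(2) by simp
    then show ?thesis using that by auto
  qed
  have "inj_on (cell_index x0 w) ?B"
    by (rule cell_index_inj[OF gapped_subset[OF assms(1)] assms(2)]) (use x0 in auto)
  moreover have im: "cell_index x0 w ` ?B \<subseteq> {i..<M} \<inter> ?I M"
  proof
    fix l assume "l \<in> cell_index x0 w ` ?B"
    then obtain y where y: "y \<in> ?B" "l = cell_index x0 w y" by blast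
    have "y \<in> N \<inter> cell_interval x0 w l" using
        mem_cell_interval_cell_index[OF assms(2) x0[OF y(1)]] y by simp
    moreover have "i \<le> l" using cell_index_ge[OF assms(2) _ x0[OF y(1)], of i] y by simp
    moreover have "l < M" using cell_index_less[OF assms(2) x0[OF y(1)], of M] y by simp
    ultimately show "l \<in> {i..<M} \<inter> ?I M" by auto
  qed
  ultimately have "card ?B \<le> card ({i..<M} \<inter> ?I M)" by (intro card_inj_on_le) auto
  moreover have "card (?I i \<union> ({i..<M} \<inter> ?I M)) = card (?I i) + card ({i..<M} \<inter> ?I M)"
    by (rule card_Un_disjoint) auto
  moreover have "?I i \<union> ({i..<M} \<inter> ?I M) = ?I M" using assms(3) by auto
  ultimately show ?thesis using assms(3) by (simp add: source_sum_grid_config)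
qed

text \<open>Points picked from a strict chain of occupied cells are strictly increasing in both
  coordinates, whatever the mesh. Grid paths thus never overestimate the continuum.\<close>

lemma cells_le_LPP:
  assumes "locally_finite Q" "0 < w" "0 < h" "grid_chain S" "S \<subseteq> {i0..<M} \<times> {..<k}"
    and "\<forall>s\<in>S. occupied (grid_config x0 w h M k Q N) (fst s) (snd s)"
  shows "card S \<le> LPP Q (x0 + real i0 * w, 0) (x0 + real M * w, real k * h)"
proof -
  have fin: "finite S" by (rule finite_subset[OF assms(5)]) simp
  have "\<exists>x. x \<in> Q \<inter> cell_interval x0 w (fst s) \<times> cell_interval 0 h (snd s)" if "s \<in> S" for s
  proof -
    have "fst s < M" "snd s < k" using that assms(5) by auto
    then show ?thesis using occupied_grid_config[of "fst s" M "snd s" k x0 w h Q N] assms(6) that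
        by blast
  qed
  then have "\<forall>s\<in>S. \<exists>x. x \<in> Q \<inter> cell_interval x0 w (fst s) \<times> cell_interval 0 h (snd s)" by blast
  from bchoice[OF this]
  obtain f where f: "\<And>s. s \<in> S \<Longrightarrow> f s \<in> Q \<inter> cell_interval x0 w (fst s) \<times> cell_interval 0 h (snd s)"
      by blast
  have lt: "fst (f s) < fst (f s') \<and> snd (f s) < snd (f s')"
    if "s \<in> S" "s' \<in> S" "fst s < fst s'" "snd s < snd s'" for s s'
    using f[OF that(1)] f[OF that(2)] cell_interval_disjoint[OF assms(2) that(3)]
        cell_interval_disjoint[OF assms(3) that(4)]
    by (auto simp: mem_Times_iff)
  have inj: "inj_on f S"
  proof (rule inj_onI, rule ccontr)
    fix s s' assume s: "s \<in> S" "s' \<in> S" "f s = f s'" "s \<noteq> s'"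
    show False using bspec[OF bspec[OF assms(4)[unfolded grid_chain_def] s(1)] s(2)] s(3,4)
        lt[OF s(1,2)] lt[OF s(2,1)] by auto
  qed
  have "incr_chain (f ` S)" unfolding incr_chain_def
  proof (intro ballI impI)
    fix x y assume "x \<in> f ` S" "y \<in> f ` S" and ne: "x \<noteq> y"
    then obtain s s' where s: "s \<in> S" "s' \<in> S" "x = f s" "y = f s'" by blast
    show "fst x < fst y \<and> snd x < snd y \<or> fst y < fst x \<and> snd y < snd x"
      using bspec[OF bspec[OF assms(4)[unfolded grid_chain_def] s(1)] s(2)] ne s(3,4)
        lt[OF s(1,2)] lt[OF s(2,1)] by auto
  qed
  moreover have "f ` S \<subseteq> Q \<inter> rect (x0 + real i0 * w, 0) (x0 + real M * w, real k * h)"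
  proof
    fix x assume "x \<in> f ` S"
    then obtain s where s: "s \<in> S" "x = f s" by blast
    then have "i0 \<le> fst s" "fst s < M" "0 \<le> snd s" "snd s < k" using assms(5) by auto
    then show "x \<in> Q \<inter> rect (x0 + real i0 * w, 0) (x0 + real M * w, real k * h)"
      using f[OF s(1)] s(2) cell_interval_subset[OF assms(2), of i0 "fst s" M x0]
        cell_interval_subset[OF assms(3), of 0 "snd s" k 0]
      by (auto simp: rect_eq mem_Times_iff)
  qed
  ultimately show ?thesis
    using LPP_ge[OF assms(1), of "f ` S"] fin card_image[OF inj] by auto
qed

text \<open>On a separating grid an increasing chain of points occupies an increasing chain of
  cells, so no reward of a continuum path is lost.\<close>

lemma source_LPP_le_grid_lpp:
  assumes lf: "locally_finite Q" "locally_finite N" and wh: "0 < w" "0 < h"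
    and gx: "gapped w (N \<inter> {x0<..x0 + real M * w} \<union> fst `
        (Q \<inter> rect (x0, 0) (x0 + real M * w, real k * h)))"
    and gy: "gapped h (snd ` (Q \<inter> rect (x0, 0) (x0 + real M * w, real k * h)))"
    and z: "x0 \<le> z" "z \<le> x0 + real M * w"
  shows "card (N \<inter> {x0<..z}) + LPP Q (z, 0) (x0 + real M * w, real k * h)
    \<le> grid_lpp (source_sum (grid_config x0 w h M k Q N)) (\<lambda>_. 0)
        (occupied (grid_config x0 w h M k Q N)) M k"
proof -
  let ?c = "grid_config x0 w h M k Q N" and ?R = "rect (x0, 0) (x0 + real M * w, real k * h)"
  let ?A = "N \<inter> {x0<..z}"
  have finA: "finite ?A" using lf(2) by (auto simp: locally_finite_def)
  \<comment> \<open>The grid path leaves the axis right after the cell of the last source, not after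
    the cell of \<open>z\<close>, which could contain a point of the chain. The joint gap between
    sources and points puts the chain into cells from \<open>i0\<close> on.\<close>
  define i0 where "i0 = (if ?A = {} then 0 else Suc (cell_index x0 w (Max ?A)))"
  have Max: "Max ?A \<in> ?A" if "?A \<noteq> {}" using finA that by (rule Max_in)
  have i0M: "i0 \<le> M"
  proof (cases "?A = {}")
    case False
    have "cell_index x0 w (Max ?A) < M" using Max[OF False] z
        by (intro cell_index_less[OF wh(1)]) auto
    then show ?thesis unfolding i0_def using False by simp
  qed (simp add: i0_def)
  have gA: "gapped w ?A" using gx by (rule gapped_subset) (use z in auto)
  have "card ?A \<le> source_sum ?c i0"
  proof -
    have "inj_on (cell_index x0 w) ?A" by (rule cell_index_inj[OF gA wh(1)]) auto
    moreover have "cell_index x0 w ` ?A \<subseteq> {i'. i' < i0 \<and> N \<inter> cell_interval x0 w i' \<noteq> {}}"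
    proof
      fix i assume "i \<in> cell_index x0 w ` ?A"
      then obtain y where y: "y \<in> ?A" "i = cell_index x0 w y" by blast
      then have "?A \<noteq> {}" by blast
      have "y \<le> Max ?A" using finA y(1) by simp
      then have "cell_index x0 w y \<le> cell_index x0 w (Max ?A)"
        using gA y Max[OF \<open>?A \<noteq> {}\<close>] cell_index_strict[OF wh(1), of x0 y "Max ?A"]
        unfolding gapped_def by (cases "y = Max ?A") force+
      then have "i < i0" using y \<open>?A \<noteq> {}\<close> unfolding i0_def by simp
      moreover have "y \<in> N \<inter> cell_interval x0 w i"
          using y mem_cell_interval_cell_index[OF wh(1), of x0 y] by auto
      ultimately show "i \<in> {i'. i' < i0 \<and> N \<inter> cell_interval x0 w i' \<noteq> {}}" by blast
    qed
    ultimately have "card ?A \<le> card {i'. i' < i0 \<and> N \<inter> cell_interval x0 w i' \<noteq> {}}"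
        by (intro card_inj_on_le) auto
    then show ?thesis using i0M by (simp add: source_sum_grid_config)
  qed
  moreover obtain S where S: "finite S" "incr_chain S" "S
      \<subseteq> Q \<inter> rect (z, 0) (x0 + real M * w, real k * h)"
    "card S = LPP Q (z, 0) (x0 + real M * w, real k * h)" by (rule LPP_attained[OF lf(1)])
  define f where "f = (\<lambda>x. (cell_index x0 w (fst x), cell_index 0 h (snd x)))"
  have SR: "x \<in> Q \<inter> ?R" if "x \<in> S" for x using S(3) that z by (auto simp: rect_eq)
  have Sz: "z < fst x" if "x \<in> S" for x using S(3) that by (auto simp: rect_def)
  have pos: "x0 < fst x" "0 < snd x" "fst x \<le> x0 + real M * w" "snd x \<le> real k * h" if "x \<in> S" for x
    using SR[OF that] by (auto simp: rect_def)
  have lt: "fst (f x) < fst (f y) \<and> snd (f x) < snd (f y)"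
    if "x \<in> S" "y \<in> S" "fst x < fst y" "snd x < snd y" for x y
  proof -
    have "w < fst y - fst x" "h < snd y - snd x"
      using gx gy that SR[of x] SR[of y] unfolding gapped_def by auto
    then show ?thesis using pos[OF that(1)] unfolding f_def by (auto intro: cell_index_strict wh)
  qed
  have inj: "inj_on f S"
  proof (rule inj_onI, rule ccontr)
    fix s s' assume s: "s \<in> S" "s' \<in> S" "f s = f s'" "s \<noteq> s'"
    show False using bspec[OF bspec[OF S(2)[unfolded incr_chain_def] s(1)] s(2)] s(3,4)
        lt[OF s(1,2)] lt[OF s(2,1)] by auto
  qed
  have nch: "grid_chain (f ` S)" unfolding grid_chain_def
  proof (intro ballI impI)
    fix x y assume "x \<in> f ` S" "y \<in> f ` S" and ne: "x \<noteq> y"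
    then obtain s s' where s: "s \<in> S" "s' \<in> S" "x = f s" "y = f s'" by blast
    show "fst x < fst y \<and> snd x < snd y \<or> fst y < fst x \<and> snd y < snd x"
      using bspec[OF bspec[OF S(2)[unfolded incr_chain_def] s(1)] s(2)] ne s(3,4)
        lt[OF s(1,2)] lt[OF s(2,1)] by auto
  qed
  have rng: "f x \<in> {i0..<M} \<times> {..<k} \<and> occupied ?c (fst (f x)) (snd (f x))" if x: "x \<in> S" for x
  proof -
    have M: "cell_index x0 w (fst x) < M" "cell_index 0 h (snd x) < k"
      using pos[OF x] by (auto intro!: cell_index_less wh)
    have "i0 \<le> cell_index x0 w (fst x)"
    proof (cases "?A = {}")
      case False
      have "Max ?A < fst x" using Max[OF False] Sz[OF x] by auto
      then have "w < fst x - Max ?A"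
        using gx Max[OF False] SR[OF x] z unfolding gapped_def by auto
      then show ?thesis using cell_index_strict[OF wh(1), of x0 "Max ?A" "fst x"] Max[OF False]
          False
        unfolding i0_def by auto
    qed (simp add: i0_def)
    moreover have "x \<in> Q \<inter> cell_interval x0 w (cell_index x0 w (fst x)) \<times> cell_interval 0 h
        (cell_index 0 h (snd x))"
      using SR[OF x] mem_cell_interval_cell_index[OF wh(1) pos(1)[OF x]]
          mem_cell_interval_cell_index[OF wh(2) pos(2)[OF x]]
      by (auto simp: mem_Times_iff)
    ultimately show ?thesis using M occupied_grid_config[OF M, of x0 w h Q N] by (auto simp: f_def)
  qed
  have "source_sum ?c i0 + card (f ` S) \<le> grid_lpp (source_sum ?c) (\<lambda>_. 0) (occupied ?c) M k"
    by (rule grid_lpp_upper[OF mono_source_sum source_sum_0 i0M nch]) (use rng in blast)+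
  ultimately show ?thesis using card_image[OF inj] S(4) by simp
qed


section \<open>The profile along the axis and its comparison with the grid\<close>

lemma nu_count_diff:
  assumes "locally_finite N" "z \<le> z'"
  shows "nu_count N z' - nu_count N z = real (card (N \<inter> {z<..z'}))"
proof -
  have fin: "finite (N \<inter> {a<..b})" for a b using assms(1) by (auto simp: locally_finite_def)
  have add: "card (N \<inter> {a<..c}) = card (N \<inter> {a<..b}) + card (N \<inter> {b<..c})" if "a \<le> b" "b \<le> c"
      for a b c
  proof -
    have "N \<inter> {a<..c} = (N \<inter> {a<..b}) \<union> (N \<inter> {b<..c})" using that by auto
    then show ?thesis using fin by (simp add: card_Un_disjoint disjoint_iff)
  qed
  consider "0 \<le> z" | "z < 0" "0 \<le> z'" | "z' < 0" using assms(2) by linarith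
  then show ?thesis
  proof cases
    case 1 then show ?thesis using assms(2) add[of 0 z z'] by (simp add: nu_count_def)
  next
    case 2 then show ?thesis using add[of z 0 z'] by (simp add: nu_count_def)
  next
    case 3 then show ?thesis using assms(2) add[of z z' 0] by (simp add: nu_count_def)
  qed
qed

text \<open>\<open>L1\<close> is its supremum over \<open>{..x}\<close>, and \<open>Z1\<close> is
  the supremum of the points where it equals \<open>L1\<close>.\<close>

definition profile :: "(real \<times> real) set \<Rightarrow> real set \<Rightarrow> real \<times> real \<Rightarrow> real \<Rightarrow> real" where
  "profile Q N p z = nu_count N z + real (LPP Q (z, 0) p)"

text \<open>Sources and first coordinates of points are gapped jointly, because a path passes from
  the axis to the points.\<close>

definition good_grid :: "real \<Rightarrow> real \<Rightarrow> real \<Rightarrow> nat \<Rightarrow> nat \<Rightarrow> (real \<times> real) set \<Rightarrow> real set \<Rightarrow> bool" where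
  "good_grid x0 w h M k Q N \<longleftrightarrow>
     gapped w (N \<inter> {x0<..x0 + real M * w} \<union> fst `
         (Q \<inter> rect (x0, 0) (x0 + real M * w, real k * h))) \<and>
     gapped h (snd ` (Q \<inter> rect (x0, 0) (x0 + real M * w, real k * h)))"

lemma good_grid_drop:
  assumes "good_grid x0 w h (m + n) k Q N" "0 < w"
  shows "good_grid (x0 + real m * w) w h n k Q N"
proof -
  have eq: "x0 + real m * w + real n * w = x0 + real (m + n) * w" by (simp add: algebra_simps)
  have "0 \<le> real m * w" using assms(2) by simp
  then have "rect (x0 + real m * w, 0) (x0 + real (m + n) * w, real k * h)
      \<subseteq> rect (x0, 0) (x0 + real (m + n) * w, real k * h)"
    "{x0 + real m * w<..x0 + real (m + n) * w} \<subseteq> {x0<..x0 + real (m + n) * w}"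
    by (auto simp: rect_eq)
  then show ?thesis using assms(1) unfolding good_grid_def eq by (blast intro: gapped_subset)
qed

text \<open>An optimal grid path through the sinks gives a continuum competitor leaving the axis at
  some \<open>z' \<le> u\<close>. This competitor does not beat the maximizer \<open>z > u\<close>,
  whose path the grid sources to the right of \<open>u\<close> reproduce.\<close>

lemma sink_lpp_le_source_lpp:
  assumes lf: "locally_finite Q" "locally_finite N" and wh: "0 < w" "0 < h"
    and good: "good_grid x0 w h (m + n) k Q N"
    and u: "u = x0 + real m * w" and T: "T = x0 + real (m + n) * w"
    and z: "u < z" "z \<le> T" "\<And>z'. z' \<le> T \<Longrightarrow> profile Q N (T, real k * h) z'
        \<le> profile Q N (T, real k * h) z"
  defines "c \<equiv> grid_config x0 w h (m + n) k Q N"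
  shows "sink_lpp (run_columns (no_sinks k) (take m c)) (drop m c) \<le> source_lpp k (drop m c)"
proof -
  let ?d = "drop m c" and ?J = "run_columns (no_sinks k) (take m c)"
  \<comment> \<open>Freezing the source count at column \<open>m\<close> removes the sources beyond
    \<open>u\<close>. Heights with boundary \<open>X\<close> are then \<open>sink_lpp\<close> up to
    the constant \<open>source_sum c m\<close>.\<close>
  define X where "X i = source_sum c (min i m)" for i
  have c: "c \<in> configs (m + n) k" unfolding c_def by (rule grid_config_in_configs)
  have lc: "length c = m + n" by (simp add: c_def)
  have lJ: "length ?J = k" using length_run_columns[OF configs_take[OF c, of m], of "no_sinks k"]
      by simp
  have T': "T = u + real n * w" by (simp add: T u algebra_simps)
  have "grid_lpp X (\<lambda>_. 0) (occupied c) (m + n) k = source_sum c m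
      + grid_lpp (\<lambda>_. 0) (sink_sum ?J) (\<lambda>i. occupied c (m + i)) n k"
  proof (rule grid_lpp_shift[of _ _ _ _ k])
    fix j assume j: "j \<le> k"
    have "grid_lpp X (\<lambda>_. 0) (occupied c) m j
        = grid_lpp (source_sum c) (sink_sum (no_sinks k)) (occupied c) m j"
      by (rule grid_lpp_cong) (auto simp: X_def)
    also have "\<dots> = source_sum c m + sink_sum ?J j"
        by (rule grid_lpp_run_columns[OF c]) (use j in auto)
    finally show "grid_lpp X (\<lambda>_. 0) (occupied c) m j = source_sum c m + sink_sum ?J j" .
  qed (simp_all add: X_def)
  also have "(\<lambda>i. occupied c (m + i)) = occupied ?d" by (auto simp: fun_eq_iff occupied_def lc)
  finally have GX: "grid_lpp X (\<lambda>_. 0) (occupied c) (m + n) k = source_sum c m + sink_lpp ?J ?d"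
    by (simp add: sink_lpp_def lJ lc)
  obtain i0 S where S: "i0 \<le> m + n" "grid_chain S" "S
      \<subseteq> {i0..<m + n} \<times> {..<k}" "\<forall>s\<in>S. occupied c (fst s) (snd s)"
    "grid_lpp X (\<lambda>_. 0) (occupied c) (m + n) k = X i0 + card S"
    using grid_lpp_lower[of X "m + n" k "occupied c"] by (auto simp: X_def)
  \<comment> \<open>\<open>X\<close> is constant beyond \<open>m\<close>, so an exit further right
    earns no more than an exit at \<open>u\<close> with the same chain.\<close>
  define i1 where "i1 = min i0 m"
  define z' where "z' = x0 + real i1 * w"
  have i1: "i1 \<le> m" "i1 \<le> i0" "X i0 = source_sum c i1" by (auto simp: i1_def X_def)
  have z'u: "z' \<le> u" unfolding z'_def u using i1 wh by (simp add: mult_right_mono)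
  have "card S \<le> LPP Q (z', 0) (T, real k * h)"
    unfolding z'_def T by (rule cells_le_LPP[OF lf(1) wh S(2)]) (use S(3,4) i1
        in \<open>auto simp: c_def\<close>)
  moreover have "source_sum c i1 + card (N \<inter> {z'<..u}) \<le> source_sum c m"
  proof -
    have "x0 + real m * w \<le> x0 + real (m + n) * w" using wh by (simp add: mult_right_mono)
    then have "{x0<..x0 + real m * w} \<subseteq> {x0<..x0 + real (m + n) * w}" by auto
    then have "gapped w (N \<inter> {x0<..x0 + real m * w})"
      using good unfolding good_grid_def by (blast intro: gapped_subset)
    from source_sum_gap[OF this wh(1) i1(1), of h k Q] have "source_sum (take m c) i1
        + card (N \<inter> {z'<..u}) \<le> source_sum (take m c) m"
      unfolding c_def take_grid_config z'_def u .
    then show ?thesis using i1 by (simp add: source_sum_def min_def)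
  qed
  ultimately have "real (sink_lpp ?J ?d) \<le> real (LPP Q (z', 0) (T, real k * h))
      - real (card (N \<inter> {z'<..u}))"
    using GX S(5) i1(3) by linarith
  also have "\<dots> = profile Q N (T, real k * h) z' - nu_count N u"
    using nu_count_diff[OF lf(2) z'u] by (simp add: profile_def)
  also have "\<dots> \<le> profile Q N (T, real k * h) z - nu_count N u" using z z'u by simp
  also have "\<dots> = real (card (N \<inter> {u<..z}) + LPP Q (z, 0) (T, real k * h))"
    using nu_count_diff[OF lf(2), of u z] z by (simp add: profile_def)
  also have "card (N \<inter> {u<..z}) + LPP Q (z, 0) (T, real k * h) \<le> source_lpp k ?d"
    using source_LPP_le_grid_lpp[OF lf wh, of u n k z] good_grid_drop[OF good wh(1)] z
    unfolding good_grid_def source_lpp_def c_def drop_grid_config T' u by simp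
  finally show ?thesis by simp
qed

text \<open>The grid height loses nothing of the path, and its source part is at most the true
  number of sources. What remains is the number of sinks leaving the right edge, which
  \<open>overflow_bound\<close> controls.\<close>

lemma profile_le_count_true:
  assumes lf: "locally_finite Q" "locally_finite N" and wh: "0 < w" "0 < h"
    and good: "good_grid x0 w h M k Q N" and T: "T = x0 + real M * w" and z: "x0 \<le> z" "z \<le> T"
  shows "profile Q N (T, real k * h) z - nu_count N T
      \<le> real (count_true (run_columns (no_sinks k) (grid_config x0 w h M k Q N)))"
proof -
  let ?c = "grid_config x0 w h M k Q N"
  have x0T: "x0 \<le> T" using z by simp
  have "card (N \<inter> {x0<..z}) + LPP Q (z, 0) (T, real k * h)
      \<le> grid_lpp (source_sum ?c) (sink_sum (no_sinks k)) (occupied ?c) M k"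
    using source_LPP_le_grid_lpp[OF lf wh, of x0 M k z] good z unfolding good_grid_def T by simp
  also have "\<dots> = source_sum ?c M + count_true (run_columns (no_sinks k) ?c)"
    using grid_lpp_total[OF grid_config_in_configs, of "no_sinks k" k x0 w h M Q N]
        by (simp add: source_sum_def)
  also have "source_sum ?c M \<le> card (N \<inter> {x0<..T})" unfolding T
      by (rule source_sum_le_card[OF lf(2) wh(1)])
  finally have "real (card (N \<inter> {x0<..z})) + real (LPP Q (z, 0) (T, real k * h))
     \<le> real (card (N \<inter> {x0<..T})) + real (count_true (run_columns (no_sinks k) ?c))" by linarith
  then show ?thesis
    using nu_count_diff[OF lf(2) z(1)] nu_count_diff[OF lf(2) x0T] by (simp add: profile_def)
qed

text \<open>Without sources the flux through the right edge is a pure chain height. Together with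
  \<open>profile_le_count_true\<close> this makes \<open>LPP\<close> a maximum of grid
  quantities.\<close>

lemma count_true_le_LPP:
  assumes lf: "locally_finite Q" and wh: "0 < w" "0 < h"
  shows "count_true (run_columns (no_sinks k) (grid_config x0 w h M k Q {}))
      \<le> LPP Q (x0, 0) (x0 + real M * w, real k * h)"
proof -
  let ?c = "grid_config x0 w h M k Q {}"
  have X: "source_sum ?c i = 0" if "i \<le> M" for i using that by (simp add: source_sum_grid_config)
  have "count_true (run_columns (no_sinks k) ?c)
      = grid_lpp (source_sum ?c) (\<lambda>_. 0) (occupied ?c) M k"
    using grid_lpp_total[OF grid_config_in_configs, of "no_sinks k" k x0 w h M Q "{}"] X[of M]
        by (simp add: source_sum_def)
  then obtain i0 S where S: "i0 \<le> M" "grid_chain S" "S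
      \<subseteq> {i0..<M} \<times> {..<k}" "\<forall>s\<in>S. occupied ?c (fst s) (snd s)"
    "count_true (run_columns (no_sinks k) ?c) = source_sum ?c i0 + card S"
    using grid_lpp_lower[of "source_sum ?c" M k "occupied ?c"] by auto
  have "card S \<le> LPP Q (x0 + real 0 * w, 0) (x0 + real M * w, real k * h)"
    by (rule cells_le_LPP[OF lf wh S(2) _ S(4)]) (use S(3) in auto)
  then show ?thesis using S X by simp
qed

text \<open>The region is fixed and contains finitely many points, while the mesh tends to 0. The
  region consists of \<open>l\<close> blocks of width \<open>a\<close> with \<open>n\<close> columns
  each.\<close>

lemma eventually_good_grid:
  assumes lf: "locally_finite Q" "locally_finite N" and pos: "0 < a" "0 < t"
  shows "\<forall>\<^sub>F n in sequentially. good_grid x0 (a / real n) (t / real n) (l * n) n Q N"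
proof -
  let ?R = "rect (x0, 0) (x0 + real l * a, t)"
  have fin: "finite (Q \<inter> ?R)" "finite (N \<inter> {x0<..x0 + real l * a})"
    using lf bounded_rect by (auto simp: locally_finite_def)
  obtain e where e: "0 < e" "\<And>d. d < e \<Longrightarrow> gapped d (N \<inter> {x0<..x0 + real l * a} \<union> fst ` (Q \<inter> ?R))"
    using finite_gapped[of "N \<inter> {x0<..x0 + real l * a} \<union> fst ` (Q \<inter> ?R)"] fin by blast
  obtain e' where e': "0 < e'" "\<And>d. d < e' \<Longrightarrow> gapped d (snd ` (Q \<inter> ?R))"
    using finite_gapped[of "snd ` (Q \<inter> ?R)"] fin by blast
  have "((\<lambda>n. a / real n) \<longlongrightarrow> 0) sequentially" "((\<lambda>n. t / real n) \<longlongrightarrow> 0) sequentially"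
    by (rule lim_const_over_n)+
  then have "\<forall>\<^sub>F n in sequentially. a / real n < e" "\<forall>\<^sub>F n in sequentially. t / real n < e'"
    using e(1) e'(1) by (auto intro: order_tendstoD(2))
  then show ?thesis using eventually_gt_at_top[of 0]
  proof eventually_elim
    case (elim n)
    then have eq: "real (l * n) * (a / real n) = real l * a" "real n * (t / real n) = t" by auto
    show ?case unfolding good_grid_def eq using e(2)[OF elim(1)] e'(2)[OF elim(2)] by simp
  qed
qed

section \<open>The law of the grid configuration\<close>

lemma iter_mean_sum:
  assumes S: "finite S" and E: "\<And>f. E f = (\<Sum>x\<in>S. q x * f x)"
  shows "iter_mean n E f = (\<Sum>xs | set xs \<subseteq> S \<and> length xs = n. prod_list (map q xs) * f xs)"
proof (induction n arbitrary: f)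
  case 0
  have "{xs. set xs \<subseteq> S \<and> length xs = 0} = {[]}" by auto
  then show ?case by simp
next
  case (Suc n)
  let ?L = "{xs. set xs \<subseteq> S \<and> length xs = n}"
  have im: "{xs. set xs \<subseteq> S \<and> length xs = Suc n} = (\<lambda>(x, xs). x # xs) ` (S \<times> ?L)"
    by (auto simp: length_Suc_conv image_iff)
  have inj: "inj_on (\<lambda>(x, xs). x # xs) (S \<times> ?L)" by (auto simp: inj_on_def)
  have "iter_mean (Suc n) E f = (\<Sum>x\<in>S. \<Sum>xs\<in>?L. q x * (prod_list (map q xs) * f (x # xs)))"
    by (simp add: E Suc sum_distrib_left)
  also have "\<dots> = (\<Sum>xs | set xs \<subseteq> S \<and> length xs = Suc n. prod_list (map q xs) * f xs)"
    unfolding im sum.reindex[OF inj] sum.cartesian_product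
        by (intro sum.cong) (auto simp: mult.assoc)
  finally show ?case .
qed

definition bern_weight :: "real \<Rightarrow> bool \<Rightarrow> real" where "bern_weight p x = (if x then p else 1 - p)"

definition configs_weight :: "real \<Rightarrow> real \<Rightarrow> nat \<Rightarrow> nat \<Rightarrow> (bool \<times> bool list) list \<Rightarrow> real" where
  "configs_weight a p M k cs = (\<Prod>i<M. bern_weight a (fst (cs ! i)) *
      (\<Prod>j<k. bern_weight p (snd (cs ! i) ! j)))"

lemma finite_configs: "finite (configs n k)"
proof -
  have "configs n k = {cs. set cs \<subseteq> UNIV \<times> {W. set W \<subseteq> UNIV \<and> length W = k} \<and> length cs = n}"
    by (auto simp: configs_def)
  then show ?thesis by (simp only: finite_lists_length_eq finite_cartesian_product finite)
qed

lemma cols_mean_sum: "iter_mean n (col_mean a p k) f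
    = (\<Sum>cs\<in>configs n k. configs_weight a p n k cs * f cs)"
proof -
  let ?W = "{W :: bool list. set W \<subseteq> UNIV \<and> length W = k}"
  let ?q = "\<lambda>(I, W). bern_weight a I * prod_list (map (bern_weight p) W)"
  have fW: "finite ?W" by (rule finite_lists_length_eq) simp
  have 1: "bern_mean p f = (\<Sum>x\<in>UNIV. bern_weight p x * f x)" for p f
    by (simp add: bern_mean_def bern_weight_def UNIV_bool)
  have 2: "col_mean a p k f = (\<Sum>x\<in>UNIV \<times> ?W. ?q x * f x)" for f
  proof -
    have "col_mean a p k f = (\<Sum>I\<in>UNIV. \<Sum>W\<in>?W. bern_weight a I *
        (prod_list (map (bern_weight p) W) * f (I, W)))"
      unfolding col_mean_def 1[of a] iter_mean_sum[OF finite 1] sum_distrib_left ..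
    also have "\<dots> = (\<Sum>x\<in>UNIV \<times> ?W. ?q x * f x)"
      unfolding sum.cartesian_product by (intro sum.cong) (auto simp: mult.assoc)
    finally show ?thesis .
  qed
  have "iter_mean n (col_mean a p k) f = (\<Sum>xs | set xs \<subseteq> UNIV \<times> ?W \<and> length xs
      = n. prod_list (map ?q xs) * f xs)"
    by (rule iter_mean_sum[OF _ 2]) (use fW in simp)
  also have "{xs :: (bool \<times> bool list) list. set xs \<subseteq> UNIV \<times> ?W \<and> length xs = n} = configs n k"
    by (auto simp: configs_def)
  also have "(\<Sum>xs\<in>configs n k. prod_list (map ?q xs) * f xs)
      = (\<Sum>cs\<in>configs n k. configs_weight a p n k cs * f cs)"
  proof (rule sum.cong[OF refl])
    fix cs assume cs: "cs \<in> configs n k"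
    have "prod_list (map ?q cs) = (\<Prod>i<n. ?q (cs ! i))"
      using cs by (simp add: prod.list_conv_set_nth configs_def atLeast0LessThan)
    also have "\<dots> = configs_weight a p n k cs"
      unfolding configs_weight_def
      by (intro prod.cong refl) (auto simp: case_prod_beta prod.list_conv_set_nth
          configs_nth[OF cs] atLeast0LessThan)
    finally show "prod_list (map ?q cs) * f cs = configs_weight a p n k cs * f cs" by simp
  qed
  finally show ?thesis .
qed

lemma measure_lborel_Times:
  fixes a b c d :: real
  assumes "a \<le> b" "c \<le> d"
  shows "measure lborel ({a<..b} \<times> {c<..d}) = (b - a) * (d - c)"
proof -
  have "emeasure (lborel \<Otimes>\<^sub>M lborel) ({a<..b} \<times> {c<..d}) = ennreal ((b - a) * (d - c))"
    using assms by (subst lborel.emeasure_pair_measure_Times) (auto simp: ennreal_mult)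
  then show ?thesis using assms by (simp add: lborel_prod measure_def)
qed

lemma poisson_locally_finite:
  assumes "indep_poisson_pair M P N" "\<omega> \<in> space M"
  shows "locally_finite (P \<omega>)" "locally_finite (N \<omega>)"
proof -
  note * = bspec[OF conjunct1[OF conjunct2[OF assms(1)[unfolded indep_poisson_pair_def]]] assms(2)]
  show "locally_finite (P \<omega>)" "locally_finite (N \<omega>)"
    unfolding locally_finite_def
    by (rule conjunct1[OF conjunct2[OF *]], rule conjunct2[OF conjunct2[OF *]])
qed

lemma poisson_prob_space: "indep_poisson_pair M P N \<Longrightarrow> prob_space M"
  by (simp add: indep_poisson_pair_def)

lemma poisson_indep:
  fixes I J :: "nat set"
  assumes "indep_poisson_pair M P N"
    "finite I" "finite J" "\<And>i. i \<in> I \<Longrightarrow> bset2 (Bs i)" "\<And>j. j \<in> J \<Longrightarrow> bset1 (Cs j)"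
    "disjoint_family_on Bs I" "disjoint_family_on Cs J"
  shows "prob_space.indep_vars M (\<lambda>_. count_space (UNIV :: nat set))
     (\<lambda>ij \<omega>. case ij of Inl i \<Rightarrow> card (P \<omega> \<inter> Bs i) | Inr j \<Rightarrow> card (N \<omega> \<inter> Cs j)) (I <+> J)"
  by (rule conjunct2[OF conjunct2[OF conjunct2[OF
      conjunct2[OF assms(1)[unfolded indep_poisson_pair_def]]]],
      THEN spec, THEN spec, THEN spec, THEN spec, THEN mp]) (intro conjI ballI assms; assumption)

lemma poisson_void:
  assumes PP: "indep_poisson_pair M P N"
  shows "bset2 B \<Longrightarrow> measure M {\<omega> \<in> space M. card (P \<omega> \<inter> B) = 0} = exp (- measure lborel B)"
    "bset1 C \<Longrightarrow> measure M {\<omega> \<in> space M. card (N \<omega> \<inter> C) = 0} = exp (- measure lborel C)"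
proof -
  note * = conjunct2[OF conjunct2[OF PP[unfolded indep_poisson_pair_def]]]
  show "bset2 B \<Longrightarrow> measure M {\<omega> \<in> space M. card (P \<omega> \<inter> B) = 0} = exp (- measure lborel B)"
    using conjunct1[OF *, rule_format, of B 0] by simp
  show "bset1 C \<Longrightarrow> measure M {\<omega> \<in> space M. card (N \<omega> \<inter> C) = 0} = exp (- measure lborel C)"
    using conjunct1[OF conjunct2[OF *], rule_format, of C 0] by simp
qed

text \<open>Measurability of counts is supplied by \<open>indep_vars\<close> in the definition, and
  is extracted from a family with a single member.\<close>

lemma card_N_measurable:
  assumes PP: "indep_poisson_pair M P N" and C: "bset1 C"
  shows "(\<lambda>\<omega>. card (N \<omega> \<inter> C)) \<in> measurable M (count_space UNIV)"
proof -
  interpret prob_space M by (rule poisson_prob_space[OF PP])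
  define X where "X = (\<lambda>(ij :: nat + nat) \<omega>. case ij of Inl i \<Rightarrow> card (P \<omega> \<inter> {}) | Inr j \<Rightarrow> card
      (N \<omega> \<inter> C))"
  have iv: "indep_vars (\<lambda>_. count_space UNIV) X (({} :: nat set) <+> {0 :: nat})"
    unfolding X_def
    by (rule poisson_indep[OF PP, where Bs = "\<lambda>_. {}" and Cs = "\<lambda>_. C"]) (use C
        in \<open>auto simp: disjoint_family_on_def\<close>)
  have "X ij \<in> measurable M (count_space UNIV)" if "ij \<in> ({} :: nat set) <+> {0 :: nat}" for ij
    using iv that unfolding indep_vars_def by auto
  moreover have "(Inr 0 :: nat + nat) \<in> {} <+> {0}" by blast
  ultimately show ?thesis by (fastforce simp: X_def)
qed

lemma cell_interval_disjoint_family: "0 < w \<Longrightarrow> disjoint_family_on (cell_interval x0 w) I"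
  unfolding disjoint_family_on_def
proof (intro ballI impI equals0I)
  fix i j :: nat and y assume "0 < w" "i \<noteq> j"
      and y: "y \<in> cell_interval x0 w i \<inter> cell_interval x0 w j"
  then consider "i < j" | "j < i" by linarith
  then show False
    using cell_interval_disjoint[OF \<open>0 < w\<close> _ IntD1[OF y] IntD2[OF y]]
        cell_interval_disjoint[OF \<open>0 < w\<close> _ IntD2[OF y] IntD1[OF y]]
    by cases simp_all
qed

text \<open>Counts in disjoint cells are independent, and a Poisson count with mean \<open>w\<close>
  or \<open>w * h\<close> is nonzero with probability \<open>1 - exp (- w)\<close> or
  \<open>1 - exp (- (w * h))\<close>.\<close>

lemma grid_point_prob:
  assumes PP: "indep_poisson_pair M P N" and wh: "0 < w" "0 < h" and m: "0 < m"
      and c: "c \<in> configs m k"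
  shows "{\<omega> \<in> space M. grid_config x0 w h m k (P \<omega>) (N \<omega>) = c} \<in> sets M" (is "?E \<in> _")
    and "measure M {\<omega> \<in> space M. grid_config x0 w h m k (P \<omega>) (N \<omega>) = c} =
      configs_weight (1 - exp (- w)) (1 - exp (- (w * h))) m k c"
proof -
  interpret prob_space M by (rule poisson_prob_space[OF PP])
  \<comment> \<open>Cells are numbered by naturals because independence is stated for families
    indexed by \<open>nat\<close>.\<close>
  define I where "I = prod_encode ` ({..<m} \<times> {..<k})"
  define Bs where "Bs l = cell_interval x0 w (fst (prod_decode l)) \<times> cell_interval 0 h
      (snd (prod_decode l))" for l
  define Cs where "Cs = cell_interval x0 w"
  define X where "X = (\<lambda>ij \<omega>. case ij of Inl i \<Rightarrow> card (P \<omega> \<inter> Bs i) | Inr j \<Rightarrow> card (N \<omega> \<inter> Cs j))"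
  define bit where "bit ij = (case ij of Inl l \<Rightarrow> snd (c ! fst (prod_decode l)) ! snd (prod_decode l)
     | Inr i \<Rightarrow> fst (c ! i))" for ij
  define A where "A ij = (if bit ij then - {0} else {0 :: nat})" for ij
  have b2: "bset2 (Bs l)" for l
  proof -
    have "0 \<le> real (snd (prod_decode l)) * h" using wh by simp
    then show ?thesis unfolding bset2_def Bs_def cell_interval_def
      by (auto intro!: bounded_Times borel_Times simp: mem_Times_iff)
  qed
  have b1: "bset1 (Cs i)" for i by (auto simp: bset1_def Cs_def cell_interval_def)
  have vol2: "measure lborel (Bs l) = w * h" for l
    unfolding Bs_def cell_interval_def using wh
        by (subst measure_lborel_Times) (auto simp: algebra_simps)
  have vol1: "measure lborel (Cs i) = w" for i
    unfolding Cs_def cell_interval_def using wh by (simp add: algebra_simps)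
  have disj2: "disjoint_family_on Bs I"
    unfolding disjoint_family_on_def
  proof (intro ballI impI)
    fix l l' :: nat assume "l \<noteq> l'"
    then have "prod_decode l \<noteq> prod_decode l'" by (metis prod_decode_inverse)
    then have "fst (prod_decode l) \<noteq> fst (prod_decode l')
        \<or> snd (prod_decode l) \<noteq> snd (prod_decode l')"
      by (simp add: prod_eq_iff)
    then show "Bs l \<inter> Bs l' = {}" unfolding Bs_def
      using cell_interval_disjoint_family[OF wh(1), of x0 UNIV]
          cell_interval_disjoint_family[OF wh(2), of 0 UNIV]
      unfolding disjoint_family_on_def by blast
  qed
  have iv: "indep_vars (\<lambda>_. count_space UNIV) X (I <+> {..<m})"
    unfolding X_def by (rule poisson_indep[OF PP])
      (use b1 b2 disj2 in \<open>auto simp: I_def Cs_def cell_interval_disjoint_family[OF wh(1)]\<close>)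
  have rv: "X ij \<in> measurable M (count_space UNIV)" if "ij \<in> I <+> {..<m}" for ij
    using iv that unfolding indep_vars_def by auto
  have E: "?E = (\<Inter>ij\<in>I <+> {..<m}. X ij -` A ij \<inter> space M)" (is "_ = ?F")
  proof -
    have "grid_config x0 w h m k (P \<omega>) (N \<omega>) = c \<longleftrightarrow> (\<forall>ij\<in>I <+> {..<m}. X ij \<omega> \<in> A ij)"
        if \<omega>: "\<omega> \<in> space M" for \<omega>
    proof -
      \<comment> \<open>Emptiness can be read off a count only for finite sets, since
        \<open>card\<close> of an infinite set is 0.\<close>
      have fin: "finite (P \<omega> \<inter> Bs l)" "finite (N \<omega> \<inter> Cs i)" for l i
        using poisson_locally_finite[OF PP \<omega>] b1[of i] b2[of l]
        by (auto simp: locally_finite_def bset1_def bset2_def)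
      have "grid_config x0 w h m k (P \<omega>) (N \<omega>) = c \<longleftrightarrow>
        (\<forall>i<m. (N \<omega> \<inter> cell_interval x0 w i \<noteq> {}) = fst (c ! i) \<and>
          (\<forall>j<k. (P \<omega> \<inter> cell_interval x0 w i \<times> cell_interval 0 h j \<noteq> {}) = snd (c ! i) ! j))"
        using c by (auto simp: list_eq_iff_nth_eq grid_config_def configs_def prod_eq_iff)
      also have "\<dots> \<longleftrightarrow> (\<forall>i<m. X (Inr i) \<omega> \<in> A (Inr i)) \<and>
          (\<forall>i<m. \<forall>j<k. X (Inl (prod_encode (i, j))) \<omega> \<in> A (Inl (prod_encode (i, j))))"
      proof -
        have e1: "X (Inr i) \<omega> \<in> A (Inr i) \<longleftrightarrow> (N \<omega> \<inter> cell_interval x0 w i \<noteq> {}) = fst (c ! i)" for i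
          using fin(2)[of i] by (simp add: X_def A_def bit_def Cs_def)
        have e2: "X (Inl (prod_encode (i, j))) \<omega> \<in> A (Inl (prod_encode (i, j))) \<longleftrightarrow>
            (P \<omega> \<inter> cell_interval x0 w i \<times> cell_interval 0 h j \<noteq> {}) = snd (c ! i) ! j" for i j
          using fin(1)[of "prod_encode (i, j)"] by (simp add: X_def A_def bit_def Bs_def)
        show ?thesis unfolding e1 e2 by blast
      qed
      also have "\<dots> \<longleftrightarrow> (\<forall>ij\<in>I <+> {..<m}. X ij \<omega> \<in> A ij)" by (auto simp: I_def)
      finally show ?thesis .
    qed
    then show ?thesis using m by auto
  qed
  have fI: "finite (I <+> {..<m})" by (simp add: I_def)
  have ne: "I <+> {..<m} \<noteq> {}" using m by auto
  show "?E \<in> sets M" unfolding E using rv fI ne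
      by (intro sets.finite_INT) (auto intro: measurable_sets)
  have comp: "prob {\<omega> \<in> space M. card (Y \<omega>) \<noteq> 0} = 1 - prob {\<omega> \<in> space M. card (Y \<omega>) = 0}"
    if "(\<lambda>\<omega>. card (Y \<omega>)) \<in> measurable M (count_space UNIV)" for Y :: "_ \<Rightarrow> 'z set"
  proof -
    have "{\<omega> \<in> space M. card (Y \<omega>) = 0} \<in> sets M"
      using measurable_sets[OF that, of "{0}"] by (simp add: vimage_def Int_def conj_commute)
    from prob_compl[OF this] show ?thesis
      by (simp add: set_diff_eq) (metis (no_types, lifting) Collect_cong)
  qed
  have pr: "prob (X ij -` A ij \<inter> space M) = bern_weight
      (case ij of Inl _ \<Rightarrow> 1 - exp (- (w * h)) | Inr _ \<Rightarrow> 1 - exp (- w)) (bit ij)"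
    if ij: "ij \<in> I <+> {..<m}" for ij
  proof (cases ij)
    case (Inl l)
    have s: "X ij -` S \<inter> space M = {\<omega> \<in> space M. card (P \<omega> \<inter> Bs l) \<in> S}" for S
      by (auto simp: X_def Inl)
    have "(\<lambda>\<omega>. card (P \<omega> \<inter> Bs l)) \<in> measurable M (count_space UNIV)"
      using rv[OF ij] by (simp add: X_def Inl)
    from comp[OF this] show ?thesis
      using poisson_void(1)[OF PP b2[of l]] unfolding A_def s
          by (simp add: Inl bern_weight_def vol2)
  next
    case (Inr l)
    have s: "X ij -` S \<inter> space M = {\<omega> \<in> space M. card (N \<omega> \<inter> Cs l) \<in> S}" for S
      by (auto simp: X_def Inr)
    have "(\<lambda>\<omega>. card (N \<omega> \<inter> Cs l)) \<in> measurable M (count_space UNIV)"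
      using rv[OF ij] by (simp add: X_def Inr)
    from comp[OF this] show ?thesis
      using poisson_void(2)[OF PP b1[of l]] unfolding A_def s
          by (simp add: Inr bern_weight_def vol1)
  qed
  have "prob ?E = (\<Prod>ij\<in>I <+> {..<m}. prob (X ij -` A ij \<inter> space M))"
    unfolding E by (rule indep_varsD[OF iv ne fI order.refl]) simp
  also have "\<dots> = (\<Prod>ij\<in>I <+> {..<m}. bern_weight
      (case ij of Inl _ \<Rightarrow> 1 - exp (- (w * h)) | Inr _ \<Rightarrow> 1 - exp (- w)) (bit ij))"
    by (rule prod.cong[OF refl pr])
  also have "\<dots> = (\<Prod>l\<in>I. bern_weight (1 - exp (- (w * h))) (bit (Inl l))) *
      (\<Prod>i<m. bern_weight (1 - exp (- w)) (bit (Inr i)))"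
    by (subst prod.Plus) (simp_all add: I_def comp_def)
  also have "(\<Prod>l\<in>I. bern_weight (1 - exp (- (w * h))) (bit (Inl l))) =
      (\<Prod>(i, j)\<in>{..<m} \<times> {..<k}. bern_weight (1 - exp (- (w * h))) (snd (c ! i) ! j))"
    unfolding I_def by (subst prod.reindex) (auto simp: inj_on_def bit_def case_prod_beta)
  also have "\<dots> = (\<Prod>i<m. \<Prod>j<k. bern_weight (1 - exp (- (w * h))) (snd (c ! i) ! j))"
    by (rule prod.cartesian_product[symmetric])
  finally show "prob ?E = configs_weight (1 - exp (- w)) (1 - exp (- (w * h))) m k c"
    by (simp add: configs_weight_def bit_def prod.distrib mult.commute)
qed

lemma grid_prob:
  assumes PP: "indep_poisson_pair M P N" and wh: "0 < w" "0 < h"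
  shows "{\<omega> \<in> space M. R (grid_config x0 w h m k (P \<omega>) (N \<omega>))} \<in> sets M" (is "?E \<in> _")
    and "measure M {\<omega> \<in> space M. R (grid_config x0 w h m k (P \<omega>) (N \<omega>))} =
      iter_mean m (col_mean (1 - exp (- w)) (1 - exp (- (w * h))) k) (\<lambda>cs. of_bool (R cs))"
proof -
  interpret prob_space M by (rule poisson_prob_space[OF PP])
  have "?E \<in> sets M \<and> prob ?E = iter_mean m (col_mean (1 - exp (- w)) (1 - exp (- (w * h))) k)
      (\<lambda>cs. of_bool (R cs))"
  proof (cases "m = 0")
    case True
    then have "?E = (if R [] then space M else {})" by (auto simp: grid_config_def)
    then show ?thesis using True by (simp add: prob_space)
  next
    case False
    let ?F = "\<lambda>c. {\<omega> \<in> space M. grid_config x0 w h m k (P \<omega>) (N \<omega>) = c}"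
    let ?C = "{c \<in> configs m k. R c}"
    have m: "0 < m" using False by simp
    have eq: "?E = (\<Union>c\<in>?C. ?F c)" using grid_config_in_configs by fastforce
    have F: "?F c \<in> sets M" if "c \<in> ?C" for c using grid_point_prob(1)[OF PP wh m] that by auto
    have fin: "finite ?C" using finite_configs by simp
    have "prob ?E = (\<Sum>c\<in>?C. prob (?F c))"
      unfolding eq by (rule finite_measure_finite_Union) (use F fin
          in \<open>auto simp: disjoint_family_on_def\<close>)
    also have "\<dots> = (\<Sum>c\<in>?C. configs_weight (1 - exp (- w)) (1 - exp (- (w * h))) m k c)"
      by (intro sum.cong refl) (simp add: grid_point_prob(2)[OF PP wh m])
    also have "\<dots> = iter_mean m (col_mean (1 - exp (- w)) (1 - exp (- (w * h))) k)
        (\<lambda>cs. of_bool (R cs))"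
      unfolding cols_mean_sum by (simp add: sum.inter_filter[OF finite_configs] of_bool_def
          if_distrib cong: if_cong)
    finally show ?thesis unfolding eq using F fin by (auto intro: sets.finite_UN)
  qed
  then show "?E \<in> sets M" "prob ?E = iter_mean m
      (col_mean (1 - exp (- w)) (1 - exp (- (w * h))) k) (\<lambda>cs. of_bool (R cs))"
    by blast+
qed

text \<open>Fatou's lemma for events. An outcome belongs to the grid events for all fine meshes, so
  grid bounds pass to the limit without convergence of the events.\<close>

lemma liminf_measure:
  assumes "prob_space M" and A: "\<And>n. A n \<in> sets M"
    and B: "\<forall>\<^sub>F n in sequentially. measure M (A n) \<le> B n" "B \<longlonglongrightarrow> c"
  shows "{\<omega> \<in> space M. \<forall>\<^sub>F n in sequentially. \<omega> \<in> A n} \<in> sets M" (is "?E \<in> _")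
    and "measure M {\<omega> \<in> space M. \<forall>\<^sub>F n in sequentially. \<omega> \<in> A n} \<le> c"
proof -
  interpret prob_space M by fact
  let ?I = "\<lambda>n0. \<Inter>n\<in>{n0..}. A n"
  have AE: "A n \<subseteq> space M" for n using sets.sets_into_space[OF A] .
  have eq: "?E = (\<Union>n0. ?I n0)" using AE by (fastforce simp: eventually_sequentially)
  have I: "?I n0 \<in> sets M" for n0 using A by (intro sets.countable_INT') auto
  show "?E \<in> sets M" unfolding eq using I by auto
  have inc: "incseq ?I" by (auto simp: incseq_def)
  have lim: "(\<lambda>n0. prob (?I n0)) \<longlonglongrightarrow> prob ?E"
    unfolding eq by (rule finite_Lim_measure_incseq[OF _ inc]) (use I in auto)
  show "prob ?E \<le> c"
  proof (rule field_le_epsilon)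
    fix e :: real assume "0 < e"
    then have "\<forall>\<^sub>F n in sequentially. B n < c + e" using B(2) by (auto intro: order_tendstoD(2))
    with B(1) have ev: "\<forall>\<^sub>F n in sequentially. prob (A n) \<le> c + e" by eventually_elim simp
    have "prob (?I n0) \<le> c + e" for n0
    proof -
      obtain n where n: "n0 \<le> n" "prob (A n) \<le> c + e"
        using eventually_conj[OF ev eventually_ge_at_top[of n0]]
            eventually_happens'[OF sequentially_bot] by blast
      have "prob (?I n0) \<le> prob (A n)" using n(1) A by (intro finite_measure_mono) auto
      then show ?thesis using n(2) by simp
    qed
    then show "prob ?E \<le> c + e" by (intro LIMSEQ_le_const2[OF lim]) auto
  qed
qed

section \<open>Measurability of the exit point\<close>

lemma LPP_measurable:
  assumes PP: "indep_poisson_pair M P N" and t: "0 < t"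
  shows "(\<lambda>\<omega>. LPP (P \<omega>) (z, 0) (T, t)) \<in> measurable M (count_space UNIV)"
proof (cases "z < T")
  case False
  have "rect (z, 0) (T, t) = {}" using False by (auto simp: rect_def)
  then have "LPP (P \<omega>) (z, 0) (T, t) = LPP {} (z, 0) (T, t)" for \<omega> by (simp add: LPP_rect)
  then show ?thesis by simp
next
  case True
  have nu_empty: "nu_count {} y = 0" for y by (simp add: nu_count_def)
  define c where "c n \<omega> = count_true (run_columns (no_sinks n)
      (grid_config z ((T - z) / real n) (t / real n) n n (P \<omega>) {}))" for n \<omega>
  have ge: "{\<omega> \<in> space M. l \<le> LPP (P \<omega>) (z, 0) (T, t)} \<in> sets M" for l
  proof -
    \<comment> \<open>Grid heights never exceed \<open>LPP\<close> and reach it on fine grids, which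
      turns the event into a countable union of grid events.\<close>
    have "l \<le> LPP (P \<omega>) (z, 0) (T, t) \<longleftrightarrow> (\<exists>n\<in>{1..}. l \<le> c n \<omega>)" if \<omega>: "\<omega> \<in> space M" for \<omega>
    proof
      have lf: "locally_finite (P \<omega>)" "locally_finite ({} :: real set)"
        using poisson_locally_finite[OF PP \<omega>] by (auto simp: locally_finite_def)
      have "\<forall>\<^sub>F n in sequentially. good_grid z ((T - z) / real n) (t / real n) (1 * n) n (P \<omega>) {}"
        by (rule eventually_good_grid[OF lf]) (use True t in auto)
      then obtain n where n: "1 \<le> n" "good_grid z ((T - z) / real n) (t / real n) n n (P \<omega>) {}"
        using eventually_conj[OF _ eventually_ge_at_top[of 1]]
            eventually_happens'[OF sequentially_bot]
        by (metis (no_types, lifting) mult_1)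
      have eq: "z + real n * ((T - z) / real n) = T" "real n * (t / real n) = t" using n(1) by auto
      assume l: "l \<le> LPP (P \<omega>) (z, 0) (T, t)"
      have "profile (P \<omega>) {} (T, real n * (t / real n)) z - nu_count {} T \<le> real (c n \<omega>)"
        unfolding c_def by (rule profile_le_count_true[OF lf _ _ n(2)]) (use n(1) True t
            in \<open>auto simp: eq\<close>)
      then have "LPP (P \<omega>) (z, 0) (T, t) \<le> c n \<omega>"
        unfolding eq by (simp add: profile_def nu_empty)
      then show "\<exists>n\<in>{1..}. l \<le> c n \<omega>" using l n(1) by (meson atLeast_iff le_trans)
    next
      assume "\<exists>n\<in>{1..}. l \<le> c n \<omega>"
      then obtain n where n: "1 \<le> n" "l \<le> c n \<omega>" by auto
      have "c n \<omega> \<le> LPP (P \<omega>) (z, 0) (z + real n * ((T - z) / real n), real n * (t / real n))"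
        unfolding c_def by (rule count_true_le_LPP) (use poisson_locally_finite[OF PP \<omega>] n True t
            in auto)
      then show "l \<le> LPP (P \<omega>) (z, 0) (T, t)" using n by simp
    qed
    then have "{\<omega> \<in> space M. l \<le> LPP (P \<omega>) (z, 0) (T, t)} = (\<Union>n\<in>{1..}. {\<omega> \<in> space M. l \<le> c n \<omega>})"
        by auto
    also have "\<dots> \<in> sets M"
    proof (rule sets.countable_UN', simp, clarsimp)
      fix n :: nat assume n: "Suc 0 \<le> n"
      \<comment> \<open>\<open>grid_prob\<close> concerns the configuration with the sources of
        \<open>N\<close>, so these are erased afterwards.\<close>
      have "grid_config z w h n n (P \<omega>) {} = map (\<lambda>x. (False, snd x))
          (grid_config z w h n n (P \<omega>) (N \<omega>))" for w h \<omega>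
        by (simp add: grid_config_def)
      then show "{\<omega> \<in> space M. l \<le> c n \<omega>} \<in> sets M"
        using grid_prob(1)[OF PP, of "(T - z) / real n" "t / real n"
            "\<lambda>cs. l \<le> count_true (run_columns (no_sinks n) (map (\<lambda>x. (False, snd x)) cs))" z n n]
                n True t
        by (simp add: c_def)
    qed
    finally show ?thesis .
  qed
  show ?thesis
  proof (rule measurable_count_space_eq2_countable[THEN iffD2], intro conjI ballI)
    fix l :: nat
    have "(\<lambda>\<omega>. LPP (P \<omega>) (z, 0) (T, t)) -` {l} \<inter> space M =
      {\<omega> \<in> space M. l \<le> LPP (P \<omega>) (z, 0) (T, t)} - {\<omega> \<in> space M. Suc l \<le> LPP (P \<omega>) (z, 0) (T, t)}"
          by auto
    then show "(\<lambda>\<omega>. LPP (P \<omega>) (z, 0) (T, t)) -` {l} \<inter> space M \<in> sets M" using ge by auto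
  qed auto
qed

lemma profile_measurable:
  assumes PP: "indep_poisson_pair M P N" and t: "0 < t"
  shows "(\<lambda>\<omega>. profile (P \<omega>) (N \<omega>) (T, t) z) \<in> borel_measurable M"
proof -
  have b: "bset1 {a<..b :: real}" for a b by (auto simp: bset1_def)
  have [measurable]: "(\<lambda>\<omega>. card (N \<omega> \<inter> {a<..b})) \<in> measurable M (count_space UNIV)" for a b
    by (rule card_N_measurable[OF PP b])
  have [measurable]: "(\<lambda>\<omega>. LPP (P \<omega>) (z, 0) (T, t)) \<in> measurable M (count_space UNIV)"
    by (rule LPP_measurable[OF PP t])
  have "(\<lambda>\<omega>. nu_count (N \<omega>) z) \<in> borel_measurable M" unfolding nu_count_def by measurable
  then show ?thesis unfolding profile_def by measurable
qed

text \<open>Nothing changes before the next source or point to the right of \<open>z\<close>, which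
  is at positive distance. Intervals open on the left make this include \<open>z\<close>
  itself.\<close>

lemma profile_right_constant:
  assumes lf: "locally_finite Q" "locally_finite N" and z: "z < T"
  obtains e where "0 < e" "\<And>z'. z \<le> z' \<Longrightarrow> z' < z + e \<Longrightarrow> profile Q N (T, t) z' = profile Q N (T, t) z"
proof -
  let ?A = "insert z (N \<inter> {z<..T} \<union> fst ` (Q \<inter> rect (z, 0) (T, t)))"
  have "finite ?A" using lf bounded_rect by (auto simp: locally_finite_def)
  then obtain e where e: "0 < e" "\<And>d. d < e \<Longrightarrow> gapped d ?A" by (rule finite_gapped) blast
  have far: "z' < y" if "y \<in> ?A" "z < y" "z' < z + min e (T - z)" for y z'
  proof (rule ccontr)
    assume "\<not> z' < y"
    then have "y - z < e" using that by simp
    from bspec[OF bspec[OF e(2)[OF this, unfolded gapped_def] insertI1] that(1)] that(2) show False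
      by (simp only: simp_thms less_irrefl)
  qed
  show ?thesis
  proof (rule that[of "min e (T - z)"])
    fix z' assume z': "z \<le> z'" "z' < z + min e (T - z)"
    have "N \<inter> {z<..z'} = {}"
    proof (rule equals0I)
      fix y assume y: "y \<in> N \<inter> {z<..z'}"
      have "z' \<le> T" using z'(2) by linarith
      then have "y \<in> ?A" "z < y" using y by auto
      from far[OF this z'(2)] show False using y by simp
    qed
    moreover have "Q \<inter> rect (z', 0) (T, t) = Q \<inter> rect (z, 0) (T, t)"
    proof (intro equalityI subsetI)
      fix x assume x: "x \<in> Q \<inter> rect (z, 0) (T, t)"
      then have "fst x \<in> ?A" "z < fst x" by (auto simp: rect_def)
      then have "z' < fst x" using far[OF _ _ z'(2)] by blast
      then show "x \<in> Q \<inter> rect (z', 0) (T, t)" using x by (auto simp: rect_def)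
    qed (use z' in \<open>auto simp: rect_def\<close>)
    ultimately show "profile Q N (T, t) z' = profile Q N (T, t) z"
      using nu_count_diff[OF lf(2) z'(1)] by (simp add: profile_def LPP_rect)
  qed (use e z in auto)
qed

lemma profile_Ints: "profile Q N p z \<in> \<int>"
  by (auto simp: profile_def nu_count_def)

text \<open>Profiles are integer valued, so boundedness alone makes the supremum in
  \<open>L1\<close> a maximum.\<close>

lemma bdd_above_Ints_has_max:
  fixes S :: "real set"
  assumes "S \<noteq> {}" "S \<subseteq> \<int>" "bdd_above S"
  shows "\<exists>m\<in>S. \<forall>x\<in>S. x \<le> m"
proof -
  obtain m where m: "m \<in> S" "Sup S - 1 < m" using less_cSup_iff[OF assms(1,3), of "Sup S - 1"]
      by auto
  have "x \<le> m" if "x \<in> S" for x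
  proof -
    have "x \<le> Sup S" using that assms(3) by (rule cSup_upper)
    have "x \<in> \<int>" "m \<in> \<int>" using assms(2) that m(1) by blast+
    then obtain i j :: int where ij: "x = of_int i" "m = of_int j" by (auto elim!: Ints_cases)
    have "(of_int i :: real) < of_int (j + 1)" using \<open>x \<le> Sup S\<close> m(2) ij by simp
    then have "i \<le> j" unfolding of_int_less_iff by simp
    then show ?thesis using ij by simp
  qed
  then show ?thesis using m(1) by blast
qed

text \<open>
  Profiles are locally constant to the right, so their values are all attained on this
  countable set.
\<close>

definition dense_pts :: "real \<Rightarrow> real set" where "dense_pts t = insert t (\<rat> \<inter> {..t})"

lemma countable_dense_pts: "countable (dense_pts t)"
  by (simp add: dense_pts_def countable_rat)

lemma dense_pts_approx:
  assumes lf: "locally_finite Q" "locally_finite N" and z: "z \<le> T"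
  shows "\<exists>q\<in>dense_pts T. z \<le> q \<and> profile Q N (T, t) q = profile Q N (T, t) z"
proof (cases "z = T")
  case True then show ?thesis by (auto simp: dense_pts_def)
next
  case False
  then have "z < T" using z by simp
  from profile_right_constant[OF lf this] obtain e where
    e: "0 < e" "\<And>z'. z \<le> z' \<Longrightarrow> z' < z + e \<Longrightarrow> profile Q N (T, t) z' = profile Q N (T, t) z" by blast
  obtain q where "q \<in> \<rat>" "z < q" "q < min T (z + e)"
      using Rats_dense_in_real[of z "min T (z + e)"] \<open>z < T\<close> e(1) by auto
  then show ?thesis using e(2)[of q] by (auto simp: dense_pts_def)
qed

lemma L1_profile: "L1 Q N x t = Sup (profile Q N (x, t) ` {..x})"
  by (simp add: L1_def profile_def[abs_def])

text \<open>
  \<open>Sup\<close> of an unbounded set of reals is an unspecified number, but the same one for all such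
  sets.
\<close>

lemma Sup_unbounded: "\<not> bdd_above (S :: real set) \<Longrightarrow> Sup S = Sup UNIV"
proof -
  assume "\<not> bdd_above S"
  then have "(\<lambda>z. \<forall>x\<in>S. x \<le> z) = (\<lambda>z. \<forall>x\<in>UNIV. x \<le> z)"
    by (auto simp: bdd_above_def fun_eq_iff)
  then show ?thesis by (simp add: Sup_real_def)
qed

lemma Z1_measurable:
  assumes PP: "indep_poisson_pair M P N" and t: "0 < t"
  shows "(\<lambda>\<omega>. Z1 (P \<omega>) (N \<omega>) T t) \<in> borel_measurable M"
proof (rule borel_measurable_iff_greater[THEN iffD2], rule allI)
  fix s :: real
  let ?D = "dense_pts T"
  define g where "g \<omega> = profile (P \<omega>) (N \<omega>) (T, t)" for \<omega>
  define L where "L \<omega> = L1 (P \<omega>) (N \<omega>) T t" for \<omega>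
  have gm [measurable]: "(\<lambda>\<omega>. g \<omega> q) \<in> borel_measurable M" for q
    unfolding g_def by (rule profile_measurable[OF PP t])
  have lf: "locally_finite (P \<omega>)" "locally_finite (N \<omega>)" if "\<omega> \<in> space M" for \<omega>
    using poisson_locally_finite[OF PP that] .
  have D: "\<exists>q\<in>?D. z \<le> q \<and> g \<omega> q = g \<omega> z" if "\<omega> \<in> space M" "z \<le> T" for \<omega> z
    unfolding g_def by (rule dense_pts_approx[OF lf[OF that(1)] that(2)])
  have DT: "q \<le> T" if "q \<in> ?D" for q using that by (auto simp: dense_pts_def)
  \<comment> \<open>A maximum over the countable set is a maximum over all exits. Without one, the
    integer-valued profile is unbounded and \<open>L1\<close> takes the common default
    \<open>Sup UNIV\<close>.\<close>
  have Lq: "L \<omega> = g \<omega> q \<longleftrightarrow>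
      (if \<exists>q'\<in>?D. \<forall>q''\<in>?D. g \<omega> q'' \<le> g \<omega> q' then \<forall>q''\<in>?D. g \<omega> q'' \<le> g \<omega> q else g \<omega> q = Sup UNIV)"
    if \<omega>: "\<omega> \<in> space M" and q: "q \<in> ?D" for \<omega> q
  proof (cases "\<exists>q'\<in>?D. \<forall>q''\<in>?D. g \<omega> q'' \<le> g \<omega> q'")
    case True
    then obtain q' where q': "q' \<in> ?D" "\<And>q''. q'' \<in> ?D \<Longrightarrow> g \<omega> q'' \<le> g \<omega> q'" by blast
    have "L \<omega> = g \<omega> q'" unfolding L_def L1_profile g_def[symmetric]
    proof (rule cSup_eq_maximum)
      fix x assume "x \<in> g \<omega> ` {..T}"
      then show "x \<le> g \<omega> q'" using D[OF \<omega>] q'(2) by fastforce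
    qed (use q'(1) DT in auto)
    then show ?thesis using True q' q by (auto intro: antisym)
  next
    case False
    have "\<not> bdd_above (g \<omega> ` {..T})"
    proof
      assume "bdd_above (g \<omega> ` {..T})"
      moreover have "g \<omega> ` {..T} \<subseteq> \<int>" using profile_Ints by (auto simp: g_def)
      ultimately obtain z where z: "z \<le> T" "\<And>z'. z' \<le> T \<Longrightarrow> g \<omega> z' \<le> g \<omega> z"
        using bdd_above_Ints_has_max[of "g \<omega> ` {..T}"] by auto
      from D[OF \<omega> z(1)] obtain q where "q \<in> ?D" "g \<omega> q = g \<omega> z" by blast
      then show False using False z(2) DT by metis
    qed
    then have "L \<omega> = Sup UNIV" unfolding L_def L1_profile g_def[symmetric] by (rule Sup_unbounded)
    then show ?thesis using False by auto
  qed
  have m: "{\<omega> \<in> space M. L \<omega> = g \<omega> q} \<in> sets M" if q: "q \<in> ?D" for q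
  proof -
    have c: "countable ?D" by (rule countable_dense_pts)
    have [measurable]: "Measurable.pred M (\<lambda>\<omega>. \<forall>q''\<in>?D. g \<omega> q'' \<le> g \<omega> q')" for q'
      unfolding pred_def by (rule sets.sets_Collect_countable_All'[OF _ c]) measurable
    have [measurable]: "Measurable.pred M (\<lambda>\<omega>. \<exists>q'\<in>?D. \<forall>q''\<in>?D. g \<omega> q'' \<le> g \<omega> q')"
      unfolding pred_def by (rule sets.sets_Collect_countable_Ex'[OF _ c]) measurable
    have "{\<omega> \<in> space M. L \<omega> = g \<omega> q} = {\<omega> \<in> space M. if \<exists>q'\<in>?D. \<forall>q''\<in>?D. g \<omega> q'' \<le> g \<omega> q'
        then \<forall>q''\<in>?D. g \<omega> q'' \<le> g \<omega> q else g \<omega> q = Sup UNIV}"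
      using Lq[OF _ q] by blast
    also have "\<dots> \<in> sets M" by measurable
    finally show ?thesis .
  qed
  \<comment> \<open>A point attaining \<open>L1\<close> can be moved to the right into the countable
    set. If none exists, \<open>Z1\<close> is the default \<open>Sup {}\<close>.\<close>
  have Z: "s < Z1 (P \<omega>) (N \<omega>) T t \<longleftrightarrow>
    (\<exists>q\<in>?D \<inter> {s<..}. L \<omega> = g \<omega> q) \<or> (\<forall>q\<in>?D. L \<omega> \<noteq> g \<omega> q) \<and> s < Sup ({} :: real set)"
    if \<omega>: "\<omega> \<in> space M" for \<omega>
  proof -
    let ?A = "{z. z \<le> T \<and> L \<omega> = g \<omega> z}"
    have Z1: "Z1 (P \<omega>) (N \<omega>) T t = Sup ?A" by (simp add: Z1_def L_def g_def profile_def)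
    show ?thesis
    proof (cases "?A = {}")
      case True
      then have "\<forall>q\<in>?D. L \<omega> \<noteq> g \<omega> q" using DT by blast
      then show ?thesis unfolding Z1 True by auto
    next
      case False
      then obtain z where z: "z \<le> T" "L \<omega> = g \<omega> z" by blast
      have "\<exists>q\<in>?D. L \<omega> = g \<omega> q" using D[OF \<omega> z(1)] z(2) by metis
      moreover have "s < Sup ?A \<longleftrightarrow> (\<exists>z\<in>?A. s < z)"
        by (rule less_cSup_iff[OF False]) (auto intro: bdd_aboveI[of _ T])
      moreover have "(\<exists>z\<in>?A. s < z) \<longleftrightarrow> (\<exists>q\<in>?D \<inter> {s<..}. L \<omega> = g \<omega> q)"
      proof
        assume "\<exists>z\<in>?A. s < z"
        then obtain z where "z \<le> T" "L \<omega> = g \<omega> z" "s < z" by blast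
        with D[OF \<omega>, of z] obtain q where "q \<in> ?D" "z \<le> q" "L \<omega> = g \<omega> q" by auto
        then show "\<exists>q\<in>?D \<inter> {s<..}. L \<omega> = g \<omega> q" using \<open>s < z\<close> by auto
      qed (use DT in auto)
      ultimately show ?thesis unfolding Z1 by blast
    qed
  qed
  have "{\<omega> \<in> space M. s < Z1 (P \<omega>) (N \<omega>) T t} =
    (\<Union>q\<in>?D \<inter> {s<..}. {\<omega> \<in> space M. L \<omega> = g \<omega> q}) \<union>
    (if s < Sup ({} :: real set) then space M - (\<Union>q\<in>?D. {\<omega> \<in> space M. L \<omega> = g \<omega> q}) else {})"
    using Z by auto
  also have "\<dots> \<in> sets M"
    using m countable_dense_pts[of T] by (auto intro!: sets.Un sets.countable_UN' sets.Diff)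
  finally show "{\<omega> \<in> space M. s < Z1 (P \<omega>) (N \<omega>) T t} \<in> sets M" .
qed

section \<open>From the grid to the Poisson process\<close>

text \<open>An unbounded profile forces the flux through the right edge above every
  \<open>K\<close>, for all long strips and fine meshes. This has probability at most
  \<open>t / K\<close>, uniformly in the strip.\<close>

lemma profile_bounded_AE:
  assumes PP: "indep_poisson_pair M P N" and t: "0 < t"
  shows "\<exists>U\<in>sets M. measure M U = 0 \<and>
    {\<omega> \<in> space M. \<not> bdd_above (profile (P \<omega>) (N \<omega>) (T, t) ` {..T})} \<subseteq> U"
proof -
  interpret prob_space M by (rule poisson_prob_space[OF PP])
  let ?g = "\<lambda>\<omega>. profile (P \<omega>) (N \<omega>) (T, t)"
  define c where "c l n \<omega> = count_true (run_columns (no_sinks n)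
      (grid_config (T - real l) (1 / real n) (t / real n) (l * n) n (P \<omega>) (N \<omega>)))"
    for l n \<omega>
  define A where "A K l n = (if n = 0 then space M else {\<omega> \<in> space M. real K \<le> real (c l n \<omega>)})"
      for K l n :: nat
  \<comment> \<open>The mesh is refined first for a fixed strip length \<open>l\<close>; then the
    strip grows. Both limits preserve the bound \<open>t / K\<close>.\<close>
  define W where "W K l = {\<omega> \<in> space M. \<forall>\<^sub>F n in sequentially. \<omega> \<in> A K l n}" for K l :: nat
  define V where "V K = {\<omega> \<in> space M. \<forall>\<^sub>F l in sequentially. \<omega> \<in> W K l}" for K :: nat
  have Am: "A K l n \<in> sets M" for K l n
    using grid_prob(1)[OF PP, of "1 / real n" "t / real n" "\<lambda>cs. real K
        \<le> real (count_true (run_columns (no_sinks n) cs))"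
        "T - real l" "l * n" n] t by (simp add: A_def c_def)
  have Ap: "measure M (A K l n) \<le> t / real K" if K: "0 < K" and n: "0 < n" for K l n
  proof -
    define w h where "w = 1 / real n" and "h = t / real n"
    \<comment> \<open>\<open>\<beta>\<close> is the odds of the sink parameter in equilibrium with
      \<open>a\<close>. The estimate \<open>\<beta> \<le> h\<close> keeps the mean number of sinks
      at most \<open>t\<close>.\<close>
    define a p \<beta> where "a = 1 - exp (- w)" and "p = 1 - exp (- (w * h))" and "\<beta> = p / (exp w - 1)"
    have wh: "0 < w" "0 < h" using n t by (auto simp: w_def h_def)
    have a: "0 \<le> a" "a \<le> 1" and p: "0 \<le> p" "p \<le> 1" "p \<le> w * h"
      using wh exp_ge_add_one_self[of "- (w * h)"] by (auto simp: a_def p_def)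
    have ew: "w \<le> exp w - 1" using exp_ge_add_one_self[of w] by linarith
    have \<beta>: "0 \<le> \<beta>" "\<beta> \<le> h"
    proof -
      show "0 \<le> \<beta>" using p ew wh by (simp add: \<beta>_def)
      have "h * w \<le> h * (exp w - 1)" by (rule mult_left_mono[OF ew]) (use wh in simp)
      then have "p \<le> h * (exp w - 1)" using p(3) mult.commute[of w h] by linarith
      then show "\<beta> \<le> h" using ew wh by (simp add: \<beta>_def divide_le_eq)
    qed
    define b where "b = \<beta> / (1 + \<beta>)"
    have b: "0 \<le> b" "b \<le> 1" "b \<le> h"
    proof -
      have "b \<le> \<beta>" using \<beta>(1) by (simp add: b_def divide_le_eq) (simp add: field_simps)
      then show "b \<le> h" using \<beta> by simp
    qed (use \<beta> in \<open>auto simp: b_def\<close>)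
    have ab: "a * b = p * (1 - a) * (1 - b)"
    proof -
      have "1 - b = 1 / (1 + \<beta>)" using \<beta>(1) by (simp add: b_def field_simps)
      moreover have "a * \<beta> = p * (1 - a)"
        using ew wh by (simp add: a_def \<beta>_def exp_minus field_simps)
      ultimately show ?thesis by (simp add: b_def)
    qed
    have "measure M (A K l n) = iter_mean (l * n) (col_mean a p n)
        (\<lambda>cs. of_bool (real K \<le> real (count_true (run_columns (no_sinks n) cs))))"
      using grid_prob(2)[OF PP wh, of "\<lambda>cs. real K
          \<le> real (count_true (run_columns (no_sinks n) cs))" "T - real l" "l * n" n] n
      by (simp add: A_def c_def a_def p_def w_def h_def)
    also have "\<dots> \<le> real n * b / real K" by (rule overflow_bound[OF p(1,2) a b(1,2) ab]) (use K
        in simp)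
    also have "\<dots> \<le> t / real K"
    proof -
      have "real n * b \<le> real n * h" using b by (intro mult_left_mono) auto
      then show ?thesis using K n by (intro divide_right_mono) (auto simp: h_def)
    qed
    finally show ?thesis .
  qed
  have W: "W K l \<in> sets M" "0 < K \<Longrightarrow> measure M (W K l) \<le> t / real K" for K l
  proof -
    show "W K l \<in> sets M" unfolding W_def using Am by auto
    show "measure M (W K l) \<le> t / real K" if "0 < K"
      unfolding W_def
      by (rule liminf_measure(2)[OF prob_space_axioms Am _ tendsto_const])
        (rule eventually_mono[OF eventually_gt_at_top[of 0]], rule Ap[OF that])
  qed
  have V: "V K \<in> sets M" "0 < K \<Longrightarrow> measure M (V K) \<le> t / real K" for K
  proof -
    show "V K \<in> sets M" unfolding V_def using W(1) by auto
    show "measure M (V K) \<le> t / real K" if "0 < K"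
      unfolding V_def
      by (rule liminf_measure(2)[OF prob_space_axioms W(1) _ tendsto_const])
          (simp add: W(2)[OF that])
  qed
  let ?U = "\<Inter>K\<in>{1..}. V K"
  have Um: "?U \<in> sets M" using V(1) by (intro sets.countable_INT') auto
  have "measure M ?U \<le> t / real K" if "0 < K" for K
  proof -
    have "measure M ?U \<le> measure M (V K)" using that by (intro finite_measure_mono V(1)) auto
    then show ?thesis using V(2)[OF that] by simp
  qed
  then have "measure M ?U \<le> 0"
    by (intro LIMSEQ_le_const[OF lim_const_over_n[of t]] exI[of _ 1]) auto
  then have U0: "measure M ?U = 0" by (simp add: measure_le_0_iff)
  have "\<omega> \<in> V K" if \<omega>: "\<omega> \<in> space M" and unb: "\<not> bdd_above (?g \<omega> ` {..T})" for \<omega> and K :: nat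
  proof -
    have lf: "locally_finite (P \<omega>)" "locally_finite (N \<omega>)"
        by (rule poisson_locally_finite[OF PP \<omega>])+
    obtain z where z: "z \<le> T" "real K + nu_count (N \<omega>) T \<le> ?g \<omega> z"
    proof -
      from unb obtain x where "x \<in> ?g \<omega> ` {..T}" "\<not> x \<le> real K + nu_count (N \<omega>) T"
        unfolding bdd_above_def by blast
      then show ?thesis using that by auto
    qed
    have "\<omega> \<in> W K l" if l: "nat \<lceil>T - z\<rceil> \<le> l" "1 \<le> l" for l
    proof -
      have zl: "T - real l \<le> z" using l(1) by linarith
      have "\<forall>\<^sub>F n in sequentially. good_grid (T - real l) (1 / real n) (t / real n) (l * n) n
          (P \<omega>) (N \<omega>)"
        by (rule eventually_good_grid[OF lf]) (use t in auto)
      then have "\<forall>\<^sub>F n in sequentially. \<omega> \<in> A K l n" using eventually_gt_at_top[of 0]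
      proof eventually_elim
        case (elim n)
        then have eq: "T = T - real l + real (l * n) * (1 / real n)" "real n * (t / real n) = t"
            by auto
        have "?g \<omega> z - nu_count (N \<omega>) T \<le> real (c l n \<omega>)"
          using profile_le_count_true[OF lf _ _ elim(1) eq(1) zl z(1)] elim(2) t
              unfolding c_def eq(2) by simp
        then show ?case using z(2) elim(2) \<omega> by (simp add: A_def)
      qed
      then show ?thesis using \<omega> by (simp add: W_def)
    qed
    then show ?thesis unfolding V_def using \<omega>
      by (auto simp: eventually_sequentially intro!: exI[of _ "max 1 (nat \<lceil>T - z\<rceil>)"])
  qed
  then show ?thesis using Um U0 by (intro bexI[of _ ?U]) auto
qed

text \<open>
  The left half-plane is cut at distance \<open>32 (t - u)\<close>, far enough for the coalescence error
  to be at most \<open>exp (- 2 t)\<close> when \<open>u \<le> t / 2\<close>.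
\<close>

lemma exit_prob_le:
  assumes PP: "indep_poisson_pair M P N" and u: "u < t" and t: "0 < t"
    and B: "\<forall>\<^sub>F n in sequentially. iter_mean (32 * n + n)
        (col_mean (1 - exp (- ((t - u) / real n))) (1 - exp (- ((t - u) / real n * (t / real n))))
            n)
        (\<lambda>cs. of_bool (sink_lpp (run_columns (no_sinks n) (take (32 * n) cs)) (drop (32 * n) cs) \<le>
            source_lpp n (drop (32 * n) cs))) \<le> B n"
    and lim: "B \<longlonglongrightarrow> c"
  shows "measure M {\<omega> \<in> space M. u < Z1 (P \<omega>) (N \<omega>) t t} \<le> c"
proof -
  interpret prob_space M by (rule poisson_prob_space[OF PP])
  let ?g = "\<lambda>\<omega>. profile (P \<omega>) (N \<omega>) (t, t)"
  define a where "a = t - u"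
  define R where "R n cs \<longleftrightarrow> sink_lpp (run_columns (no_sinks n) (take (32 * n) cs))
      (drop (32 * n) cs) \<le> source_lpp n (drop (32 * n) cs)" for n cs
  define cs where "cs n \<omega> = grid_config (u - 32 * a) (a / real n) (t / real n) (32 * n
      + n) n (P \<omega>) (N \<omega>)" for n \<omega>
  define A where "A n = (if n = 0 then space M else {\<omega> \<in> space M. R n (cs n \<omega>)})" for n
  have a: "0 < a" using u by (simp add: a_def)
  have Am: "A n \<in> sets M" for n
    using grid_prob(1)[OF PP, of "a / real n" "t / real n" "R n" "u - 32 * a" "32 * n + n" n] a t
    by (simp add: A_def cs_def)
  have Ap: "\<forall>\<^sub>F n in sequentially. measure M (A n) \<le> B n"
    using B eventually_gt_at_top[of 0]
  proof eventually_elim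
    case (elim n)
    then have "0 < a / real n" "0 < t / real n" using a t by auto
    from grid_prob(2)[OF PP this, of "R n" "u - 32 * a" "32 * n + n" n] elim
    show ?case by (simp add: A_def cs_def R_def a_def)
  qed
  obtain U where U: "U \<in> sets M" "measure M U = 0"
    "{\<omega> \<in> space M. \<not> bdd_above (?g \<omega> ` {..t})} \<subseteq> U"
    using profile_bounded_AE[OF PP t, of t] by blast
  let ?E = "{\<omega> \<in> space M. \<forall>\<^sub>F n in sequentially. \<omega> \<in> A n}"
  have E: "?E \<in> sets M" "measure M ?E \<le> c"
    using liminf_measure[OF prob_space_axioms Am Ap lim] Am by auto
  have "{\<omega> \<in> space M. u < Z1 (P \<omega>) (N \<omega>) t t} \<subseteq> U \<union> ?E"
  proof
    fix \<omega> assume "\<omega> \<in> {\<omega> \<in> space M. u < Z1 (P \<omega>) (N \<omega>) t t}"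
    then have \<omega>: "\<omega> \<in> space M" and Z: "u < Z1 (P \<omega>) (N \<omega>) t t" by auto
    have lf: "locally_finite (P \<omega>)" "locally_finite (N \<omega>)"
        by (rule poisson_locally_finite[OF PP \<omega>])+
    show "\<omega> \<in> U \<union> ?E"
    proof (cases "bdd_above (?g \<omega> ` {..t})")
      case False then show ?thesis using \<omega> by (intro UnI1 subsetD[OF U(3)]) simp
    next
      case True
      have "?g \<omega> ` {..t} \<subseteq> \<int>" using profile_Ints by auto
      then obtain z0 where z0: "z0 \<le> t" "\<And>z. z \<le> t \<Longrightarrow> ?g \<omega> z \<le> ?g \<omega> z0"
        using bdd_above_Ints_has_max[OF _ _ True] by auto
      have L: "L1 (P \<omega>) (N \<omega>) t t = ?g \<omega> z0"
        unfolding L1_profile by (rule cSup_eq_maximum) (use z0 in auto)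
      let ?A = "{z. z \<le> t \<and> ?g \<omega> z0 = ?g \<omega> z}"
      have "Z1 (P \<omega>) (N \<omega>) t t = Sup ?A" unfolding Z1_def L by (simp add: profile_def)
      moreover have "?A \<noteq> {}" using z0(1) by blast
      moreover have "bdd_above ?A" by (auto intro: bdd_aboveI[of _ t])
      ultimately obtain z where z: "z \<le> t" "?g \<omega> z0 = ?g \<omega> z" "u < z"
        using Z less_cSup_iff[of ?A u] by auto
      have "\<forall>\<^sub>F n in sequentially. good_grid (u - 32 * a) (a / real n) (t / real n) (33 * n) n
          (P \<omega>) (N \<omega>)"
        by (rule eventually_good_grid[OF lf a t])
      then have "\<forall>\<^sub>F n in sequentially. \<omega> \<in> A n" using eventually_gt_at_top[of 0]
      proof eventually_elim
        case (elim n)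
        \<comment> \<open>Thirty-two blocks of width \<open>a\<close> lie to the left of
          \<open>u\<close> and one between \<open>u\<close> and \<open>t\<close>.\<close>
        have m: "33 * n = 32 * n + n" by simp
        have eq: "u = u - 32 * a + real (32 * n) * (a / real n)"
          "t = u - 32 * a + real (32 * n + n) * (a / real n)" "real n * (t / real n) = t"
          using elim(2) by (auto simp: a_def field_simps)
        have pos: "0 < a / real n" "0 < t / real n" using elim(2) a t by auto
        have "R n (cs n \<omega>)" unfolding R_def cs_def
          by (rule sink_lpp_le_source_lpp[OF lf pos elim(1)[unfolded m] eq(1,2) z(3,1)])
              (use z0 z(2) eq(3) in auto)
        then show ?case using \<omega> elim(2) by (simp add: A_def)
      qed
      then show ?thesis using \<omega> by simp
    qed
  qed
  then have "measure M {\<omega> \<in> space M. u < Z1 (P \<omega>) (N \<omega>) t t} \<le> measure M (U \<union> ?E)"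
    using U(1) E(1) by (intro finite_measure_mono) auto
  also have "\<dots> \<le> measure M U + measure M ?E" by (rule measure_Un_le[OF U(1) E(1)])
  finally show ?thesis using U(2) E(2) by simp
qed

text \<open>Attaining points never exceed \<open>t\<close>. Only the default \<open>Sup {}\<close>
  could be larger, and it occurs only for an unbounded profile.\<close>

lemma exit_prob_0:
  assumes PP: "indep_poisson_pair M P N" and t: "0 < t" "t \<le> u"
  shows "measure M {\<omega> \<in> space M. u < Z1 (P \<omega>) (N \<omega>) t t} = 0"
proof -
  interpret prob_space M by (rule poisson_prob_space[OF PP])
  let ?g = "\<lambda>\<omega>. profile (P \<omega>) (N \<omega>) (t, t)"
  obtain U where U: "U \<in> sets M" "measure M U = 0"
    "{\<omega> \<in> space M. \<not> bdd_above (?g \<omega> ` {..t})} \<subseteq> U"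
    using profile_bounded_AE[OF PP t(1), of t] by blast
  have "{\<omega> \<in> space M. u < Z1 (P \<omega>) (N \<omega>) t t} \<subseteq> U"
  proof (rule ccontr)
    assume "\<not> ?thesis"
    then obtain \<omega> where \<omega>: "\<omega> \<in> space M" "u < Z1 (P \<omega>) (N \<omega>) t t" "\<omega> \<notin> U" by auto
    have bdd: "bdd_above (?g \<omega> ` {..t})"
    proof (rule ccontr)
      assume "\<not> ?thesis"
      then have "\<omega> \<in> U" using \<omega>(1) by (intro subsetD[OF U(3)]) simp
      then show False using \<omega>(3) by simp
    qed
    have "?g \<omega> ` {..t} \<subseteq> \<int>" using profile_Ints by auto
    then obtain z0 where z0: "z0 \<le> t" "\<And>z. z \<le> t \<Longrightarrow> ?g \<omega> z \<le> ?g \<omega> z0"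
      using bdd_above_Ints_has_max[OF _ _ bdd] by auto
    have L: "L1 (P \<omega>) (N \<omega>) t t = ?g \<omega> z0"
      unfolding L1_profile by (rule cSup_eq_maximum) (use z0 in auto)
    have "Z1 (P \<omega>) (N \<omega>) t t \<le> t"
      unfolding Z1_def L by (rule cSup_least) (use z0(1) in \<open>auto simp: profile_def\<close>)
    then show False using \<omega>(2) t(2) by simp
  qed
  then have "measure M {\<omega> \<in> space M. u < Z1 (P \<omega>) (N \<omega>) t t} \<le> measure M U"
    using U(1) by (intro finite_measure_mono) auto
  then show ?thesis using U(2) by (simp add: measure_le_0_iff)
qed

text \<open>The positive part is bounded by \<open>t\<close>, or by the default
  \<open>Sup {}\<close> on outcomes where \<open>L1\<close> is not attained.\<close>

lemma Z1plus_integrable: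
  assumes PP: "indep_poisson_pair M P N" and t: "0 < t"
  shows "integrable M (\<lambda>\<omega>. Z1plus (P \<omega>) (N \<omega>) t t)"
proof -
  interpret prob_space M by (rule poisson_prob_space[OF PP])
  have m [measurable]: "(\<lambda>\<omega>. Z1 (P \<omega>) (N \<omega>) t t) \<in> borel_measurable M"
      by (rule Z1_measurable[OF PP t])
  have "norm (Z1plus (P \<omega>) (N \<omega>) t t) \<le> max t \<bar>Sup {}\<bar>" for \<omega>
  proof -
    let ?A = "{z. z \<le> t \<and> L1 (P \<omega>) (N \<omega>) t t = nu_count (N \<omega>) z + real (LPP (P \<omega>) (z, 0) (t, t))}"
    have "Z1 (P \<omega>) (N \<omega>) t t \<le> max t \<bar>Sup {}\<bar>"
    proof (cases "?A = {}")
      case True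
      then have "Z1 (P \<omega>) (N \<omega>) t t = Sup {}" unfolding Z1_def by (simp only:)
      then show ?thesis by simp
    next
      case False
      have "Z1 (P \<omega>) (N \<omega>) t t \<le> t" unfolding Z1_def by (rule cSup_least[OF False]) simp
      then show ?thesis by simp
    qed
    then show ?thesis using t by (auto simp: Z1plus_def)
  qed
  then show ?thesis
    by (intro integrable_const_bound[of _ "max t \<bar>Sup {}\<bar>"]) (auto simp: Z1plus_def[abs_def])
qed

section \<open>Exponents and limits\<close>

lemma ln_one_plus_le_cubic:
  fixes y :: real assumes "0 \<le> y" shows "ln (1 + y) \<le> y - y\<^sup>2 / 2 + y ^ 3 / 3"
proof -
  define f where "f x = x - x\<^sup>2 / 2 + x ^ 3 / 3 - ln (1 + x)" for x :: real
  have "f 0 \<le> f y"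
  proof (rule DERIV_nonneg_imp_nondecreasing[OF assms])
    fix x :: real assume x: "0 \<le> x" "x \<le> y"
    have "(f has_real_derivative (1 - x + x\<^sup>2 - 1 / (1 + x))) (at x)"
      unfolding f_def using x by (auto intro!: derivative_eq_intros simp: power2_eq_square)
    moreover have "1 - x + x\<^sup>2 - 1 / (1 + x) = x ^ 3 / (1 + x)"
      using x by (simp add: field_simps power2_eq_square power3_eq_cube)
    ultimately show "\<exists>D. (f has_real_derivative D) (at x) \<and> 0 \<le> D" using x by auto
  qed
  then show ?thesis by (simp add: f_def)
qed

lemma ln_one_minus_le_cubic:
  fixes y :: real assumes "0 \<le> y" "y < 1" shows "ln (1 - y) \<le> - y - y\<^sup>2 / 2 - y ^ 3 / 3"
proof -
  define f where "f x = - x - x\<^sup>2 / 2 - x ^ 3 / 3 - ln (1 - x)" for x :: real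
  have "f 0 \<le> f y"
  proof (rule DERIV_nonneg_imp_nondecreasing[OF assms(1)])
    fix x :: real assume x: "0 \<le> x" "x \<le> y"
    have "(f has_real_derivative (- 1 - x - x\<^sup>2 + 1 / (1 - x))) (at x)"
      unfolding f_def using x assms(2) by (auto intro!: derivative_eq_intros simp: power2_eq_square)
    moreover have "- 1 - x - x\<^sup>2 + 1 / (1 - x) = x ^ 3 / (1 - x)"
      using x assms(2) by (simp add: field_simps power2_eq_square power3_eq_cube)
    ultimately show "\<exists>D. (f has_real_derivative D) (at x) \<and> 0 \<le> D" using x assms(2) by auto
  qed
  then show ?thesis by (simp add: f_def)
qed

lemma inverse_one_plus_le:
  fixes y :: real assumes "0 \<le> y" shows "1 / (1 + y) \<le> 1 - y + y\<^sup>2 - y ^ 3 + y ^ 4"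
proof -
  have "(1 - y + y\<^sup>2 - y ^ 3 + y ^ 4) * (1 + y) = 1 + y ^ 5"
    by (simp add: algebra_simps eval_nat_numeral)
  then show ?thesis using assms by (simp add: divide_le_eq)
qed

lemma inverse_one_minus_le:
  fixes y :: real assumes "0 \<le> y" "y \<le> 1 / 2" shows "1 / (1 - y) \<le> 1 + y + y\<^sup>2 + y ^ 3 + 2 * y ^ 4"
proof -
  have "(1 + y + y\<^sup>2 + y ^ 3 + 2 * y ^ 4) * (1 - y) = 1 + y ^ 4 * (1 - 2 * y)"
    by (simp add: algebra_simps eval_nat_numeral)
  moreover have "0 \<le> y ^ 4 * (1 - 2 * y)" using assms by simp
  ultimately show ?thesis using assms by (simp add: divide_le_eq)
qed

text \<open>
  With source rate \<open>1 + y d\<close>, sink rate \<open>1 - z d\<close> and threshold \<open>2 - d - 3 d\<^sup>2 / 16\<close> the two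
  exponents are \<open>(f z - f y) d\<^sup>3\<close> and \<open>- f y d\<^sup>3\<close> up to fourth order in \<open>d\<close>, where
  \<open>f x = x (x - 3/4)\<^sup>2 / 3\<close>. The choice \<open>y = 1/4\<close>, \<open>z = 3/4\<close> makes both equal to
  \<open>- d\<^sup>3 / 48\<close>.
\<close>

lemma source_deviation_exponent:
  fixes d :: real assumes d: "0 < d" "d \<le> 1 / 40"
  shows "(2 - d - 3 * d\<^sup>2 / 16) * ln ((1 + d / 4) * (1 - 3 * d / 4))
     + (1 - d) * (1 / (1 - 3 * d / 4) - (1 + d / 4)) + (1 / (1 + d / 4) - (1 - 3 * d / 4)) \<le>
         - (d ^ 3 / 96)"
proof -
  define e n where "e = d / 4" and "n = 3 * d / 4"
  have en: "0 \<le> e" "0 \<le> n" "n \<le> 1 / 2" "n < 1" using d by (auto simp: e_def n_def)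
  have d2: "d\<^sup>2 \<le> 1" using d by (simp add: power_le_one)
  have K: "0 \<le> 2 - d - 3 * d\<^sup>2 / 16" using d d2 by simp
  have "ln ((1 + e) * (1 - n)) = ln (1 + e) + ln (1 - n)" using en by (intro ln_mult_pos) auto
  also have "\<dots> \<le> (e - e\<^sup>2 / 2 + e ^ 3 / 3) + (- n - n\<^sup>2 / 2 - n ^ 3 / 3)"
    using en by (intro add_mono ln_one_plus_le_cubic ln_one_minus_le_cubic)
  finally have "(2 - d - 3 * d\<^sup>2 / 16) * ln ((1 + e) * (1 - n))
      \<le> (2 - d - 3 * d\<^sup>2 / 16) * ((e - e\<^sup>2 / 2 + e ^ 3 / 3) + (- n - n\<^sup>2 / 2 - n ^ 3 / 3))"
    using K by (rule mult_left_mono)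
  moreover have "(1 - d) * (1 / (1 - n) - (1 + e))
      \<le> (1 - d) * ((1 + n + n\<^sup>2 + n ^ 3 + 2 * n ^ 4) - (1 + e))"
    using inverse_one_minus_le[OF en(2,3)] d by (intro mult_left_mono) auto
  moreover have "1 / (1 + e) - (1 - n) \<le> (1 - e + e\<^sup>2 - e ^ 3 + e ^ 4) - (1 - n)"
    using inverse_one_plus_le[OF en(1)] by simp
  ultimately have "(2 - d - 3 * d\<^sup>2 / 16) * ln ((1 + e) * (1 - n))
      + (1 - d) * (1 / (1 - n) - (1 + e)) + (1 / (1 + e) - (1 - n))
     \<le> (2 - d - 3 * d\<^sup>2 / 16) * ((e - e\<^sup>2 / 2 + e ^ 3 / 3) + (- n - n\<^sup>2 / 2 - n ^ 3 / 3))
      + (1 - d) * ((1 + n + n\<^sup>2 + n ^ 3 + 2 * n ^ 4) - (1 + e)) +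
          ((1 - e + e\<^sup>2 - e ^ 3 + e ^ 4) - (1 - n))"
    by (intro add_mono)
  also have "\<dots> = d ^ 3 * (- 1 / 48 + 157 / 384 * d - 311 / 512 * d\<^sup>2)"
    unfolding e_def n_def by (simp add: field_simps eval_nat_numeral)
  also have "\<dots> \<le> d ^ 3 * (- 1 / 96)"
  proof (rule mult_left_mono)
    \<comment> \<open>This requires \<open>d \<le> 4 / 157\<close>, which explains the restriction
      to \<open>1 / 40\<close>.\<close>
    show "- 1 / 48 + 157 / 384 * d - 311 / 512 * d\<^sup>2 \<le> - 1 / 96" using d zero_le_power2[of d]
        by linarith
  qed (use d in simp)
  finally show ?thesis by (simp add: e_def n_def)
qed

lemma total_deviation_exponent:
  fixes d :: real assumes d: "0 < d" "d \<le> 1 / 40"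
  shows "(2 - d - 3 * d\<^sup>2 / 16) * ln (1 + d / 4) + (1 - d) * (1 - (1 + d / 4))
      + (1 / (1 + d / 4) - 1) \<le> - (d ^ 3 / 96)"
proof -
  define e where "e = d / 4"
  have en: "0 \<le> e" using d by (auto simp: e_def)
  have d2: "d\<^sup>2 \<le> 1" using d by (simp add: power_le_one)
  have K: "0 \<le> 2 - d - 3 * d\<^sup>2 / 16" using d d2 by simp
  have "(2 - d - 3 * d\<^sup>2 / 16) * ln (1 + e) \<le> (2 - d - 3 * d\<^sup>2 / 16) * (e - e\<^sup>2 / 2 + e ^ 3 / 3)"
    using K ln_one_plus_le_cubic[OF en] by (rule mult_left_mono[rotated])
  moreover have "1 / (1 + e) - 1 \<le> (1 - e + e\<^sup>2 - e ^ 3 + e ^ 4) - 1"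
    using inverse_one_plus_le[OF en(1)] by simp
  ultimately have "(2 - d - 3 * d\<^sup>2 / 16) * ln (1 + e) + (1 - d) * (1 - (1 + e)) + (1 / (1 + e) - 1)
     \<le> (2 - d - 3 * d\<^sup>2 / 16) * (e - e\<^sup>2 / 2 + e ^ 3 / 3) + (1 - d) * (1 - (1 + e)) +
         ((1 - e + e\<^sup>2 - e ^ 3 + e ^ 4) - 1)"
    by simp
  also have "\<dots> = d ^ 3 * (- 1 / 48 + 7 / 1536 * d - 1 / 1024 * d\<^sup>2)"
    unfolding e_def by (simp add: field_simps eval_nat_numeral)
  also have "\<dots> \<le> d ^ 3 * (- 1 / 96)"
  proof (rule mult_left_mono)
    show "- 1 / 48 + 7 / 1536 * d - 1 / 1024 * d\<^sup>2 \<le> - 1 / 96" using d zero_le_power2[of d]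
        by linarith
  qed (use d in simp)
  finally show ?thesis by (simp add: e_def)
qed

text \<open>Grid version of source rate \<open>r\<close> and sink rate \<open>s\<close>.
  \<open>X\<close> is the odds of the source parameter stationary for \<open>b\<close>, and
  \<open>\<phi>\<close> divides it by the odds \<open>exp (r * w) - 1\<close> of \<open>a\<close>.
  The exponential bounds hold at every mesh and only \<open>\<phi>\<close> needs a limit.\<close>

lemma tilt_rates:
  fixes p w h r s :: real
  assumes p: "0 < p" "p \<le> w * h" and wh: "0 < w" "0 < h" and rates: "0 < r" "0 < s"
  defines "X \<equiv> p / (exp (s * h) - 1)"
  defines "\<phi> \<equiv> X / (exp (r * w) - 1)" and "c \<equiv> exp (- (r * w)) * (1 + X)"
    and "a \<equiv> 1 - exp (- (r * w))" and "b \<equiv> 1 - exp (- (s * h))"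
  shows "0 < \<phi>" "a * \<phi> = c * (X / (1 + X))" "1 - a = c * (1 - X / (1 + X))"
    "(X / (1 + X)) * b = p * (1 - X / (1 + X)) * (1 - b)"
    "0 \<le> c" "c \<le> exp (w * (1 / s - r))" "0 \<le> 1 - b + b * \<phi>" "1 - b + b * \<phi> \<le> exp (h * (1 / r - s))"
    "0 \<le> a" "a \<le> 1" "0 \<le> b" "b \<le> 1"
proof -
  have e1: "r * w \<le> exp (r * w) - 1" using exp_ge_add_one_self[of "r * w"] by linarith
  have e2: "s * h \<le> exp (s * h) - 1" using exp_ge_add_one_self[of "s * h"] by linarith
  have pos: "0 < r * w" "0 < s * h" using wh rates by auto
  have X: "0 < X" using p e2 pos by (simp add: X_def)
  have Xe: "X * (exp (s * h) - 1) = p" using e2 pos unfolding X_def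
      by (intro nonzero_eq_divide_eq[THEN iffD1] refl) linarith
  have \<phi>e: "\<phi> * (exp (r * w) - 1) = X" using e1 pos unfolding \<phi>_def
      by (intro nonzero_eq_divide_eq[THEN iffD1] refl) linarith
  show "0 < \<phi>" using X e1 pos by (simp add: \<phi>_def)
  have a: "a = exp (- (r * w)) * (exp (r * w) - 1)" by (simp add: a_def algebra_simps flip: exp_add)
  have b: "b = exp (- (s * h)) * (exp (s * h) - 1)" by (simp add: b_def algebra_simps flip: exp_add)
  have 1: "(1 + X) * (X / (1 + X)) = X" "(1 + X) * (1 - X / (1 + X)) = 1" using X
      by (auto simp: field_simps)
  have "a * \<phi> = exp (- (r * w)) * X" unfolding a \<phi>e[symmetric] by (simp add: algebra_simps)
  then show "a * \<phi> = c * (X / (1 + X))" unfolding c_def by (simp only: mult.assoc 1)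
  show "1 - a = c * (1 - X / (1 + X))" unfolding c_def mult.assoc 1 by (simp add: a_def)
  have 2: "1 - X / (1 + X) = 1 / (1 + X)" using X by (simp add: field_simps)
  have "X * b = p * (1 - b)" unfolding b Xe[symmetric] by (simp add: algebra_simps flip: exp_add)
  then show "(X / (1 + X)) * b = p * (1 - X / (1 + X)) * (1 - b)" unfolding 2 by simp
  show "0 \<le> c" using X by (simp add: c_def)
  have "X \<le> w / s"
  proof -
    have "p \<le> (w / s) * (s * h)" using p(2) rates by simp
    also have "\<dots> \<le> (w / s) * (exp (s * h) - 1)" using e2 wh rates by (intro mult_left_mono) auto
    finally show ?thesis using e2 pos by (simp add: X_def divide_le_eq)
  qed
  then have "1 + X \<le> exp (w / s)" using exp_ge_add_one_self[of "w / s"] by linarith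
  then have "c \<le> exp (- (r * w)) * exp (w / s)" unfolding c_def by (intro mult_left_mono) auto
  also have "\<dots> = exp (w * (1 / s - r))" by (simp add: algebra_simps flip: exp_add)
  finally show "c \<le> exp (w * (1 / s - r))" .
  define Y where "Y = p / (exp (r * w) - 1)"
  have Y: "0 \<le> Y" using p e1 pos by (simp add: Y_def)
  have "b * \<phi> = exp (- (s * h)) * Y" unfolding b \<phi>_def Y_def Xe[symmetric] by simp
  then have eq: "1 - b + b * \<phi> = exp (- (s * h)) * (1 + Y)" by (simp add: b_def algebra_simps)
  show "0 \<le> 1 - b + b * \<phi>" unfolding eq using Y by simp
  have "Y \<le> h / r"
  proof -
    have "p \<le> (h / r) * (r * w)" using p(2) rates by (simp add: mult.commute)
    also have "\<dots> \<le> (h / r) * (exp (r * w) - 1)" using e1 wh rates by (intro mult_left_mono) auto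
    finally show ?thesis using e1 pos by (simp add: Y_def divide_le_eq)
  qed
  then have "1 + Y \<le> exp (h / r)" using exp_ge_add_one_self[of "h / r"] by linarith
  then have "1 - b + b * \<phi> \<le> exp (- (s * h)) * exp (h / r)" unfolding eq
      by (intro mult_left_mono) auto
  also have "\<dots> = exp (h * (1 / r - s))" by (simp add: algebra_simps flip: exp_add)
  finally show "1 - b + b * \<phi> \<le> exp (h * (1 / r - s))" .
  show "0 \<le> a" "a \<le> 1" "0 \<le> b" "b \<le> 1" using pos by (auto simp: a_def b_def)
qed

lemma tendsto_tilt:
  fixes r s a t :: real
  assumes "0 < r" "0 < s" "0 < a" "0 < t"
  shows "(\<lambda>n. (1 - exp (- (a / real n * (t / real n)))) / (exp (s * (t / real n)) - 1) /
      (exp (r * (a / real n)) - 1))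
    \<longlonglongrightarrow> 1 / (r * s)"
proof -
  have "(\<lambda>n. (1 - exp (- (a / real n * (t / real n)))) / (exp (s * (t / real n)) - 1) /
      (exp (r * (a / real n)) - 1))
    \<longlonglongrightarrow> a * t * (inverse s * inverse t) * (inverse r * inverse a)"
    using assms by real_asymp
  also have "a * t * (inverse s * inverse t) * (inverse r * inverse a) = 1 / (r * s)"
    using assms by (simp add: field_simps)
  finally show ?thesis .
qed

text \<open>The limit of the probability that equilibrium sinks for source rate 1 leave the whole
  edge empty. Their parameter is fixed by the sources, so the unit sink rate appears only in the
  limit.\<close>

lemma tendsto_stationary_mgf:
  fixes a t :: real
  assumes "0 < a" "0 < t"
  shows "(\<lambda>n. (1 / (1 + (1 - exp (- (a / real n * (t / real n)))) / (exp (a / real n) - 1))) ^ n)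
      \<longlonglongrightarrow> exp (- t)"
proof -
  define f where "f n = (1 - exp (- (a / real n * (t / real n)))) / (exp (a / real n) - 1)"
      for n :: nat
  have lim: "(\<lambda>n. real n * ln (1 + f n)) \<longlonglongrightarrow> a * t * inverse a"
    unfolding f_def using assms by real_asymp
  have pos: "\<forall>\<^sub>F n in sequentially. 0 < 1 + f n"
    using eventually_gt_at_top[of 0]
  proof eventually_elim
    case (elim n)
    have "0 \<le> f n" unfolding f_def using assms elim by (intro divide_nonneg_nonneg) auto
    then show ?case by simp
  qed
  have "(\<lambda>n. exp (- (real n * ln (1 + f n)))) \<longlonglongrightarrow> exp (- (a * t * inverse a))"
    by (intro tendsto_intros lim)
  moreover have "\<forall>\<^sub>F n in sequentially. exp (- (real n * ln (1 + f n))) = (1 / (1 + f n)) ^ n"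
    using pos by eventually_elim (simp add: exp_minus exp_of_nat_mult inverse_eq_divide
        power_one_over)
  ultimately have "(\<lambda>n. (1 / (1 + f n)) ^ n) \<longlonglongrightarrow> exp (- (a * t * inverse a))"
    by (rule Lim_transform_eventually)
  moreover have "a * t * inverse a = t" using assms by (simp add: field_simps)
  ultimately show ?thesis by (simp only: f_def)
qed

section \<open>The tail of the exit point\<close>

text \<open>The three terms are the errors of large source paths, of small total height and of
  coalescence.\<close>

lemma grid_bound:
  fixes w h r s K :: real
  assumes wh: "0 < w" "0 < h" and r: "1 \<le> r" and s: "0 < s"
  defines "p \<equiv> 1 - exp (- (w * h))"
  defines "\<beta> \<equiv> p / (exp w - 1)"
  defines "\<phi> \<equiv> p / (exp (s * h) - 1) / (exp (r * w) - 1)"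
    and "\<psi> \<equiv> (exp w - 1) / (exp (r * w) - 1)"
    and "\<theta> \<equiv> p / (exp (2 * h) - 1) / (exp (1 / 4 * w) - 1)"
  assumes \<phi>: "1 \<le> \<phi>" and \<theta>: "1 \<le> \<theta>"
  shows "iter_mean (32 * n + n) (col_mean (1 - exp (- w)) p n)
      (\<lambda>cs. of_bool (sink_lpp (run_columns (no_sinks n) (take (32 * n) cs)) (drop (32 * n) cs) \<le>
          source_lpp n (drop (32 * n) cs)))
    \<le> \<phi> powr (- K) * (exp (real n * w * (1 / s - r)) * exp (real n * h * (1 / r - s)))
      + \<psi> powr (- K) * (exp (real n * w * (1 - r)) * (exp (real n * h / r) * (1 / (1 + \<beta>)) ^ n))
      + exp (- (32 * (real n * (1 - exp (- w))) * (1 - 1 / \<theta>))) *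
          (exp (8 * (real n * w)) * exp (2 * (real n * h)))"
proof -
  have p: "0 < p" "p \<le> 1" "p \<le> w * h" "p \<le> h * w"
    using wh exp_ge_add_one_self[of "- (w * h)"] by (auto simp: p_def mult.commute)
  have r0: "0 < r" using r by simp
  define a b where "a = 1 - exp (- w)" and "b = \<beta> / (1 + \<beta>)"
  have ew: "w \<le> exp w - 1" using exp_ge_add_one_self[of w] by linarith
  have erw: "exp w - 1 \<le> exp (r * w) - 1" "0 < exp (r * w) - 1" using wh r by auto
  have \<beta>: "0 < \<beta>" using p ew wh by (simp add: \<beta>_def)
  have \<beta>h: "\<beta> \<le> h"
  proof -
    have "h * w \<le> h * (exp w - 1)" by (rule mult_left_mono[OF ew]) (use wh in simp)
    then have "p \<le> h * (exp w - 1)" using p(4) by linarith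
    then show ?thesis using ew wh by (simp add: \<beta>_def divide_le_eq)
  qed
  have a: "0 \<le> a" "a \<le> 1" using wh by (auto simp: a_def)
  have b: "0 \<le> b" "b \<le> 1" using \<beta> by (auto simp: b_def)
  have b1: "1 - b = 1 / (1 + \<beta>)" using \<beta> by (simp add: b_def field_simps)
  \<comment> \<open>The balance equation is symmetric in \<open>a\<close> and \<open>b\<close>;
    hence \<open>tilt_rates\<close> is used with \<open>w\<close> and \<open>h\<close>
    exchanged.\<close>
  have ab: "a * b = p * (1 - a) * (1 - b)"
    using tilt_rates(4)[OF p(1,4) wh(2,1) zero_less_one zero_less_one]
    unfolding a_def b_def \<beta>_def by (simp add: mult.commute mult.left_commute)
  note T = tilt_rates[OF p(1,3) wh r0 s]
  \<comment> \<open>Auxiliary rates for coalescence. Their product 1/2 gives a tilt near 2. With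
    \<open>a\<close> and \<open>t\<close> for \<open>real n * w\<close> and
    \<open>real n * h\<close>, the cost is \<open>exp (8 * a + 2 * t)\<close> against a gain of
    about \<open>exp (- 16 * a)\<close> from the sources.\<close>
  note C = tilt_rates[OF p(1,3) wh, of "1 / 4" 2, simplified]
  let ?a' = "1 - exp (- (r * w))" and ?X = "p / (exp (s * h) - 1)" and ?b2 = "1 - exp (- (s * h))"
  let ?c = "exp (- (r * w)) * (1 + ?X)" and ?d = "exp (w - r * w)"
  have \<psi>: "0 < \<psi>" "\<psi> \<le> 1" using ew wh erw by (auto simp: \<psi>_def)
  have a\<psi>: "?a' * \<psi> = ?d * a" "1 - ?a' = ?d * (1 - a)"
  proof -
    have "?a' = exp (- (r * w)) * (exp (r * w) - 1)" by (simp add: algebra_simps flip: exp_add)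
    then have "?a' * \<psi> = exp (- (r * w)) * (exp w - 1)" using wh r0 by (simp add: \<psi>_def)
    also have "\<dots> = ?d * a" by (simp add: a_def algebra_simps flip: exp_add)
    finally show "?a' * \<psi> = ?d * a" .
    show "1 - ?a' = ?d * (1 - a)" by (simp add: a_def flip: exp_add)
  qed
  have aa': "a \<le> ?a'" using r wh by (simp add: a_def)
  have Q: "iter_mean n (bern_mean b) (\<lambda>J. iter_mean n (col_mean a p n)
      (\<lambda>cs. of_bool (sink_lpp J cs \<le> source_lpp n cs)))
      \<le> \<phi> powr (- K) * (?c ^ n * (1 - ?b2 + ?b2 * \<phi>) ^ n) + \<psi> powr (- K) *
          (?d ^ n * (1 - b + b * \<psi>) ^ n)"
    by (rule quadrant_bound[OF less_imp_le[OF p(1)] p(2) a(1) aa' T(10) b ab T(11,12,4)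
        \<phi>[unfolded \<phi>_def, folded \<phi>_def]])
       (use T(2,3) a\<psi> \<psi> in \<open>auto simp: \<phi>_def\<close>)
  have Q1: "?c ^ n * (1 - ?b2 + ?b2 * \<phi>) ^ n \<le> exp (real n * w * (1 / s - r)) * exp
      (real n * h * (1 / r - s))"
  proof (rule mult_mono)
    have "?c ^ n \<le> exp (w * (1 / s - r)) ^ n" by (rule power_mono[OF T(6,5)])
    also have "\<dots> = exp (real n * w * (1 / s - r))" by (simp add: mult.assoc flip: exp_of_nat_mult)
    finally show "?c ^ n \<le> exp (real n * w * (1 / s - r))" .
    have "(1 - ?b2 + ?b2 * \<phi>) ^ n \<le> exp (h * (1 / r - s)) ^ n"
      unfolding \<phi>_def by (rule power_mono[OF T(8,7)])
    also have "\<dots> = exp (real n * h * (1 / r - s))" by (simp add: mult.assoc flip: exp_of_nat_mult)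
    finally show "(1 - ?b2 + ?b2 * \<phi>) ^ n \<le> exp (real n * h * (1 / r - s))" .
    show "0 \<le> (1 - ?b2 + ?b2 * \<phi>) ^ n" unfolding \<phi>_def by (rule zero_le_power[OF T(7)])
  qed simp
  have Q2: "?d ^ n * (1 - b + b * \<psi>) ^ n \<le> exp (real n * w * (1 - r)) *
      (exp (real n * h / r) * (1 / (1 + \<beta>)) ^ n)"
  proof -
    define Y where "Y = p / (exp (r * w) - 1)"
    have Y: "0 \<le> Y" using p erw by (simp add: Y_def)
    have "\<beta> * \<psi> = Y" using ew wh by (simp add: \<beta>_def \<psi>_def Y_def)
    then have "1 - b + b * \<psi> = (1 + Y) * (1 / (1 + \<beta>))" unfolding b1
        by (simp add: b_def add_divide_distrib)
    moreover have "1 + Y \<le> exp (h / r)"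
    proof -
      have "r * w \<le> exp (r * w) - 1" using exp_ge_add_one_self[of "r * w"] by linarith
      then have "(h / r) * (r * w) \<le> (h / r) * (exp (r * w) - 1)" using wh r0
          by (intro mult_left_mono) auto
      then have "p \<le> (h / r) * (exp (r * w) - 1)" using p(4) r0 by simp
      then have "Y \<le> h / r" using erw by (simp add: Y_def divide_le_eq)
      then show ?thesis using exp_ge_add_one_self[of "h / r"] by linarith
    qed
    then have "(1 + Y) ^ n \<le> exp (real n * h / r)"
      using power_mono[of "1 + Y" "exp (h / r)" n] Y by (simp flip: exp_of_nat_mult)
    moreover have "?d ^ n = exp (real n * w * (1 - r))"
        by (simp add: algebra_simps flip: exp_of_nat_mult)
    ultimately show ?thesis using \<beta> by (simp only: power_mult_distrib)
        (intro mult_left_mono mult_right_mono; simp)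
  qed
  let ?a3 = "1 - exp (- (w / 4))" and ?b3 = "1 - exp (- (2 * h))" and ?X3 = "p / (exp (2 * h) - 1)"
  let ?e = "exp (- (w / 4)) * (1 + ?X3)"
  have bb3: "b \<le> ?b3"
  proof -
    have "1 + \<beta> \<le> exp h" using \<beta>h exp_ge_add_one_self[of h] by linarith
    also have "\<dots> \<le> exp (2 * h)" using wh by simp
    finally have "exp (- (2 * h)) \<le> 1 / (1 + \<beta>)" using \<beta>
        by (simp add: exp_minus inverse_eq_divide frac_le)
    then show ?thesis using b1 by linarith
  qed
  have \<theta>': "\<theta> = ?X3 / (exp (w / 4) - 1)" by (simp add: \<theta>_def)
  have Cc: "iter_mean n (bern_mean b) (\<lambda>J. iter_mean (32 * n) (col_mean a p n)
      (\<lambda>cs. of_bool (run_columns (no_sinks n) cs \<noteq> run_columns J cs)))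
    \<le> (1 - a + a / \<theta>) ^ (32 * n) * (?e ^ (32 * n) * (1 - ?b3 + ?b3 * \<theta>) ^ n)"
    by (rule coalescence_bound[where a'' = "?X3 / (1 + ?X3)" and a' = ?a3])
       (use p a b bb3 C \<theta> in \<open>auto simp: \<theta>'\<close>)
  have C1: "(1 - a + a / \<theta>) ^ (32 * n) \<le> exp (- (32 * (real n * a) * (1 - 1 / \<theta>)))"
  proof -
    have "0 \<le> (1 - a) + a / \<theta>" using a \<theta> by (intro add_nonneg_nonneg) auto
    moreover have "1 - a + a / \<theta> \<le> exp (- (a * (1 - 1 / \<theta>)))"
      using exp_ge_add_one_self[of "- (a * (1 - 1 / \<theta>))"] by (simp add: algebra_simps)
    ultimately have "(1 - a + a / \<theta>) ^ (32 * n) \<le> exp (- (a * (1 - 1 / \<theta>))) ^ (32 * n)"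
        by (intro power_mono)
    also have "\<dots> = exp (- (32 * (real n * a) * (1 - 1 / \<theta>)))"
        by (simp add: algebra_simps flip: exp_of_nat_mult)
    finally show ?thesis .
  qed
  have C2: "?e ^ (32 * n) \<le> exp (8 * (real n * w))"
  proof -
    have "?e \<le> exp (w * (1 / 2 - 1 / 4))" "0 \<le> ?e" using C by auto
    then have "?e ^ (32 * n) \<le> exp (w * (1 / 2 - 1 / 4)) ^ (32 * n)" by (rule power_mono)
    also have "\<dots> = exp (8 * (real n * w))" by (simp flip: exp_of_nat_mult)
    finally show ?thesis .
  qed
  have C3: "(1 - ?b3 + ?b3 * \<theta>) ^ n \<le> exp (2 * (real n * h))" "0 \<le> (1 - ?b3 + ?b3 * \<theta>) ^ n"
  proof -
    have *: "1 - ?b3 + ?b3 * \<theta> \<le> exp (h * (1 / (1 / 4) - 2))" "0 \<le> 1 - ?b3 + ?b3 * \<theta>"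
      using C unfolding \<theta>' by auto
    then have "(1 - ?b3 + ?b3 * \<theta>) ^ n \<le> exp (h * (1 / (1 / 4) - 2)) ^ n" by (rule power_mono)
    also have "\<dots> = exp (2 * (real n * h))" by (simp add: algebra_simps flip: exp_of_nat_mult)
    finally show "(1 - ?b3 + ?b3 * \<theta>) ^ n \<le> exp (2 * (real n * h))" .
    show "0 \<le> (1 - ?b3 + ?b3 * \<theta>) ^ n" using *(2) by (rule zero_le_power)
  qed
  have Cc': "iter_mean n (bern_mean b) (\<lambda>J. iter_mean (32 * n) (col_mean a p n)
      (\<lambda>cs. of_bool (run_columns (no_sinks n) cs \<noteq> run_columns J cs)))
    \<le> exp (- (32 * (real n * a) * (1 - 1 / \<theta>))) * (exp (8 * (real n * w)) * exp (2 * (real n * h)))"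
    using p(1) by (intro order_trans[OF Cc] mult_mono C1 C2 C3 mult_nonneg_nonneg zero_le_power)
      (auto intro: less_imp_le divide_nonneg_nonneg simp: wh less_imp_le add_nonneg_nonneg)
  have Q': "iter_mean n (bern_mean b) (\<lambda>J. iter_mean n (col_mean a p n)
      (\<lambda>cs. of_bool (sink_lpp J cs \<le> source_lpp n cs)))
    \<le> \<phi> powr (- K) * (exp (real n * w * (1 / s - r)) * exp (real n * h * (1 / r - s)))
      + \<psi> powr (- K) * (exp (real n * w * (1 - r)) * (exp (real n * h / r) * (1 / (1 + \<beta>)) ^ n))"
    by (intro order_trans[OF Q] add_mono mult_left_mono Q1 Q2) auto
  show ?thesis
    using halfplane_bound[OF less_imp_le[OF p(1)] p(2) a b ab Q' Cc'] by (simp add: a_def)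
qed

text \<open>Each of the three errors is at most \<open>exp (- (t * d ^ 3 / 96))\<close> in the
  limit. Then \<open>exp (- y) \<le> 1 / y\<close> gives the constant
  \<open>288 = 3 * 96\<close>.\<close>

lemma exit_tail_small:
  assumes PP: "indep_poisson_pair M P N" and u: "0 < u" "u \<le> t / 40"
  shows "measure M {\<omega> \<in> space M. u < Z1 (P \<omega>) (N \<omega>) t t} \<le> 288 * (t\<^sup>2 / u ^ 3)"
proof -
  have t: "0 < t" "u < t" using u by auto
  define d where "d = u / t"
  define r s K a where "r = 1 + d / 4" and "s = 1 - 3 * d / 4"
    and "K = t * (2 - d - 3 * d\<^sup>2 / 16)" and "a = t - u"
  have d: "0 < d" "d \<le> 1 / 40" using u t by (auto simp: d_def field_simps)
  have rs: "1 \<le> r" "0 < r" "0 < s" using d by (auto simp: r_def s_def)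
  have a: "0 < a" "a = t * (1 - d)" using t by (auto simp: a_def d_def field_simps)
  define w h where "w n = a / real n" and "h n = t / real n" for n
  define p where "p n = 1 - exp (- (w n * h n))" for n
  define \<phi> \<psi> \<theta> \<beta> where "\<phi> n = p n / (exp (s * h n) - 1) / (exp (r * w n) - 1)"
    and "\<psi> n = (exp (w n) - 1) / (exp (r * w n) - 1)"
    and "\<theta> n = p n / (exp (2 * h n) - 1) / (exp (1 / 4 * w n) - 1)"
    and "\<beta> n = p n / (exp (w n) - 1)" for n
  define B where "B n = \<phi> n powr (- K) * (exp (a * (1 / s - r)) * exp (t * (1 / r - s)))
      + \<psi> n powr (- K) * (exp (a * (1 - r)) * (exp (t / r) * (1 / (1 + \<beta> n)) ^ n))
      + exp (- (32 * (real n * (1 - exp (- w n))) * (1 - 1 / \<theta> n))) * (exp (8 * a) * exp (2 * t))"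
          for n
  have \<phi>: "\<phi> \<longlonglongrightarrow> 1 / (r * s)"
    using tendsto_tilt[OF rs(2,3) a(1) t(1)] unfolding \<phi>_def p_def w_def h_def .
  have \<theta>: "\<theta> \<longlonglongrightarrow> 2"
    using tendsto_tilt[of "1 / 4" 2 a t] a(1) t(1) unfolding \<theta>_def p_def w_def h_def by simp
  have \<psi>: "\<psi> \<longlonglongrightarrow> 1 / r"
  proof -
    have "\<psi> \<longlonglongrightarrow> a * (inverse r * inverse a)" unfolding \<psi>_def w_def using a(1) rs(2) by real_asymp
    then show ?thesis using a(1) rs(2) by (simp add: field_simps)
  qed
  have \<beta>: "(\<lambda>n. (1 / (1 + \<beta> n)) ^ n) \<longlonglongrightarrow> exp (- t)"
    using tendsto_stationary_mgf[OF a(1) t(1)] unfolding \<beta>_def p_def w_def h_def .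
  have nw: "(\<lambda>n. real n * (1 - exp (- w n))) \<longlonglongrightarrow> a" unfolding w_def by real_asymp
  have rs1: "r * s < 1" using d by (simp add: r_def s_def algebra_simps power2_eq_square)
      (simp add: add_pos_pos)
  have ev: "\<forall>\<^sub>F n in sequentially. 1 < \<phi> n" "\<forall>\<^sub>F n in sequentially. 1 < \<theta> n"
    using order_tendstoD(1)[OF \<phi>, of 1] order_tendstoD(1)[OF \<theta>, of 1] rs rs1 by auto
  have lim: "B \<longlonglongrightarrow> (1 / (r * s)) powr (- K) * (exp (a * (1 / s - r)) * exp (t * (1 / r - s)))
      + (1 / r) powr (- K) * (exp (a * (1 - r)) * (exp (t / r) * exp (- t)))
      + exp (- (32 * a * (1 - 1 / 2))) * (exp (8 * a) * exp (2 * t))"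
    unfolding B_def using rs by (intro tendsto_intros \<phi> \<psi> \<theta> \<beta> nw) auto
  have "measure M {\<omega> \<in> space M. u < Z1 (P \<omega>) (N \<omega>) t t} \<le>
      (1 / (r * s)) powr (- K) * (exp (a * (1 / s - r)) * exp (t * (1 / r - s)))
      + (1 / r) powr (- K) * (exp (a * (1 - r)) * (exp (t / r) * exp (- t)))
      + exp (- (32 * a * (1 - 1 / 2))) * (exp (8 * a) * exp (2 * t))"
  proof (rule exit_prob_le[OF PP t(2,1) _ lim])
    show "\<forall>\<^sub>F n in sequentially. iter_mean (32 * n + n)
        (col_mean (1 - exp (- ((t - u) / real n))) (1 - exp (- ((t - u) / real n * (t / real n))))
            n)
        (\<lambda>cs. of_bool (sink_lpp (run_columns (no_sinks n) (take (32 * n) cs)) (drop (32 * n) cs) \<le>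
            source_lpp n (drop (32 * n) cs))) \<le> B n"
      using ev eventually_gt_at_top[of 0]
    proof eventually_elim
      case (elim n)
      have n: "0 < w n" "0 < h n" "real n * w n = a" "real n * h n = t"
        using elim(3) a(1) t(1) by (auto simp: w_def h_def)
      show ?case
        using grid_bound[OF n(1,2) rs(1,3), of n K] elim(1,2)
        unfolding B_def n(3,4) \<phi>_def \<psi>_def \<theta>_def \<beta>_def p_def by (simp add: w_def h_def a_def)
    qed
  qed
  also have "\<dots> \<le> 3 * exp (- (t * d ^ 3 / 96))"
  proof -
    have powr: "(1 / x) powr (- K) = exp (K * ln x)" if "0 < x" for x
      using that by (simp add: powr_def ln_div)
    have "(1 / (r * s)) powr (- K) * (exp (a * (1 / s - r)) * exp (t * (1 / r - s)))
       = exp (t * ((2 - d - 3 * d\<^sup>2 / 16) * ln (r * s) + (1 - d) * (1 / s - r) + (1 / r - s)))"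
      using powr[of "r * s"] rs by (simp add: K_def a(2) distrib_left mult.assoc flip: exp_add)
    also have "\<dots> \<le> exp (t * - (d ^ 3 / 96))"
      using mult_left_mono[OF source_deviation_exponent[OF d], of t] t unfolding r_def s_def by simp
    finally have 1: "(1 / (r * s)) powr (- K) * (exp (a * (1 / s - r)) * exp (t * (1 / r - s)))
        \<le> exp (t * - (d ^ 3 / 96))" .
    have "(1 / r) powr (- K) * (exp (a * (1 - r)) * (exp (t / r) * exp (- t)))
       = exp (t * ((2 - d - 3 * d\<^sup>2 / 16) * ln r + (1 - d) * (1 - r) + (1 / r - 1)))"
    proof -
      have "K * ln r + (a * (1 - r) + (t / r + - t))
          = t * ((2 - d - 3 * d\<^sup>2 / 16) * ln r + (1 - d) * (1 - r) + (1 / r - 1))"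
        unfolding K_def a(2) by (simp add: algebra_simps)
      then show ?thesis using powr[of r] rs by (simp only: exp_add[symmetric])
    qed
    also have "\<dots> \<le> exp (t * - (d ^ 3 / 96))"
      using mult_left_mono[OF total_deviation_exponent[OF d], of t] t unfolding r_def s_def by simp
    finally have 2: "(1 / r) powr (- K) * (exp (a * (1 - r)) * (exp (t / r) * exp (- t)))
        \<le> exp (t * - (d ^ 3 / 96))" .
    have "exp (- (32 * a * (1 - 1 / 2))) * (exp (8 * a) * exp (2 * t)) = exp (2 * t - 8 * a)"
      by (simp flip: exp_add)
    also have "\<dots> \<le> exp (t * - (d ^ 3 / 96))"
    proof -
      have "t * d ^ 3 \<le> t * 1" using d t power_le_one[of d 3] by (intro mult_left_mono) auto
      moreover have "t / 2 \<le> a" using u by (simp add: a_def)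
      ultimately have "2 * t - 8 * a \<le> t * - (d ^ 3 / 96)" using t by linarith
      then show ?thesis by (simp only: exp_le_cancel_iff)
    qed
    finally show ?thesis using 1 2 by simp
  qed
  also have "\<dots> \<le> 3 * (96 / (t * d ^ 3))"
  proof -
    define y where "y = t * d ^ 3 / 96"
    have "0 < y" using t d by (simp add: y_def)
    moreover have "y \<le> exp y" using exp_ge_add_one_self[of y] by linarith
    ultimately have "exp (- y) \<le> 1 / y" by (simp add: exp_minus inverse_eq_divide frac_le)
    then show ?thesis by (simp add: y_def)
  qed
  also have "\<dots> = 288 * (t\<^sup>2 / u ^ 3)" using t u
      by (simp add: d_def field_simps power2_eq_square power3_eq_cube)
  finally show ?thesis .
qed

text \<open>For \<open>u\<close> between \<open>t / 40\<close> and \<open>t\<close> the bound at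
  \<open>t / 40\<close> is reused, at the price \<open>40 ^ 3\<close>, so that
  \<open>18432000 = 288 * 40 ^ 3\<close>.\<close>

lemma exit_tail:
  assumes PP: "indep_poisson_pair M P N" and u: "0 < u" and t: "0 < t"
  shows "measure M {\<omega> \<in> space M. u < Z1 (P \<omega>) (N \<omega>) t t} \<le> 18432000 * (t\<^sup>2 / u ^ 3)"
proof -
  interpret prob_space M by (rule poisson_prob_space[OF PP])
  consider "u \<le> t / 40" | "t / 40 < u" "u < t" | "t \<le> u" by linarith
  then show ?thesis
  proof cases
    case 1
    have "0 \<le> t\<^sup>2 / u ^ 3" using u by simp
    then show ?thesis using exit_tail_small[OF PP u 1] by linarith
  next
    case 2
    have m: "{\<omega> \<in> space M. t / 40 < Z1 (P \<omega>) (N \<omega>) t t} \<in> sets M"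
      using Z1_measurable[OF PP t, of t] by measurable
    have "measure M {\<omega> \<in> space M. u < Z1 (P \<omega>) (N \<omega>) t t}
        \<le> measure M {\<omega> \<in> space M. t / 40 < Z1 (P \<omega>) (N \<omega>) t t}"
      using 2 by (intro finite_measure_mono m) auto
    also have "\<dots> \<le> 288 * (t\<^sup>2 / (t / 40) ^ 3)" by (rule exit_tail_small[OF PP]) (use t in auto)
    also have "\<dots> = 18432000 * (t\<^sup>2 / t ^ 3)" by (simp add: power_divide)
    also have "\<dots> \<le> 18432000 * (t\<^sup>2 / u ^ 3)"
      using 2 u t by (intro mult_left_mono divide_left_mono power_mono) auto
    finally show ?thesis .
  next
    case 3
    then show ?thesis using exit_prob_0[OF PP t 3] u by simp
  qed
qed

theorem theorem5p9:
  shows "\<exists>c1>0. \<forall>(M :: 'a measure) P N (t::real) (r::real).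
     indep_poisson_pair M P N \<longrightarrow> t > 0 \<longrightarrow> r > 0 \<longrightarrow>
     (let EZ = (\<integral>\<omega>. Z1plus (P \<omega>) (N \<omega>) t t \<partial>M) in
       measure M {\<omega> \<in> space M. Z1 (P \<omega>) (N \<omega>) t t > r * EZ}
         \<le> c1 * t ^ 2 / EZ ^ 3 * (1 / r ^ 3 + 1 / r ^ 4))"
proof (intro exI[of _ 18432000] conjI allI impI)
  fix M :: "'a measure" and P N and t r :: real
  assume PP: "indep_poisson_pair M P N" and t: "0 < t" and r: "0 < r"
  interpret prob_space M by (rule poisson_prob_space[OF PP])
  define EZ where "EZ = (\<integral>\<omega>. Z1plus (P \<omega>) (N \<omega>) t t \<partial>M)"
  have nonneg: "0 \<le> Z1plus (P \<omega>) (N \<omega>) t t" for \<omega> by (simp add: Z1plus_def)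
  then have EZ: "0 \<le> EZ" unfolding EZ_def by simp
  have "measure M {\<omega> \<in> space M. Z1 (P \<omega>) (N \<omega>) t t > r * EZ}
      \<le> 18432000 * t ^ 2 / EZ ^ 3 * (1 / r ^ 3 + 1 / r ^ 4)"
  proof (cases "EZ = 0")
    \<comment> \<open>here the right-hand side is 0, because division by 0 yields 0\<close>
    case True
    \<comment> \<open>Integrability matters here, because a non-integrable function would have
      integral 0 by convention.\<close>
    then have "AE \<omega> in M. Z1plus (P \<omega>) (N \<omega>) t t = 0"
      using integral_nonneg_eq_0_iff_AE[OF Z1plus_integrable[OF PP t]] nonneg by (simp add: EZ_def)
    then have "AE \<omega> in M. \<not> 0 < Z1 (P \<omega>) (N \<omega>) t t"
        by eventually_elim (simp add: Z1plus_def max_def split: if_splits)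
    moreover have "{\<omega> \<in> space M. 0 < Z1 (P \<omega>) (N \<omega>) t t} \<in> sets M"
      using Z1_measurable[OF PP t, of t] by measurable
    ultimately have "measure M {\<omega> \<in> space M. 0 < Z1 (P \<omega>) (N \<omega>) t t} = 0"
      by (subst prob_eq_0) auto
    then show ?thesis using True by simp
  next
    case False
    then have "0 < r * EZ" using EZ r by simp
    from exit_tail[OF PP this t]
    have "measure M {\<omega> \<in> space M. Z1 (P \<omega>) (N \<omega>) t t > r * EZ} \<le> 18432000 * (t\<^sup>2 / (r * EZ) ^ 3)" .
    also have "\<dots> = 18432000 * t\<^sup>2 / EZ ^ 3 * (1 / r ^ 3)"
        by (simp add: power_mult_distrib mult.commute)
    also have "\<dots> \<le> 18432000 * t\<^sup>2 / EZ ^ 3 * (1 / r ^ 3 + 1 / r ^ 4)"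
      using EZ r by (intro mult_left_mono) auto
    finally show ?thesis .
  qed
  then show "let EZ = (\<integral>\<omega>. Z1plus (P \<omega>) (N \<omega>) t t \<partial>M) in
       measure M {\<omega> \<in> space M. Z1 (P \<omega>) (N \<omega>) t t > r * EZ}
         \<le> 18432000 * t ^ 2 / EZ ^ 3 * (1 / r ^ 3 + 1 / r ^ 4)"
    by (simp only: Let_def EZ_def)
qed simp

end
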